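(* Let $0\le T_0<T_1\le+\infty$ and let $\Gamma$ be a network with Hamiltonians $\{H_\gamma\}$ as described in the context. For any continuous initial datum $g:\Gamma\to\mathbb{R}$ and any flux limiter $x\mapsto c_x$, there exists a uniformly continuous solution $u:\Gamma\times[T_0,T_1)\to\mathbb{R}$ of (HJ$\Gamma$) in $(T_0,T_1)$ with $u(\cdot,T_0)=g$.
   Context: Network. $\Gamma=\bigcup_{\gamma\in\mathcal{E}}\gamma([0,1])\subset\mathbb{R}^N$, where $\mathcal{E}$ is a finite collection of arcs, i.e. simple $C^1$ curves $\gamma:[0,1]\to\mathbb{R}^N$ with nonvanishing derivative. Together with each arc $\gamma$ one also considers its inverse arc $-\gamma(s)=\gamma(1-s)$ (so the collection of arcs is regarded as closed under inversion). It is assumed that $\gamma((0,1))\cap\gamma'([0,1])=\emptyset$ whenever $\gamma'\ne\gamma$, $\gamma'\neq-\gamma$. Vertices are the initial and terminal points of arcs; $\mathbf{V}$ is the set of vertices. The network is connected (any two vertices are linked by a finite concatenation of arcs) and has no loops ($\gamma(0)\ne\gamma(1)$ for every arc). For $x\in\mathbf{V}$, $\Gamma_x=\{\gamma : \gamma(1)=x\}$. Hamiltonians. For each arc $\gamma$ a function $H_\gamma:[0,1]\times\mathbb{R}\to\mathbb{R}$ is given, with $H_{-\gamma}(s,p)=H_\gamma(1-s,-p)$. Each $H_\gamma$ is continuous in $(s,p)$, convex in $p$, coercive in $p$ uniformly in $s$, and for every $M>0$ there is $C_M$ with $H_\gamma(s,p)-H_\gamma(s,q)\le C_M|p-q|$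 for all $s\in[0,1]$, $p,q\in(-M,M)$. Set $c_\gamma=-\max_{s\in[0,1]}\min_{p\in\mathbb{R}}H_\gamma(s,p)$. A flux limiter is a function $x\mapsto c_x$ from $\mathbf{V}$ to $\mathbb{R}$ with $c_x\le\min_{\gamma\in\Gamma_x}c_\gamma$ for all $x$. Equation. For $v:\Gamma\times[T_0,T_1)\to\mathbb{R}$ put $(v\circ\gamma)(s,t)=v(\gamma(s),t)$; $'$ denotes the derivative in $s$ and subscript $t$ that in $t$. (HJ$_\gamma$) is $w_t+H_\gamma(s,w')=0$ in $(0,1)\times(T_0,T_1)$. A subtangent (resp. supertangent) to a function at a point is a $C^1$ function $\varphi$ such that (function $-\varphi$) has a local minimum (resp. maximum) at that point; it is constrained to a closed set $C$ if the point is a minimizer (resp. maximizer) only relative to a neighborhood of it intersected with $C$. A continuous $v:\Gamma\times[T_0,T_1)\to\mathbb{R}$ is a supersolution of (HJ$\Gamma$) in $(T_0,T_1)$ if (i) $v\circ\gamma$ is a viscosity supersolution of (HJ$_\gamma$) for every arc $\gamma$; (ii) for every $x\in\mathbf{V}$, $t_0\in(T_0,T_1)$: if some $C^1$ subtangent $\phi$ to $v(x,\cdot)$ at $t_0$ satisfies $\frac{d}{dt}\phi(t_0)<c_x$, then there is an arc $\gamma\in\Gamma_x$ such that all $C^1$ subtangents $\varphi$, constrained to $[0,1]\times\overline{(T_0,T_1)}$, to $v\circ\gamma$ at $(1,t_0)$ satisfy $\varphi_t(1,t_0)+H_\gamma(1,\varphi'(1,t_0))\ge0$. It is a subsolution of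 (HJ$\Gamma$) in $(T_0,T_1)$ if (i) $v\circ\gamma$ is a viscosity subsolution of (HJ$_\gamma$) for every arc $\gamma$; (ii) for every $x\in\mathbf{V}$, $t_0\in(T_0,T_1)$, all $C^1$ supertangents $\psi$ to $v(x,\cdot)$ at $t_0$ satisfy $\frac{d}{dt}\psi(t_0)\le c_x$. A solution is a continuous function that is both a subsolution and a supersolution. *)

theory Defs
  imports "HOL-Analysis.Analysis"
begin

section \<open>Networks\<close>

text \<open>
  An arc is a total function on the reals of which only the values on \<open>[0,1]\<close> matter.
  Two members of \<open>E\<close> that agree on \<open>[0,1]\<close> are nevertheless equal, by the disjointness condition
  and the absence of loops in \<open>network\<close>. The inverse arc is \<^const>\<open>reversepath\<close>.
  Derivatives at the endpoints are one-sided.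
\<close>

definition C1_regular :: "(real \<Rightarrow> 'a::real_normed_vector) \<Rightarrow> bool" where
  "C1_regular \<gamma> \<longleftrightarrow>
     (\<exists>D. (\<forall>s\<in>{0..1}. (\<gamma> has_vector_derivative D s) (at s within {0..1}) \<and> D s \<noteq> 0)
          \<and> continuous_on {0..1} D)"

definition vertices :: "(real \<Rightarrow> 'a::euclidean_space) set \<Rightarrow> 'a set" where
  "vertices E = pathstart ` E \<union> pathfinish ` E"

definition network_set :: "(real \<Rightarrow> 'a::euclidean_space) set \<Rightarrow> 'a set" where
  "network_set E = (\<Union>\<gamma>\<in>E. path_image \<gamma>)"

definition arcs_into :: "(real \<Rightarrow> 'a::euclidean_space) set \<Rightarrow> 'a \<Rightarrow> (real \<Rightarrow> 'a) set" where
  "arcs_into E x = {\<gamma>\<in>E. pathfinish \<gamma> = x}"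

definition network :: "(real \<Rightarrow> 'a::euclidean_space) set \<Rightarrow> bool" where
  "network E \<longleftrightarrow>
     finite E \<and>
     (\<forall>\<gamma>\<in>E. simple_path \<gamma> \<and> C1_regular \<gamma> \<and> reversepath \<gamma> \<in> E) \<and>
     (\<forall>\<gamma>\<in>E. \<forall>\<gamma>'\<in>E. \<gamma>' \<noteq> \<gamma> \<and> \<gamma>' \<noteq> reversepath \<gamma> \<longrightarrow> \<gamma> ` {0<..<1} \<inter> path_image \<gamma>' = {}) \<and>
     (\<forall>x\<in>vertices E. \<forall>y\<in>vertices E. (x, y) \<in> {(pathstart \<gamma>, pathfinish \<gamma>) | \<gamma>. \<gamma> \<in> E}\<^sup>*) \<and>
     (\<forall>\<gamma>\<in>E. pathstart \<gamma> \<noteq> pathfinish \<gamma>)"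


section \<open>Hamiltonians and flux limiters\<close>

definition hamiltonians ::
    "(real \<Rightarrow> 'a::euclidean_space) set \<Rightarrow> ((real \<Rightarrow> 'a) \<Rightarrow> real \<Rightarrow> real \<Rightarrow> real) \<Rightarrow> bool" where
  "hamiltonians E H \<longleftrightarrow> (\<forall>\<gamma>\<in>E.
     (\<forall>s\<in>{0..1}. \<forall>p. H (reversepath \<gamma>) s p = H \<gamma> (1 - s) (- p)) \<and>
     continuous_on ({0..1} \<times> UNIV) (\<lambda>(s, p). H \<gamma> s p) \<and>
     (\<forall>s\<in>{0..1}. convex_on UNIV (H \<gamma> s)) \<and>
     (\<forall>K. \<exists>R. \<forall>s\<in>{0..1}. \<forall>p. \<bar>p\<bar> \<ge> R \<longrightarrow> H \<gamma> s p \<ge> K) \<and>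
     (\<forall>M>0. \<exists>C. \<forall>s\<in>{0..1}. \<forall>p\<in>{-M<..<M}. \<forall>q\<in>{-M<..<M}. H \<gamma> s p - H \<gamma> s q \<le> C * \<bar>p - q\<bar>))"

text \<open>
  For Hamiltonians as above, continuity and coercivity ensure that the infimum and the supremum
  are attained, so that they are a minimum and a maximum.
\<close>

definition critical_const :: "(real \<Rightarrow> real \<Rightarrow> real) \<Rightarrow> real" where
  "critical_const h = - (SUP s\<in>{0..1}. INF p. h s p)"

definition flux_limiter ::
    "(real \<Rightarrow> 'a::euclidean_space) set \<Rightarrow> ((real \<Rightarrow> 'a) \<Rightarrow> real \<Rightarrow> real \<Rightarrow> real) \<Rightarrow> ('a \<Rightarrow> real) \<Rightarrow> bool"
  where
  "flux_limiter E H c \<longleftrightarrow>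
     (\<forall>x\<in>vertices E. c x \<le> Min ((\<lambda>\<gamma>. critical_const (H \<gamma>)) ` arcs_into E x))"


section \<open>Test functions\<close>

text \<open>
  Test functions are required to be \<open>C\<^sup>1\<close> near the contact point only. The set \<open>C\<close> is the constraint;
  \<open>C = UNIV\<close> gives the unconstrained notion. Functions are total, but at contact points
  interior to (or, when constrained, relatively interior to) the actual domain of \<open>w\<close>, values of
  \<open>w\<close> outside that domain are irrelevant.
\<close>

definition C1_near :: "('b::real_normed_vector \<Rightarrow> real) \<Rightarrow> 'b \<Rightarrow> bool" where
  "C1_near \<phi> z \<longleftrightarrow>
     (\<exists>U. \<exists>D :: 'b \<Rightarrow> 'b \<Rightarrow>\<^sub>L real. open U \<and> z \<in> U \<and> continuous_on U D \<and>
        (\<forall>y\<in>U. (\<phi> has_derivative blinfun_apply (D y)) (at y)))"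

definition subtangent_on ::
    "'b::real_normed_vector set \<Rightarrow> ('b \<Rightarrow> real) \<Rightarrow> ('b \<Rightarrow> real) \<Rightarrow> 'b \<Rightarrow> bool" where
  "subtangent_on C w \<phi> z \<longleftrightarrow>
     C1_near \<phi> z \<and> (\<forall>\<^sub>F y in nhds z. y \<in> C \<longrightarrow> w z - \<phi> z \<le> w y - \<phi> y)"

definition supertangent_on ::
    "'b::real_normed_vector set \<Rightarrow> ('b \<Rightarrow> real) \<Rightarrow> ('b \<Rightarrow> real) \<Rightarrow> 'b \<Rightarrow> bool" where
  "supertangent_on C w \<phi> z \<longleftrightarrow>
     C1_near \<phi> z \<and> (\<forall>\<^sub>F y in nhds z. y \<in> C \<longrightarrow> w y - \<phi> y \<le> w z - \<phi> z)"

abbreviation "subtangent \<equiv> subtangent_on UNIV"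
abbreviation "supertangent \<equiv> supertangent_on UNIV"

definition deriv_s :: "(real \<times> real \<Rightarrow> real) \<Rightarrow> real \<Rightarrow> real \<Rightarrow> real" where
  "deriv_s \<phi> s t = deriv (\<lambda>\<sigma>. \<phi> (\<sigma>, t)) s"

definition deriv_t :: "(real \<times> real \<Rightarrow> real) \<Rightarrow> real \<Rightarrow> real \<Rightarrow> real" where
  "deriv_t \<phi> s t = deriv (\<lambda>\<tau>. \<phi> (s, \<tau>)) t"


section \<open>The Hamilton--Jacobi equation on the network\<close>

definition open_times :: "real \<Rightarrow> ereal \<Rightarrow> real set" where
  "open_times T0 T1 = {t. T0 < t \<and> ereal t < T1}"

definition time_domain :: "real \<Rightarrow> ereal \<Rightarrow> real set" where
  "time_domain T0 T1 = {t. T0 \<le> t \<and> ereal t < T1}"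

definition along :: "('a \<times> real \<Rightarrow> real) \<Rightarrow> (real \<Rightarrow> 'a) \<Rightarrow> real \<times> real \<Rightarrow> real" where
  "along v \<gamma> = (\<lambda>(s, t). v (\<gamma> s, t))"

definition HJ_arc_supersolution ::
    "real \<Rightarrow> ereal \<Rightarrow> (real \<Rightarrow> real \<Rightarrow> real) \<Rightarrow> (real \<times> real \<Rightarrow> real) \<Rightarrow> bool" where
  "HJ_arc_supersolution T0 T1 h w \<longleftrightarrow>
     (\<forall>s\<in>{0<..<1}. \<forall>t\<in>open_times T0 T1. \<forall>\<phi>.
        subtangent w \<phi> (s, t) \<longrightarrow> deriv_t \<phi> s t + h s (deriv_s \<phi> s t) \<ge> 0)"

definition HJ_arc_subsolution ::
    "real \<Rightarrow> ereal \<Rightarrow> (real \<Rightarrow> real \<Rightarrow> real) \<Rightarrow> (real \<times> real \<Rightarrow> real) \<Rightarrow> bool" where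
  "HJ_arc_subsolution T0 T1 h w \<longleftrightarrow>
     (\<forall>s\<in>{0<..<1}. \<forall>t\<in>open_times T0 T1. \<forall>\<phi>.
        supertangent w \<phi> (s, t) \<longrightarrow> deriv_t \<phi> s t + h s (deriv_s \<phi> s t) \<le> 0)"

definition HJ_supersolution ::
    "real \<Rightarrow> ereal \<Rightarrow> (real \<Rightarrow> 'a::euclidean_space) set \<Rightarrow> ((real \<Rightarrow> 'a) \<Rightarrow> real \<Rightarrow> real \<Rightarrow> real)
      \<Rightarrow> ('a \<Rightarrow> real) \<Rightarrow> ('a \<times> real \<Rightarrow> real) \<Rightarrow> bool" where
  "HJ_supersolution T0 T1 E H c v \<longleftrightarrow>
     continuous_on (network_set E \<times> time_domain T0 T1) v \<and>
     (\<forall>\<gamma>\<in>E. HJ_arc_supersolution T0 T1 (H \<gamma>) (along v \<gamma>)) \<and>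
     (\<forall>x\<in>vertices E. \<forall>t0\<in>open_times T0 T1.
        (\<exists>\<phi>. subtangent (\<lambda>t. v (x, t)) \<phi> t0 \<and> deriv \<phi> t0 < c x) \<longrightarrow>
        (\<exists>\<gamma>\<in>arcs_into E x. \<forall>\<phi>.
           subtangent_on ({0..1} \<times> closure (open_times T0 T1)) (along v \<gamma>) \<phi> (1, t0) \<longrightarrow>
           deriv_t \<phi> 1 t0 + H \<gamma> 1 (deriv_s \<phi> 1 t0) \<ge> 0))"

definition HJ_subsolution ::
    "real \<Rightarrow> ereal \<Rightarrow> (real \<Rightarrow> 'a::euclidean_space) set \<Rightarrow> ((real \<Rightarrow> 'a) \<Rightarrow> real \<Rightarrow> real \<Rightarrow> real)
      \<Rightarrow> ('a \<Rightarrow> real) \<Rightarrow> ('a \<times> real \<Rightarrow> real) \<Rightarrow> bool" where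
  "HJ_subsolution T0 T1 E H c v \<longleftrightarrow>
     continuous_on (network_set E \<times> time_domain T0 T1) v \<and>
     (\<forall>\<gamma>\<in>E. HJ_arc_subsolution T0 T1 (H \<gamma>) (along v \<gamma>)) \<and>
     (\<forall>x\<in>vertices E. \<forall>t0\<in>open_times T0 T1. \<forall>\<psi>.
        supertangent (\<lambda>t. v (x, t)) \<psi> t0 \<longrightarrow> deriv \<psi> t0 \<le> c x)"

definition HJ_solution ::
    "real \<Rightarrow> ereal \<Rightarrow> (real \<Rightarrow> 'a::euclidean_space) set \<Rightarrow> ((real \<Rightarrow> 'a) \<Rightarrow> real \<Rightarrow> real \<Rightarrow> real)
      \<Rightarrow> ('a \<Rightarrow> real) \<Rightarrow> ('a \<times> real \<Rightarrow> real) \<Rightarrow> bool" where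
  "HJ_solution T0 T1 E H c v \<longleftrightarrow> HJ_subsolution T0 T1 E H c v \<and> HJ_supersolution T0 T1 E H c v"

end

theory Submission
  imports Defs
begin

text \<open>
  Perron's method. All constructions are done on \<open>[T\<^sub>0, \<infinity>)\<close>; the equation is local in time, so the
  restriction to \<open>[T\<^sub>0, T\<^sub>1)\<close> costs nothing. The solution is the pointwise supremum \<open>u\<close> of all
  continuous subsolutions lying below \<open>g\<close> at time \<open>T\<^sub>0\<close>.

  If \<open>g\<close> is the restriction of a polynomial, then \<open>g \<plusminus> M (t - T\<^sub>0)\<close> are barriers for large \<open>M\<close>.
  Invariance under time shifts makes \<open>u\<close> Lipschitz in time, and coercivity turns the lower bound on
  the time derivative into a Lipschitz bound in space. The map from \<open>g\<close> to \<open>u\<close> is nonexpansive, so by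
  Stone--Weierstrass \<open>u\<close> is uniformly continuous for every continuous \<open>g\<close>, and hence belongs to the
  family of which it is the supremum.

  If the supersolution condition fails at a point, a small cone lifted above \<open>u\<close> there yields a larger
  subsolution. At a vertex the cone needs one time slope for all arcs, whereas the
  failure of the condition only provides test functions with different time slopes on different arcs.
  The smallest of these slopes works for all arcs, because \<open>u\<close> is already known to be a supersolution
  in the interior of each arc.
\<close>

text \<open>A supremum of viscosity subsolutions is in general only semicontinuous, and the usual
  remedy is a comparison principle between arbitrary sub- and supersolutions, which is delicate at
  vertices. Here comparison is needed only against C1 barriers: at a maximum point of the difference
  the barrier itself, up to a penalty in time, is an admissible test function, and no doubling of
  variables occurs. Continuity is obtained candidate by candidate instead. A candidate need not be
  Lipschitz, but it can be enlarged to one whose time derivative is bounded below. The resulting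
  bounds depend only on the datum and its speed bound, and therefore survive the supremum.
  Polynomial data enter because a barrier must be C1 along every arc, which a merely continuous
  \<open>g\<close> need not be. The subsolution condition at a vertex \<open>x\<close> sees
  \<open>v\<close> only as a function of time, so a cone at a vertex has two separate duties:
  \<open>a + H < 0\<close> on every incident arc, and a time slope below \<open>c x\<close>.\<close>

section \<open>Test functions\<close>

text \<open>\<open>deriv_s\<close> and \<open>deriv_t\<close> are taken along coordinate lines and
  are meaningful only where these slices are differentiable. Evaluating the Frechet derivative at
  the two unit vectors identifies them throughout \<open>U\<close>, so a contact point may be moved
  slightly without losing control of the slopes.\<close>

lemma C1_near_imp_partials:
  fixes \<phi> :: "real \<times> real \<Rightarrow> real"
  assumes "C1_near \<phi> z"
  obtains U where "open U" "z \<in> U"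
    "continuous_on U (\<lambda>y. deriv_s \<phi> (fst y) (snd y))"
    "continuous_on U (\<lambda>y. deriv_t \<phi> (fst y) (snd y))"
    "\<And>y. y \<in> U \<Longrightarrow> C1_near \<phi> y"
    "\<And>y. y \<in> U \<Longrightarrow> (\<phi> has_derivative
        (\<lambda>h. deriv_s \<phi> (fst y) (snd y) * fst h + deriv_t \<phi> (fst y) (snd y) * snd h)) (at y)"
proof -
  obtain U and D :: "real \<times> real \<Rightarrow> (real \<times> real) \<Rightarrow>\<^sub>L real"
    where U: "open U" "z \<in> U" and D: "continuous_on U D"
      and der: "\<And>y. y \<in> U \<Longrightarrow> (\<phi> has_derivative blinfun_apply (D y)) (at y)"
    using assms unfolding C1_near_def by blast
  have split: "blinfun_apply (D y) h = D y (1, 0) * fst h + D y (0, 1) * snd h" for y h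
  proof -
    have "h = fst h *\<^sub>R (1, 0) + snd h *\<^sub>R (0, 1)" by (simp add: prod_eq_iff)
    then have "D y h = D y (fst h *\<^sub>R (1, 0) + snd h *\<^sub>R (0, 1))" by simp
    also have "\<dots> = fst h * D y (1, 0) + snd h * D y (0, 1)"
      by (simp only: blinfun.add_right blinfun.scaleR_right real_scaleR_def)
    finally show ?thesis by (simp add: mult.commute)
  qed
  have s: "deriv_s \<phi> (fst y) (snd y) = D y (1, 0)" if "y \<in> U" for y
  proof -
    have "((\<lambda>\<sigma>. (\<sigma>, snd y)) has_derivative (\<lambda>h. (h, 0))) (at (fst y))"
      by (auto intro!: derivative_eq_intros)
    moreover have "(\<phi> has_derivative D y) (at (fst y, snd y))" using der[OF that] by simp
    ultimately have "((\<lambda>\<sigma>. \<phi> (\<sigma>, snd y)) has_derivative (\<lambda>h. D y (h, 0))) (at (fst y))"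
      by (rule has_derivative_compose[where g = \<phi>, simplified])
    then have "((\<lambda>\<sigma>. \<phi> (\<sigma>, snd y)) has_real_derivative D y (1, 0)) (at (fst y))"
      unfolding has_field_derivative_def by (subst (asm) split) simp
    then show ?thesis unfolding deriv_s_def by (rule DERIV_imp_deriv)
  qed
  have t: "deriv_t \<phi> (fst y) (snd y) = D y (0, 1)" if "y \<in> U" for y
  proof -
    have "((\<lambda>\<tau>. (fst y, \<tau>)) has_derivative (\<lambda>h. (0, h))) (at (snd y))"
      by (auto intro!: derivative_eq_intros)
    moreover have "(\<phi> has_derivative D y) (at (fst y, snd y))" using der[OF that] by simp
    ultimately have "((\<lambda>\<tau>. \<phi> (fst y, \<tau>)) has_derivative (\<lambda>h. D y (0, h))) (at (snd y))"
      by (rule has_derivative_compose[where g = \<phi>, simplified])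
    then have "((\<lambda>\<tau>. \<phi> (fst y, \<tau>)) has_real_derivative D y (0, 1)) (at (snd y))"
      unfolding has_field_derivative_def by (subst (asm) split) simp
    then show ?thesis unfolding deriv_t_def by (rule DERIV_imp_deriv)
  qed
  have cD: "continuous_on U (\<lambda>y. D y v)" for v
    using D by (intro continuous_intros)
  show ?thesis
  proof (rule that[OF U])
    show "continuous_on U (\<lambda>y. deriv_s \<phi> (fst y) (snd y))"
      using cD[of "(1, 0)"] by (simp add: s cong: continuous_on_cong)
    show "continuous_on U (\<lambda>y. deriv_t \<phi> (fst y) (snd y))"
      using cD[of "(0, 1)"] by (simp add: t cong: continuous_on_cong)
    show "C1_near \<phi> y" if "y \<in> U" for y
      using U(1) D der that unfolding C1_near_def by blast
    show "(\<phi> has_derivative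
        (\<lambda>h. deriv_s \<phi> (fst y) (snd y) * fst h + deriv_t \<phi> (fst y) (snd y) * snd h)) (at y)"
      if "y \<in> U" for y
      unfolding s[OF that] t[OF that] split[symmetric] using der[OF that] .
  qed
qed

lemma C1_near_imp_has_real_derivative:
  fixes \<phi> :: "real \<Rightarrow> real"
  assumes "C1_near \<phi> z"
  obtains U where "open U" "z \<in> U" "continuous_on U (deriv \<phi>)"
    "\<And>y. y \<in> U \<Longrightarrow> C1_near \<phi> y"
    "\<And>y. y \<in> U \<Longrightarrow> (\<phi> has_real_derivative deriv \<phi> y) (at y)"
proof -
  obtain U and D :: "real \<Rightarrow> real \<Rightarrow>\<^sub>L real"
    where U: "open U" "z \<in> U" and D: "continuous_on U D"
      and der: "\<And>y. y \<in> U \<Longrightarrow> (\<phi> has_derivative blinfun_apply (D y)) (at y)"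
    using assms unfolding C1_near_def by blast
  have split: "blinfun_apply (D y) h = D y 1 * h" for y h
    using blinfun.scaleR_right[of "D y" h 1] by (simp add: mult.commute)
  have d: "(\<phi> has_real_derivative D y 1) (at y)" if "y \<in> U" for y
  proof -
    have "blinfun_apply (D y) = (*) (D y 1)" by (rule ext) (rule split)
    with der[OF that] show ?thesis by (simp add: has_field_derivative_def)
  qed
  then have e: "deriv \<phi> y = D y 1" if "y \<in> U" for y
    using that by (blast intro: DERIV_imp_deriv)
  have cD: "continuous_on U (\<lambda>y. D y 1)"
    using D by (intro continuous_intros)
  show ?thesis
  proof (rule that[OF U])
    show "continuous_on U (deriv \<phi>)"
      using cD by (simp add: e cong: continuous_on_cong)
    show "C1_near \<phi> y" if "y \<in> U" for y
      using U(1) D der that unfolding C1_near_def by blast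
    show "(\<phi> has_real_derivative deriv \<phi> y) (at y)" if "y \<in> U" for y
      using d[OF that] e[OF that] by simp
  qed
qed

lemma C1_near_realI:
  assumes "open U" "z \<in> U" "\<And>y. y \<in> U \<Longrightarrow> (\<phi> has_real_derivative d y) (at y)"
    "continuous_on U d"
  shows "C1_near \<phi> z"
  unfolding C1_near_def
proof (intro exI[of _ U] exI[of _ "\<lambda>y. blinfun_scaleR_left (d y) :: real \<Rightarrow>\<^sub>L real"] conjI ballI)
  show "(\<phi> has_derivative blinfun_apply (blinfun_scaleR_left (d y))) (at y)" if "y \<in> U" for y
  proof -
    have "blinfun_apply (blinfun_scaleR_left (d y) :: real \<Rightarrow>\<^sub>L real) = (*) (d y)" by (auto simp: fun_eq_iff)
    with assms(3)[OF that] show ?thesis by (simp add: has_field_derivative_def)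
  qed
qed (use assms in \<open>auto intro!: continuous_intros bounded_linear.continuous_on[OF bounded_linear_blinfun_scaleR_left]\<close>)

text \<open>All test functions of two variables that are built from scratch below have this form, a
  function of \<open>s\<close> plus a function of \<open>t\<close>.\<close>

lemma C1_near_separable:
  assumes "open U" "s \<in> U" "\<And>y. y \<in> U \<Longrightarrow> (A has_real_derivative A' y) (at y)"
    "continuous_on U A'"
    and "open V" "t \<in> V" "\<And>y. y \<in> V \<Longrightarrow> (B has_real_derivative B' y) (at y)"
    "continuous_on V B'"
  shows "C1_near (\<lambda>(\<sigma>, \<tau>). A \<sigma> + B \<tau>) (s, t)"
  unfolding C1_near_def
proof (intro exI[of _ "U \<times> V"] conjI ballI
    exI[of _ "\<lambda>y. A' (fst y) *\<^sub>R fst_blinfun + B' (snd y) *\<^sub>R snd_blinfun"])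
  show "continuous_on (U \<times> V) (\<lambda>y. A' (fst y) *\<^sub>R fst_blinfun + B' (snd y) *\<^sub>R snd_blinfun)"
    using assms(4,8) by (auto intro!: continuous_intros continuous_on_compose2[of U A']
        continuous_on_compose2[of V B'])
  show "((\<lambda>(\<sigma>, \<tau>). A \<sigma> + B \<tau>) has_derivative
      blinfun_apply (A' (fst y) *\<^sub>R fst_blinfun + B' (snd y) *\<^sub>R snd_blinfun)) (at y)"
    if "y \<in> U \<times> V" for y
  proof -
    have "(A has_derivative (\<lambda>h. A' (fst y) * h)) (at (fst y))"
      "(B has_derivative (\<lambda>h. B' (snd y) * h)) (at (snd y))"
      using assms(3,7) that by (auto simp: has_field_derivative_def)
    then have "((\<lambda>x. A (fst x) + B (snd x)) has_derivative
        (\<lambda>h. A' (fst y) * fst h + B' (snd y) * snd h)) (at y)"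
      by (auto intro!: derivative_eq_intros has_derivative_compose[where g = A]
          has_derivative_compose[where g = B])
    then show ?thesis
      by (simp add: case_prod_unfold plus_blinfun.rep_eq scaleR_blinfun.rep_eq)
  qed
qed (use assms in \<open>auto intro: open_Times\<close>)

lemma deriv_separable:
  assumes "(A has_real_derivative a) (at s)" "(B has_real_derivative b) (at t)"
  shows "deriv_s (\<lambda>(\<sigma>, \<tau>). A \<sigma> + B \<tau>) s t = a" "deriv_t (\<lambda>(\<sigma>, \<tau>). A \<sigma> + B \<tau>) s t = b"
  unfolding deriv_s_def deriv_t_def using assms
  by (auto intro!: DERIV_imp_deriv derivative_eq_intros)

lemma C1_near_add:
  assumes "C1_near \<phi> z" "C1_near \<psi> z"
  shows "C1_near (\<lambda>y. \<phi> y + \<psi> y) z"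
proof -
  obtain U D where U: "open U" "z \<in> U" "continuous_on U D"
      "\<forall>y\<in>U. (\<phi> has_derivative blinfun_apply (D y)) (at y)"
    using assms(1) unfolding C1_near_def by blast
  obtain V D' where V: "open V" "z \<in> V" "continuous_on V D'"
      "\<forall>y\<in>V. (\<psi> has_derivative blinfun_apply (D' y)) (at y)"
    using assms(2) unfolding C1_near_def by blast
  show ?thesis unfolding C1_near_def
  proof (intro exI[of _ "U \<inter> V"] exI[of _ "\<lambda>y. D y + D' y"] conjI ballI)
    show "continuous_on (U \<inter> V) (\<lambda>y. D y + D' y)"
      using U V by (auto intro!: continuous_intros intro: continuous_on_subset)
    show "((\<lambda>y. \<phi> y + \<psi> y) has_derivative blinfun_apply (D y + D' y)) (at y)" if "y \<in> U \<inter> V" for y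
      using U(4) V(4) that
      by (auto simp: plus_blinfun.rep_eq intro!: has_derivative_add)
  qed (use U V in auto)
qed

lemma C1_near_shift:
  assumes "C1_near \<phi> z"
  shows "C1_near (\<lambda>y. \<phi> (y - k)) (z + k)"
proof -
  obtain U D where U: "open U" "z \<in> U" "continuous_on U D"
      "\<forall>y\<in>U. (\<phi> has_derivative blinfun_apply (D y)) (at y)"
    using assms(1) unfolding C1_near_def by blast
  have eq: "(\<lambda>y. y + k) ` U = (\<lambda>y. y - k) -` U"
    by (force simp: image_iff algebra_simps)
  show ?thesis unfolding C1_near_def
  proof (intro exI[of _ "(\<lambda>y. y - k) -` U"] exI[of _ "\<lambda>y. D (y - k)"] conjI ballI)
    show "open ((\<lambda>y. y - k) -` U)"
      using U(1) by (intro open_vimage continuous_intros)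
    show "continuous_on ((\<lambda>y. y - k) -` U) (\<lambda>y. D (y - k))"
      by (rule continuous_on_compose2[OF U(3)]) (auto intro!: continuous_intros)
    show "((\<lambda>y. \<phi> (y - k)) has_derivative blinfun_apply (D (y - k))) (at y)"
      if "y \<in> (\<lambda>y. y - k) -` U" for y
    proof (rule has_derivative_compose[where g = \<phi> and f = "\<lambda>y. y - k", simplified])
      show "((\<lambda>y. y - k) has_derivative (\<lambda>h. h)) (at y)"
        by (auto intro!: derivative_eq_intros)
      show "(\<phi> has_derivative blinfun_apply (D (y - k))) (at (y - k))" using U(4) that by auto
    qed
  qed (use U in auto)
qed

lemma deriv_partial_shift:
  "deriv_s (\<lambda>y. \<phi> (y - (0, h))) s t = deriv_s \<phi> s (t - h)"
  "deriv_t (\<lambda>y. \<phi> (y - (0, h))) s t = deriv_t \<phi> s (t - h)"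
proof -
  have "((\<lambda>\<tau>. f (\<tau> - h)) has_field_derivative D) (at t) \<longleftrightarrow>
      (f has_field_derivative D) (at (t - h))" for f :: "real \<Rightarrow> real" and D
    using DERIV_shift[of f D "t - h" h] DERIV_shift[of "\<lambda>\<tau>. f (\<tau> - h)" D "t - h" h] by simp
  from this[of "\<lambda>\<tau>. \<phi> (s, \<tau>)"]
  show "deriv_s (\<lambda>y. \<phi> (y - (0, h))) s t = deriv_s \<phi> s (t - h)"
    "deriv_t (\<lambda>y. \<phi> (y - (0, h))) s t = deriv_t \<phi> s (t - h)"
    by (simp_all add: deriv_s_def deriv_t_def deriv_def)
qed

text \<open>A one-sided C1 penalty. It vanishes up to \<open>k\<close> and keeps extrema away from
  the artificial upper end of a compact box. For \<open>C \<ge> 0\<close> its derivative is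
  nonnegative, so in each use the strict inequality for the slopes is preserved.\<close>

lemma has_real_derivative_max_0_square:
  "((\<lambda>x. C * (max 0 (x - k))\<^sup>2) has_real_derivative C * (2 * max 0 (x - k))) (at x)"
proof -
  have "((\<lambda>x::real. (max 0 (x - k))\<^sup>2) has_real_derivative 2 * max 0 (x - k)) (at x)"
  proof -
    have bd: "\<bar>(max 0 (y - k))\<^sup>2 - (max 0 (x - k))\<^sup>2 - 2 * max 0 (x - k) * (y - x)\<bar> \<le> (y - x)\<^sup>2" for y
    proof -
      define p q where "p = y - k" and "q = x - k"
      have eq: "y - x = p - q" unfolding p_def q_def by simp
      have "p\<^sup>2 \<le> (p - q)\<^sup>2" if "p \<ge> 0" "q \<le> 0"
        using that by (intro power_mono) auto
      moreover have "\<bar>- q\<^sup>2 - 2 * q * (p - q)\<bar> \<le> (p - q)\<^sup>2" if "p \<le> 0" "q \<ge> 0"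
      proof -
        have "p * q \<le> 0" using that by (simp add: mult_nonpos_nonneg)
        then have "0 \<le> q\<^sup>2 - 2 * (p * q)" using zero_le_power2[of q] by linarith
        moreover have "- q\<^sup>2 - 2 * q * (p - q) = q\<^sup>2 - 2 * (p * q)" by algebra
        moreover have "q\<^sup>2 - 2 * (p * q) \<le> (p - q)\<^sup>2"
          using zero_le_power2[of p] by (simp add: power2_diff)
        ultimately show ?thesis by linarith
      qed
      moreover have "p\<^sup>2 - q\<^sup>2 - 2 * q * (p - q) = (p - q)\<^sup>2" by algebra
      ultimately show ?thesis unfolding eq p_def[symmetric] q_def[symmetric]
        by (cases "p \<le> 0"; cases "q \<le> 0") (auto simp: max_def)
    qed
    have "((\<lambda>y. (\<bar>y - x\<bar>)) \<longlongrightarrow> 0) (at x)"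
      by (auto intro!: tendsto_eq_intros)
    then have "((\<lambda>y. ((max 0 (y - k))\<^sup>2 - (max 0 (x - k))\<^sup>2) / (y - x) - 2 * max 0 (x - k)) \<longlongrightarrow> 0) (at x)"
    proof (rule Lim_null_comparison[rotated])
      show "\<forall>\<^sub>F y in at x. norm (((max 0 (y - k))\<^sup>2 - (max 0 (x - k))\<^sup>2) / (y - x) - 2 * max 0 (x - k)) \<le> \<bar>y - x\<bar>"
        unfolding eventually_at_filter
      proof (intro always_eventually allI impI)
        fix y :: real assume "y \<noteq> x"
        then have "((max 0 (y - k))\<^sup>2 - (max 0 (x - k))\<^sup>2) / (y - x) - 2 * max 0 (x - k)
            = ((max 0 (y - k))\<^sup>2 - (max 0 (x - k))\<^sup>2 - 2 * max 0 (x - k) * (y - x)) / (y - x)"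
          by (simp add: field_simps)
        then show "norm (((max 0 (y - k))\<^sup>2 - (max 0 (x - k))\<^sup>2) / (y - x) - 2 * max 0 (x - k)) \<le> \<bar>y - x\<bar>"
          using bd[of y] \<open>y \<noteq> x\<close>
          by (simp add: divide_le_eq power2_eq_square abs_mult[symmetric])
      qed
    qed
    then show ?thesis
      unfolding has_field_derivative_iff using LIM_zero_iff by blast
  qed
  then show ?thesis by (rule DERIV_cmult)
qed

section \<open>Boxes around a point, and slopes at a point of contact\<close>

lemma eventually_nhds_box:
  fixes s t :: real
  assumes "l < s" "s < r" "p < t" "t < q"
    and "\<And>\<sigma> \<tau>. l < \<sigma> \<Longrightarrow> \<sigma> < r \<Longrightarrow> p < \<tau> \<Longrightarrow> \<tau> < q \<Longrightarrow> P (\<sigma>, \<tau>)"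
  shows "\<forall>\<^sub>F y in nhds (s, t). P y"
  unfolding eventually_nhds
  by (rule exI[of _ "{l<..<r} \<times> {p<..<q}"]) (use assms in \<open>auto intro: open_Times\<close>)

lemma eventually_nhds_boxE:
  fixes s t :: real
  assumes "\<forall>\<^sub>F y in nhds (s, t). P y"
  obtains e where "e > 0" "\<And>\<sigma> \<tau>. \<bar>\<sigma> - s\<bar> < e \<Longrightarrow> \<bar>\<tau> - t\<bar> < e \<Longrightarrow> P (\<sigma>, \<tau>)"
proof -
  obtain d where d: "d > 0" "\<And>y. dist y (s, t) < d \<Longrightarrow> P y"
    using assms unfolding eventually_nhds_metric by blast
  show ?thesis
  proof (rule that[of "d / 2"])
    fix \<sigma> \<tau> assume "\<bar>\<sigma> - s\<bar> < d / 2" "\<bar>\<tau> - t\<bar> < d / 2"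
    then have "dist (\<sigma>, \<tau>) (s, t) < d"
      using real_sqrt_sum_squares_triangle_ineq[of "\<sigma> - s" 0 0 "\<tau> - t"]
      by (simp add: dist_Pair_Pair dist_real_def)
    then show "P (\<sigma>, \<tau>)" by (rule d(2))
  qed (use d in auto)
qed

lemma eventually_nhds_Pair:
  assumes "\<forall>\<^sub>F y in nhds (s, t). P y"
  shows "\<forall>\<^sub>F \<sigma> in nhds s. P (\<sigma>, t)" "\<forall>\<^sub>F \<tau> in nhds t. P (s, \<tau>)"
proof -
  have "((\<lambda>\<sigma>. (\<sigma>, t)) \<longlongrightarrow> (s, t)) (nhds s)"
    by (intro tendsto_intros filterlim_ident)
  from eventually_compose_filterlim[OF assms this] show "\<forall>\<^sub>F \<sigma> in nhds s. P (\<sigma>, t)" .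
  have "((\<lambda>\<tau>. (s, \<tau>)) \<longlongrightarrow> (s, t)) (nhds t)"
    by (intro tendsto_intros filterlim_ident)
  from eventually_compose_filterlim[OF assms this] show "\<forall>\<^sub>F \<tau> in nhds t. P (s, \<tau>)" .
qed

text \<open>Dividing by \<open>y - x\<close> keeps the inequality on the right of \<open>x\<close>
  and reverses it on the left. A bound on \<open>f\<close> from below alone therefore bounds the
  derivative from both sides.\<close>

lemma has_real_derivative_cone_bound:
  assumes "(f has_real_derivative d) (at x)"
    and "\<forall>\<^sub>F y in nhds x. f y - f x \<ge> \<beta> * (y - x) - \<eta> * \<bar>y - x\<bar>"
  shows "\<bar>d - \<beta>\<bar> \<le> \<eta>"
proof -
  have lim: "((\<lambda>y. (f y - f x) / (y - x)) \<longlongrightarrow> d) (at x)"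
    using assms(1) unfolding has_field_derivative_iff .
  have ev: "\<forall>\<^sub>F y in at x within A. f y - f x \<ge> \<beta> * (y - x) - \<eta> * \<bar>y - x\<bar>" for A
    using assms(2) by (simp add: eventually_at_filter eventually_mono)
  have R: "((\<lambda>y. (f y - f x) / (y - x)) \<longlongrightarrow> d) (at_right x)"
    using lim by (rule filterlim_mono) (auto simp: at_le)
  have L: "((\<lambda>y. (f y - f x) / (y - x)) \<longlongrightarrow> d) (at_left x)"
    using lim by (rule filterlim_mono) (auto simp: at_le)
  have "\<forall>\<^sub>F y in at_right x. \<beta> - \<eta> \<le> (f y - f x) / (y - x)"
    using ev[of "{x<..}"] eventually_at_right_less[of x]
  proof eventually_elim
    case (elim y)
    then have "(\<beta> - \<eta>) * (y - x) \<le> f y - f x" by (simp add: algebra_simps)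
    with elim(2) show ?case by (simp add: pos_le_divide_eq)
  qed
  then have "\<beta> - \<eta> \<le> d"
    by (rule tendsto_lowerbound[OF R]) simp
  moreover have "\<forall>\<^sub>F y in at_left x. y < x"
    by (simp add: eventually_at_filter)
  with ev[of "{..<x}"] have "\<forall>\<^sub>F y in at_left x. (f y - f x) / (y - x) \<le> \<beta> + \<eta>"
  proof eventually_elim
    case (elim y)
    then have "(\<beta> + \<eta>) * (y - x) \<le> f y - f x" by (simp add: algebra_simps)
    with elim(2) show ?case by (simp add: neg_divide_le_eq)
  qed
  then have "d \<le> \<beta> + \<eta>"
    by (rule tendsto_upperbound[OF L]) simp
  ultimately show ?thesis by auto
qed

lemma C1_near_has_derivative:
  fixes \<phi> :: "real \<times> real \<Rightarrow> real"
  assumes "C1_near \<phi> (s, t)"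
  shows "(\<phi> has_derivative (\<lambda>h. deriv_s \<phi> s t * fst h + deriv_t \<phi> s t * snd h)) (at (s, t))"
  using C1_near_imp_partials[OF assms] by (metis fst_conv snd_conv)

lemma C1_near_DERIV_partials:
  fixes \<phi> :: "real \<times> real \<Rightarrow> real"
  assumes "C1_near \<phi> (s, t)"
  shows "((\<lambda>\<sigma>. \<phi> (\<sigma>, t)) has_real_derivative deriv_s \<phi> s t) (at s)"
    "((\<lambda>\<tau>. \<phi> (s, \<tau>)) has_real_derivative deriv_t \<phi> s t) (at t)"
proof -
  note d = C1_near_has_derivative[OF assms]
  have "((\<lambda>\<sigma>. (\<sigma>, t)) has_derivative (\<lambda>h. (h, 0))) (at s)"
    "((\<lambda>\<tau>. (s, \<tau>)) has_derivative (\<lambda>h. (0, h))) (at t)"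
    by (auto intro!: derivative_eq_intros)
  from has_derivative_compose[OF this(1) d] has_derivative_compose[OF this(2) d]
  show "((\<lambda>\<sigma>. \<phi> (\<sigma>, t)) has_real_derivative deriv_s \<phi> s t) (at s)"
    "((\<lambda>\<tau>. \<phi> (s, \<tau>)) has_real_derivative deriv_t \<phi> s t) (at t)"
    by (simp_all add: has_field_derivative_def)
qed

text \<open>This makes a nonsmooth cone usable as a piece of a subsolution: a test function above
  \<open>w\<close> inherits the cone bound, so its slopes lie in a small box around
  \<open>(\<beta>, \<alpha>)\<close>, where a strict inequality for the Hamiltonian
  persists.\<close>

lemma supertangent_slopes:
  assumes "supertangent w \<phi> (s, t)"
    and "\<forall>\<^sub>F y in nhds (s, t). w y \<ge> w (s, t) + \<alpha> * (snd y - t) + \<beta> * (fst y - s)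
          - \<eta> * (\<bar>fst y - s\<bar> + \<bar>snd y - t\<bar>)"
  shows "\<bar>deriv_s \<phi> s t - \<beta>\<bar> \<le> \<eta>" "\<bar>deriv_t \<phi> s t - \<alpha>\<bar> \<le> \<eta>"
proof -
  have C1: "C1_near \<phi> (s, t)" and "\<forall>\<^sub>F y in nhds (s, t). w y - \<phi> y \<le> w (s, t) - \<phi> (s, t)"
    using assms(1) unfolding supertangent_on_def by auto
  from this(2) assms(2) have ev: "\<forall>\<^sub>F y in nhds (s, t). \<phi> y - \<phi> (s, t) \<ge>
      \<alpha> * (snd y - t) + \<beta> * (fst y - s) - \<eta> * (\<bar>fst y - s\<bar> + \<bar>snd y - t\<bar>)"
    by eventually_elim simp
  show "\<bar>deriv_s \<phi> s t - \<beta>\<bar> \<le> \<eta>"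
    by (rule has_real_derivative_cone_bound[OF C1_near_DERIV_partials(1)[OF C1]])
      (use eventually_nhds_Pair(1)[OF ev] in simp)
  show "\<bar>deriv_t \<phi> s t - \<alpha>\<bar> \<le> \<eta>"
    by (rule has_real_derivative_cone_bound[OF C1_near_DERIV_partials(2)[OF C1]])
      (use eventually_nhds_Pair(2)[OF ev] in simp)
qed

lemma supertangent_slope:
  assumes "supertangent w \<phi> t"
    and "\<forall>\<^sub>F \<tau> in nhds t. w \<tau> \<ge> w t + \<alpha> * (\<tau> - t) - \<eta> * \<bar>\<tau> - t\<bar>"
  shows "\<bar>deriv \<phi> t - \<alpha>\<bar> \<le> \<eta>"
proof -
  have C1: "C1_near \<phi> t" and "\<forall>\<^sub>F y in nhds t. w y - \<phi> y \<le> w t - \<phi> t"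
    using assms(1) unfolding supertangent_on_def by auto
  from this(2) assms(2) have ev: "\<forall>\<^sub>F y in nhds t. \<phi> y - \<phi> t \<ge> \<alpha> * (y - t) - \<eta> * \<bar>y - t\<bar>"
    by eventually_elim simp
  obtain U where "t \<in> U" "\<And>y. y \<in> U \<Longrightarrow> (\<phi> has_real_derivative deriv \<phi> y) (at y)"
    using C1_near_imp_has_real_derivative[OF C1] by metis
  then show ?thesis using has_real_derivative_cone_bound[OF _ ev] by blast
qed

lemma supertangent_touch:
  assumes "supertangent_on C w \<phi> z" "v z = w z" "\<forall>\<^sub>F y in nhds z. v y \<le> w y"
  shows "supertangent_on C v \<phi> z"
proof -
  have "\<forall>\<^sub>F y in nhds z. y \<in> C \<longrightarrow> w y - \<phi> y \<le> w z - \<phi> z"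
    using assms(1) unfolding supertangent_on_def by auto
  with assms(3) have "\<forall>\<^sub>F y in nhds z. y \<in> C \<longrightarrow> v y - \<phi> y \<le> v z - \<phi> z"
    unfolding assms(2) by eventually_elim auto
  then show ?thesis using assms(1) unfolding supertangent_on_def by auto
qed

lemma DERIV_eventually_max:
  fixes f :: "real \<Rightarrow> real"
  assumes "(f has_real_derivative l) (at x)" "\<forall>\<^sub>F y in nhds x. f y \<le> f x"
  shows "l = 0"
proof -
  obtain d where "d > 0" "\<And>y. dist y x < d \<Longrightarrow> f y \<le> f x"
    using assms(2) unfolding eventually_nhds_metric by blast
  then show ?thesis
    using DERIV_local_max[OF assms(1), of d] by (auto simp: dist_real_def abs_minus_commute)
qed

section \<open>Subsolutions for all times\<close>

locale hj_network =
  fixes E :: "(real \<Rightarrow> 'a::euclidean_space) set"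
    and H :: "(real \<Rightarrow> 'a) \<Rightarrow> real \<Rightarrow> real \<Rightarrow> real"
    and c :: "'a \<Rightarrow> real"
    and T0 :: real
  assumes network: "network E" and hamiltonians: "hamiltonians E H"
begin

abbreviation \<Gamma> where "\<Gamma> \<equiv> network_set E"

text \<open>The two subsolution conditions are stated at a single point because the functions
  constructed below are verified point by point, each time by comparison with a different function
  that touches from below.\<close>

definition sub_arc :: "('a \<times> real \<Rightarrow> real) \<Rightarrow> (real \<Rightarrow> 'a) \<Rightarrow> real \<Rightarrow> real \<Rightarrow> bool" where
  "sub_arc v \<gamma> s t \<longleftrightarrow>
     (\<forall>\<phi>. supertangent (along v \<gamma>) \<phi> (s, t) \<longrightarrow> deriv_t \<phi> s t + H \<gamma> s (deriv_s \<phi> s t) \<le> 0)"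

definition sub_vertex :: "('a \<times> real \<Rightarrow> real) \<Rightarrow> 'a \<Rightarrow> real \<Rightarrow> bool" where
  "sub_vertex v x t \<longleftrightarrow> (\<forall>\<psi>. supertangent (\<lambda>t. v (x, t)) \<psi> t \<longrightarrow> deriv \<psi> t \<le> c x)"

definition subsol :: "('a \<times> real \<Rightarrow> real) \<Rightarrow> bool" where
  "subsol v \<longleftrightarrow> continuous_on (\<Gamma> \<times> {T0..}) v \<and>
     (\<forall>\<gamma>\<in>E. \<forall>s\<in>{0<..<1}. \<forall>t>T0. sub_arc v \<gamma> s t) \<and>
     (\<forall>x\<in>vertices E. \<forall>t>T0. sub_vertex v x t)"

lemma subsolD:
  assumes "subsol v"
  shows "continuous_on (\<Gamma> \<times> {T0..}) v"
    "\<And>\<gamma> s t. \<gamma> \<in> E \<Longrightarrow> 0 < s \<Longrightarrow> s < 1 \<Longrightarrow> T0 < t \<Longrightarrow> sub_arc v \<gamma> s t"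
    "\<And>x t. x \<in> vertices E \<Longrightarrow> T0 < t \<Longrightarrow> sub_vertex v x t"
  using assms unfolding subsol_def by auto

section \<open>Geometry of the network and bounds for the Hamiltonians\<close>

lemma finite_E: "finite E"
  using network unfolding network_def by (elim conjE)

lemma no_loop: "\<gamma> \<in> E \<Longrightarrow> pathstart \<gamma> \<noteq> pathfinish \<gamma>"
proof -
  have "\<forall>\<gamma>\<in>E. pathstart \<gamma> \<noteq> pathfinish \<gamma>"
    using network unfolding network_def by (elim conjE)
  then show "\<gamma> \<in> E \<Longrightarrow> pathstart \<gamma> \<noteq> pathfinish \<gamma>" by blast
qed

lemma arc_E: "\<gamma> \<in> E \<Longrightarrow> arc \<gamma>"
proof -
  have "\<forall>\<gamma>\<in>E. simple_path \<gamma> \<and> C1_regular \<gamma> \<and> reversepath \<gamma> \<in> E"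
    using network unfolding network_def by (elim conjE)
  then show "\<gamma> \<in> E \<Longrightarrow> arc \<gamma>" using no_loop[of \<gamma>] by (simp add: arc_simple_path eq_commute)
qed

lemma continuous_E: "\<gamma> \<in> E \<Longrightarrow> continuous_on {0..1} \<gamma>"
  using arc_E by (auto simp: arc_def path_def)

lemma inj_E: "\<gamma> \<in> E \<Longrightarrow> \<gamma> s = \<gamma> s' \<Longrightarrow> s \<in> {0..1} \<Longrightarrow> s' \<in> {0..1} \<Longrightarrow> s = s'"
  using arc_E by (auto simp: arc_def inj_on_def)

lemma reversepath_E: "\<gamma> \<in> E \<Longrightarrow> reversepath \<gamma> \<in> E"
  using network unfolding network_def by (elim conjE) simp

lemma reversepath_neq: "\<gamma> \<in> E \<Longrightarrow> reversepath \<gamma> \<noteq> \<gamma>"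
  using no_loop[of \<gamma>] pathstart_reversepath[of \<gamma>] by metis

lemma arcs_meet:
  assumes "\<gamma> \<in> E" "\<gamma>' \<in> E" "0 < s" "s < 1" "s' \<in> {0..1}" "\<gamma> s = \<gamma>' s'"
  shows "\<gamma>' = \<gamma> \<and> s' = s \<or> \<gamma>' = reversepath \<gamma> \<and> s' = 1 - s"
proof -
  have "\<gamma> s \<in> \<gamma> ` {0<..<1} \<inter> path_image \<gamma>'"
    using assms(3-6) by (force simp: path_image_def)
  then have "\<gamma>' = \<gamma> \<or> \<gamma>' = reversepath \<gamma>"
  proof -
    have "\<forall>\<gamma>\<in>E. \<forall>\<gamma>'\<in>E. \<gamma>' \<noteq> \<gamma> \<and> \<gamma>' \<noteq> reversepath \<gamma> \<longrightarrow> \<gamma> ` {0<..<1} \<inter> path_image \<gamma>' = {}"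
      using network unfolding network_def by (elim conjE)
    then show "\<gamma> s \<in> \<gamma> ` {0<..<1} \<inter> path_image \<gamma>' \<Longrightarrow> ?thesis" using assms(1,2) by blast
  qed
  moreover have "s' = s" if "\<gamma>' = \<gamma>" using inj_E[of \<gamma> s s'] assms that by auto
  moreover have "s' = 1 - s" if "\<gamma>' = reversepath \<gamma>"
    using inj_E[of \<gamma> s "1 - s'"] assms that by (auto simp: reversepath_def)
  ultimately show ?thesis by blast
qed

lemma vertices_iff: "x \<in> vertices E \<longleftrightarrow> (\<exists>\<gamma>\<in>E. \<gamma> 1 = x)"
proof -
  have "\<exists>\<gamma>'\<in>E. \<gamma>' 1 = \<gamma> 0" if "\<gamma> \<in> E" for \<gamma>
    using reversepath_E[OF that] by (intro bexI[of _ "reversepath \<gamma>"]) (auto simp: reversepath_def)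
  then show ?thesis
    unfolding vertices_def by (auto simp: pathstart_def pathfinish_def image_iff)
qed

lemma endpoint_vertex: "\<gamma> \<in> E \<Longrightarrow> \<gamma> 0 \<in> vertices E" "\<gamma> \<in> E \<Longrightarrow> \<gamma> 1 \<in> vertices E"
  unfolding vertices_def by (auto simp: pathstart_def pathfinish_def)

lemma arc_point_in: "\<gamma> \<in> E \<Longrightarrow> s \<in> {0..1} \<Longrightarrow> \<gamma> s \<in> \<Gamma>"
  unfolding network_set_def path_image_def by blast

lemma vertex_in: "x \<in> vertices E \<Longrightarrow> x \<in> \<Gamma>"
  using vertices_iff arc_point_in by fastforce

lemma finite_vertices: "finite (vertices E)"
  unfolding vertices_def using finite_E by auto

lemma network_pointE:
  assumes "y \<in> \<Gamma>"
  obtains \<gamma> s where "\<gamma> \<in> E" "s \<in> {0..1}" "y = \<gamma> s"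
  using assms by (auto simp: network_set_def path_image_def)

lemma compact_network: "compact \<Gamma>"
  unfolding network_set_def path_image_def
  using finite_E continuous_E by (intro compact_UN compact_continuous_image) auto

lemma interior_point_not_vertex: "\<gamma> \<in> E \<Longrightarrow> 0 < s \<Longrightarrow> s < 1 \<Longrightarrow> \<gamma> s \<notin> vertices E"
  using arcs_meet[of \<gamma> _ s 1] unfolding vertices_iff by fastforce

lemma H_continuous: "\<gamma> \<in> E \<Longrightarrow> continuous_on ({0..1} \<times> UNIV) (\<lambda>(s, p). H \<gamma> s p)"
  using hamiltonians unfolding hamiltonians_def by simp

lemma H_continuous_on:
  assumes "\<gamma> \<in> E" "continuous_on A f" "continuous_on A p" "\<And>y. y \<in> A \<Longrightarrow> f y \<in> {0..1}"
  shows "continuous_on A (\<lambda>y. H \<gamma> (f y) (p y))"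
proof -
  have "continuous_on A (\<lambda>y. (\<lambda>(s, p). H \<gamma> s p) (f y, p y))"
    by (rule continuous_on_compose2[OF H_continuous[OF assms(1)] continuous_on_Pair])
      (use assms in auto)
  then show ?thesis by simp
qed

lemma H_reversepath: "\<gamma> \<in> E \<Longrightarrow> s \<in> {0..1} \<Longrightarrow> H (reversepath \<gamma>) s p = H \<gamma> (1 - s) (- p)"
  using hamiltonians unfolding hamiltonians_def by simp

lemma H_coercive_uniform: "\<exists>R>0. \<forall>\<gamma>\<in>E. \<forall>s\<in>{0..1}. \<forall>p. \<bar>p\<bar> \<ge> R \<longrightarrow> H \<gamma> s p \<ge> K"
proof -
  have "\<forall>\<gamma>\<in>E. \<exists>R. \<forall>s\<in>{0..1}. \<forall>p. \<bar>p\<bar> \<ge> R \<longrightarrow> H \<gamma> s p \<ge> K"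
    using hamiltonians unfolding hamiltonians_def by simp
  then obtain R where R: "\<forall>\<gamma>\<in>E. \<forall>s\<in>{0..1}. \<forall>p. \<bar>p\<bar> \<ge> R \<gamma> \<longrightarrow> H \<gamma> s p \<ge> K" by metis
  \<comment> \<open>The inserted 1 makes \<open>R'\<close> positive and keeps \<open>Max\<close>
    meaningful if \<open>E\<close> is empty.\<close>
  define R' where "R' = Max (insert 1 (R ` E))"
  have "R' \<ge> 1" "\<And>\<gamma>. \<gamma> \<in> E \<Longrightarrow> R \<gamma> \<le> R'" unfolding R'_def using finite_E by auto
  with R show ?thesis by (intro exI[of _ R']) force
qed

section \<open>Common radii for all arcs, and continuity on the network\<close>

lemma finite_E_common_radius:
  assumes "\<And>\<gamma>. \<gamma> \<in> E \<Longrightarrow> \<exists>r>0. P \<gamma> r" and "\<And>\<gamma> r r'. P \<gamma> r \<Longrightarrow> 0 < r' \<Longrightarrow> r' \<le> r \<Longrightarrow> P \<gamma> r'"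
  shows "\<exists>r>0::real. \<forall>\<gamma>\<in>E. P \<gamma> r"
proof -
  obtain f where f: "\<And>\<gamma>. \<gamma> \<in> E \<Longrightarrow> f \<gamma> > 0 \<and> P \<gamma> (f \<gamma>)" using assms(1) by metis
  define r where "r = Min (insert 1 (f ` E))"
  have "r > 0" "\<And>\<gamma>. \<gamma> \<in> E \<Longrightarrow> r \<le> f \<gamma>"
    unfolding r_def using finite_E f by (auto simp: Min_gr_iff)
  with f assms(2) show ?thesis by blast
qed

text \<open>The parameters at distance at least \<open>r\<close> from every parameter of
  \<open>y0\<close> form a compact set whose image misses \<open>y0\<close> and so stays at positive
  distance from it. For an arc that avoids \<open>y0\<close>, the conclusion says that the whole arc
  stays away.\<close>

lemma near_coordinate:
  assumes "r > 0"
  shows "\<exists>\<rho>>0. \<forall>\<gamma>\<in>E. \<forall>s\<in>{0..1}. dist (\<gamma> s) y0 < \<rho> \<longrightarrow> (\<exists>s0\<in>{0..1}. \<gamma> s0 = y0 \<and> \<bar>s - s0\<bar> < r)"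
proof (rule finite_E_common_radius)
  fix \<gamma> assume g: "\<gamma> \<in> E"
  define K where "K = {0..1} - (\<Union>s0\<in>{s0\<in>{0..1}. \<gamma> s0 = y0}. ball s0 r)"
  have "compact K" unfolding K_def by (intro compact_diff) auto
  then have "compact (\<gamma> ` K)"
    by (rule compact_continuous_image[rotated])
      (auto intro: continuous_on_subset[OF continuous_E[OF g]] simp: K_def)
  moreover have "y0 \<notin> \<gamma> ` K" unfolding K_def using assms by force
  ultimately obtain d where d: "d > 0" "\<And>y. y \<in> \<gamma> ` K \<Longrightarrow> d \<le> dist y0 y"
    using separate_point_closed compact_imp_closed by metis
  show "\<exists>\<rho>>0. \<forall>s\<in>{0..1}. dist (\<gamma> s) y0 < \<rho> \<longrightarrow> (\<exists>s0\<in>{0..1}. \<gamma> s0 = y0 \<and> \<bar>s - s0\<bar> < r)"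
  proof (intro exI conjI ballI impI)
    fix s assume s: "s \<in> {0..1::real}" "dist (\<gamma> s) y0 < d"
    then have "s \<notin> K" using d(2)[of "\<gamma> s"] by (force simp: dist_commute)
    then show "\<exists>s0\<in>{0..1}. \<gamma> s0 = y0 \<and> \<bar>s - s0\<bar> < r"
      using s unfolding K_def by (auto simp: dist_real_def abs_minus_commute)
  qed (rule d(1))
qed force

text \<open>Local facts are proved in arc parameters but needed for the Euclidean distance on
  \<open>\<Gamma>\<close>. The radius is an argument of \<open>P\<close> so that it can bound
  further variables too, such as time.\<close>

lemma near_point:
  assumes "\<And>\<gamma> s0. \<gamma> \<in> E \<Longrightarrow> s0 \<in> {0..1} \<Longrightarrow> \<gamma> s0 = y0 \<Longrightarrow>
      \<exists>r>0. \<forall>s\<in>{0..1}. \<bar>s - s0\<bar> < r \<longrightarrow> P r (\<gamma> s)"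
    and mono: "\<And>r r' y. P r y \<Longrightarrow> 0 < r' \<Longrightarrow> r' \<le> r \<Longrightarrow> P r' y"
  shows "\<exists>\<rho>>0. \<forall>y\<in>\<Gamma>. dist y y0 < \<rho> \<longrightarrow> P \<rho> y"
proof -
  have "\<exists>r>0. \<forall>s0\<in>{0..1}. \<gamma> s0 = y0 \<longrightarrow> (\<forall>s\<in>{0..1}. \<bar>s - s0\<bar> < r \<longrightarrow> P r (\<gamma> s))"
    if g: "\<gamma> \<in> E" for \<gamma>
  proof (cases "\<exists>s0\<in>{0..1}. \<gamma> s0 = y0")
    case True
    then obtain s0 where s0: "s0 \<in> {0..1}" "\<gamma> s0 = y0" by blast
    have "s = s0" if "s \<in> {0..1}" "\<gamma> s = y0" for s using inj_E[OF g] s0 that by metis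
    then show ?thesis using assms(1)[OF g s0] by blast
  next
    case False
    then show ?thesis by (intro exI[of _ 1]) auto
  qed
  then have "\<exists>r>0. \<forall>\<gamma>\<in>E. \<forall>s0\<in>{0..1}. \<gamma> s0 = y0 \<longrightarrow> (\<forall>s\<in>{0..1}. \<bar>s - s0\<bar> < r \<longrightarrow> P r (\<gamma> s))"
    by (intro finite_E_common_radius) (blast, meson mono less_le_trans)
  then obtain r where r: "r > 0" "\<And>\<gamma> s0 s. \<gamma> \<in> E \<Longrightarrow> s0 \<in> {0..1} \<Longrightarrow> \<gamma> s0 = y0 \<Longrightarrow>
      s \<in> {0..1} \<Longrightarrow> \<bar>s - s0\<bar> < r \<Longrightarrow> P r (\<gamma> s)" by blast
  obtain \<rho> where \<rho>: "\<rho> > 0" "\<And>\<gamma> s. \<gamma> \<in> E \<Longrightarrow> s \<in> {0..1} \<Longrightarrow> dist (\<gamma> s) y0 < \<rho> \<Longrightarrow>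
      \<exists>s0\<in>{0..1}. \<gamma> s0 = y0 \<and> \<bar>s - s0\<bar> < r"
    using near_coordinate[OF r(1), of y0] by blast
  show ?thesis
  proof (intro exI[of _ "min r \<rho>"] conjI ballI impI)
    fix y assume y: "y \<in> \<Gamma>" "dist y y0 < min r \<rho>"
    obtain \<gamma> s where "\<gamma> \<in> E" "s \<in> {0..1}" "y = \<gamma> s" using network_pointE[OF y(1)] .
    then have "P r y" using \<rho>(2)[of \<gamma> s] r(2)[of \<gamma>] y(2) by auto
    then show "P (min r \<rho>) y" using mono r(1) \<rho>(1) by simp
  qed (use r \<rho> in auto)
qed

lemma along_continuous:
  assumes "continuous_on (\<Gamma> \<times> T) v" "\<gamma> \<in> E"
  shows "continuous_on ({0..1} \<times> T) (along v \<gamma>)"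
  unfolding along_def case_prod_unfold
  by (rule continuous_on_compose2[OF assms(1)])
    (use assms(2) in \<open>auto intro!: continuous_intros continuous_on_compose2[OF continuous_E] arc_point_in\<close>)

text \<open>Needed for functions that are known only through their expressions along arcs. Where
  several arcs meet, \<open>near_point\<close> supplies one radius for all of them.\<close>

lemma continuous_on_network_times:
  assumes "\<And>\<gamma>. \<gamma> \<in> E \<Longrightarrow> continuous_on ({0..1} \<times> T) (along v \<gamma>)"
  shows "continuous_on (\<Gamma> \<times> T) v"
  unfolding continuous_on_iff
proof (intro ballI allI impI)
  fix z and e :: real assume z: "z \<in> \<Gamma> \<times> T" and e: "e > 0"
  obtain y0 t0 where z0: "z = (y0, t0)" "y0 \<in> \<Gamma>" "t0 \<in> T" using z by auto
  have "\<exists>\<rho>>0. \<forall>y\<in>\<Gamma>. dist y y0 < \<rho> \<longrightarrow> (\<forall>t\<in>T. dist t t0 < \<rho> \<longrightarrow> dist (v (y, t)) (v (y0, t0)) < e)"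
  proof (rule near_point)
    fix \<gamma> s0 assume g: "\<gamma> \<in> E" "s0 \<in> {0..1}" "\<gamma> s0 = y0"
    obtain d where d: "d > 0" "\<And>y. y \<in> {0..1} \<times> T \<Longrightarrow> dist y (s0, t0) < d \<Longrightarrow>
        dist (along v \<gamma> y) (along v \<gamma> (s0, t0)) < e"
      using assms[OF g(1)] g(2) z0(3) e unfolding continuous_on_iff by (metis mem_Sigma_iff)
    have "dist (v (\<gamma> s, t)) (v (y0, t0)) < e"
      if "s \<in> {0..1}" "t \<in> T" "\<bar>s - s0\<bar> < d / 2" "dist t t0 < d / 2" for s t
    proof -
      have "dist (s, t) (s0, t0) \<le> dist s s0 + dist t t0"
        using real_sqrt_sum_squares_triangle_ineq[of "dist s s0" 0 0 "dist t t0"]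
        by (simp add: dist_Pair_Pair)
      then show ?thesis using d(2)[of "(s, t)"] that g(3) by (auto simp: along_def dist_real_def)
    qed
    then show "\<exists>r>0. \<forall>s\<in>{0..1}. \<bar>s - s0\<bar> < r \<longrightarrow>
        (\<forall>t\<in>T. dist t t0 < r \<longrightarrow> dist (v (\<gamma> s, t)) (v (y0, t0)) < e)"
      using d(1) by (intro exI[of _ "d / 2"]) auto
  qed force
  then obtain \<rho> where \<rho>: "\<rho> > 0" "\<And>y t. y \<in> \<Gamma> \<Longrightarrow> dist y y0 < \<rho> \<Longrightarrow> t \<in> T \<Longrightarrow> dist t t0 < \<rho> \<Longrightarrow>
      dist (v (y, t)) (v (y0, t0)) < e" by blast
  show "\<exists>d>0. \<forall>x'\<in>\<Gamma> \<times> T. dist x' z < d \<longrightarrow> dist (v x') (v z) < e"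
  proof (intro exI[of _ \<rho>] conjI ballI impI)
    fix x' assume x: "x' \<in> \<Gamma> \<times> T" "dist x' z < \<rho>"
    then have "dist (fst x') y0 < \<rho>" "dist (snd x') t0 < \<rho>"
      using dist_fst_le[of x' z] dist_snd_le[of x' z] z0 by auto
    then show "dist (v x') (v z) < e" using \<rho>(2)[of "fst x'" "snd x'"] x(1) z0 by auto
  qed (rule \<rho>(1))
qed

section \<open>Stability of subsolutions: touching, suprema, time shifts\<close>

lemma sub_arc_touch:
  assumes "sub_arc v \<gamma> s t" "v (\<gamma> s, t) = w (\<gamma> s, t)"
    "\<forall>\<^sub>F y in nhds (s, t). along v \<gamma> y \<le> along w \<gamma> y"
  shows "sub_arc w \<gamma> s t"
  using assms supertangent_touch[of UNIV "along w \<gamma>" _ "(s, t)" "along v \<gamma>"]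
  unfolding sub_arc_def by (auto simp: along_def)

lemma sub_vertex_touch:
  assumes "sub_vertex v x t" "v (x, t) = w (x, t)"
    "\<forall>\<^sub>F \<tau> in nhds t. v (x, \<tau>) \<le> w (x, \<tau>)"
  shows "sub_vertex w x t"
  using assms supertangent_touch[of UNIV "\<lambda>t. w (x, t)" _ t "\<lambda>t. v (x, t)"]
  unfolding sub_vertex_def by auto

text \<open>A supertangent to the supremum need not touch any member of \<open>F\<close>. Adding a
  quadratic makes the contact strict; a member that is close to \<open>u\<close> at the contact
  point then attains a maximum against the perturbed test function nearby, where the violated
  inequality still holds by continuity.\<close>

lemma subsol_Sup:
  assumes sub: "\<And>v. v \<in> F \<Longrightarrow> subsol v"
    and le: "\<And>v z. v \<in> F \<Longrightarrow> z \<in> \<Gamma> \<times> {T0..} \<Longrightarrow> v z \<le> u z"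
    and approx: "\<And>z e. z \<in> \<Gamma> \<times> {T0..} \<Longrightarrow> e > 0 \<Longrightarrow> \<exists>v\<in>F. u z - e < v z"
    and cont: "continuous_on (\<Gamma> \<times> {T0..}) u"
  shows "subsol u"
  unfolding subsol_def
proof (intro conjI ballI allI impI)
  fix \<gamma> s0 t0 assume g: "\<gamma> \<in> E" and s0: "s0 \<in> {0<..<1::real}" and t0: "T0 < t0"
  show "sub_arc u \<gamma> s0 t0" unfolding sub_arc_def
  proof (intro allI impI, rule ccontr)
    fix \<phi> assume sup: "supertangent (along u \<gamma>) \<phi> (s0, t0)"
      and neg: "\<not> deriv_t \<phi> s0 t0 + H \<gamma> s0 (deriv_s \<phi> s0 t0) \<le> 0"
    have C1: "C1_near \<phi> (s0, t0)" using sup unfolding supertangent_on_def by blast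
    obtain U where U: "open U" "(s0, t0) \<in> U"
      "continuous_on U (\<lambda>y. deriv_s \<phi> (fst y) (snd y))"
      "continuous_on U (\<lambda>y. deriv_t \<phi> (fst y) (snd y))"
      "\<And>y. y \<in> U \<Longrightarrow> C1_near \<phi> y"
      using C1_near_imp_partials[OF C1] by metis
    define q :: "real \<times> real \<Rightarrow> real" where "q = (\<lambda>(\<sigma>, \<tau>). (\<sigma> - s0)\<^sup>2 + (\<tau> - t0)\<^sup>2)"
    have qC1: "C1_near q y" for y
      unfolding q_def by (subst surjective_pairing)
        (rule C1_near_separable[of UNIV _ _ "\<lambda>s. 2 * (s - s0)" UNIV _ _ "\<lambda>t. 2 * (t - t0)"],
          auto intro!: derivative_eq_intros continuous_intros)
    define \<phi>' where "\<phi>' = (\<lambda>y. \<phi> y + q y)"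
    have ds: "deriv_s \<phi>' s t = deriv_s \<phi> s t + 2 * (s - s0)"
      and dt: "deriv_t \<phi>' s t = deriv_t \<phi> s t + 2 * (t - t0)" if "(s, t) \<in> U" for s t
    proof -
      note d = C1_near_DERIV_partials[OF U(5)[OF that]]
      show "deriv_s \<phi>' s t = deriv_s \<phi> s t + 2 * (s - s0)"
        by (subst deriv_s_def, rule DERIV_imp_deriv)
          (auto simp: \<phi>'_def q_def intro!: derivative_eq_intros d)
      show "deriv_t \<phi>' s t = deriv_t \<phi> s t + 2 * (t - t0)"
        by (subst deriv_t_def, rule DERIV_imp_deriv)
          (auto simp: \<phi>'_def q_def intro!: derivative_eq_intros d)
    qed
    define U' where "U' = U \<inter> {0<..<1} \<times> {T0<..}"
    have U': "open U'" "(s0, t0) \<in> U'"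
      unfolding U'_def using U s0 t0 by (auto intro!: open_Int open_Times)
    \<comment> \<open>The left side of the equation for \<open>\<phi>'\<close>, written with the
      partials of \<open>\<phi>\<close> so that its continuity is visible.\<close>
    define \<Psi> where "\<Psi> y = deriv_t \<phi> (fst y) (snd y) + 2 * (snd y - t0)
        + H \<gamma> (fst y) (deriv_s \<phi> (fst y) (snd y) + 2 * (fst y - s0))" for y
    have "continuous_on U' \<Psi>" unfolding \<Psi>_def
      by (intro continuous_intros H_continuous_on g continuous_on_subset[OF U(3)]
          continuous_on_subset[OF U(4)]) (auto simp: U'_def)
    then have "(\<Psi> \<longlongrightarrow> \<Psi> (s0, t0)) (at (s0, t0))"
      using U' continuous_on_eq_continuous_at[OF U'(1)] isCont_def by blast
    moreover have "\<Psi> (s0, t0) > 0" using neg by (simp add: \<Psi>_def)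
    ultimately have "\<forall>\<^sub>F y in at (s0, t0). \<Psi> y > 0" by (rule order_tendstoD)
    then have "\<forall>\<^sub>F y in nhds (s0, t0). \<Psi> y > 0"
      using neg by (auto simp: eventually_at_filter \<Psi>_def elim: eventually_mono)
    moreover have "\<forall>\<^sub>F y in nhds (s0, t0). y \<in> U'"
      using U' by (simp add: eventually_nhds_in_open)
    moreover have "\<forall>\<^sub>F y in nhds (s0, t0). along u \<gamma> y - \<phi> y \<le> along u \<gamma> (s0, t0) - \<phi> (s0, t0)"
      using sup unfolding supertangent_on_def by auto
    ultimately have "\<forall>\<^sub>F y in nhds (s0, t0). \<Psi> y > 0 \<and> y \<in> U' \<and>
        along u \<gamma> y - \<phi> y \<le> along u \<gamma> (s0, t0) - \<phi> (s0, t0)"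
      by eventually_elim auto
    then obtain e' where e': "e' > 0" "\<And>\<sigma> \<tau>. \<bar>\<sigma> - s0\<bar> < e' \<Longrightarrow> \<bar>\<tau> - t0\<bar> < e' \<Longrightarrow> \<Psi> (\<sigma>, \<tau>) > 0 \<and> (\<sigma>, \<tau>) \<in> U' \<and>
        along u \<gamma> (\<sigma>, \<tau>) - \<phi> (\<sigma>, \<tau>) \<le> along u \<gamma> (s0, t0) - \<phi> (s0, t0)"
      by (rule eventually_nhds_boxE) blast
    define e where "e = e' / 2"
    have e: "e > 0" "\<And>\<sigma> \<tau>. \<bar>\<sigma> - s0\<bar> \<le> e \<Longrightarrow> \<bar>\<tau> - t0\<bar> \<le> e \<Longrightarrow> \<Psi> (\<sigma>, \<tau>) > 0 \<and> (\<sigma>, \<tau>) \<in> U' \<and>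
        along u \<gamma> (\<sigma>, \<tau>) - \<phi> (\<sigma>, \<tau>) \<le> along u \<gamma> (s0, t0) - \<phi> (s0, t0)"
      using e' unfolding e_def by auto
    define K where "K = {s0 - e..s0 + e} \<times> {t0 - e..t0 + e}"
    have KU: "K \<subseteq> U'" using e(2) unfolding K_def by (auto simp: abs_le_iff)
    have "(\<gamma> s0, t0) \<in> \<Gamma> \<times> {T0..}" using arc_point_in[OF g, of s0] s0 t0 by auto
    \<comment> \<open>On the boundary of the box \<open>K\<close> the quadratic \<open>q\<close> is
      at least \<open>e\<^sup>2\<close>. Losing less than that at the centre forces the maximum over
      \<open>K\<close> into the interior.\<close>
    then obtain v where v: "v \<in> F" "u (\<gamma> s0, t0) - e\<^sup>2 < v (\<gamma> s0, t0)"
      using approx e(1) by (metis zero_less_power)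
    have "continuous_on K (\<lambda>y. along v \<gamma> y - \<phi>' y)"
    proof (intro continuous_intros)
      show "continuous_on K (along v \<gamma>)"
        by (rule continuous_on_subset[OF along_continuous[OF subsolD(1)[OF sub[OF v(1)]] g]])
          (use KU in \<open>auto simp: U'_def\<close>)
      have "continuous (at y) \<phi>'" if "y \<in> K" for y
      proof -
        have "y \<in> U" using that KU by (auto simp: U'_def)
        then have "C1_near \<phi>' y" unfolding \<phi>'_def by (rule C1_near_add[OF U(5) qC1])
        then show ?thesis unfolding C1_near_def using has_derivative_continuous by blast
      qed
      then show "continuous_on K \<phi>'" by (simp add: continuous_at_imp_continuous_on)
    qed
    moreover have "compact K" "K \<noteq> {}" unfolding K_def using e(1) by (auto intro: compact_Times)
    ultimately obtain z where z: "z \<in> K" "\<And>y. y \<in> K \<Longrightarrow> along v \<gamma> y - \<phi>' y \<le> along v \<gamma> z - \<phi>' z"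
      using continuous_attains_sup[of K "\<lambda>y. along v \<gamma> y - \<phi>' y"] by blast
    obtain s1 t1 where z1: "z = (s1, t1)" by (cases z)
    have in1: "\<bar>s1 - s0\<bar> \<le> e" "\<bar>t1 - t0\<bar> \<le> e" using z(1) unfolding K_def z1 by auto
    have "(\<gamma> s1, t1) \<in> \<Gamma> \<times> {T0..}"
      using KU z(1) arc_point_in[OF g, of s1] unfolding z1 U'_def by auto
    then have "v (\<gamma> s1, t1) \<le> u (\<gamma> s1, t1)" using le v(1) by blast
    moreover have "along v \<gamma> (s0, t0) - \<phi>' (s0, t0) \<le> along v \<gamma> (s1, t1) - \<phi>' (s1, t1)"
      using z(2)[of "(s0, t0)"] e(1) unfolding z1 K_def by auto
    moreover have "along u \<gamma> (s1, t1) - \<phi> (s1, t1) \<le> along u \<gamma> (s0, t0) - \<phi> (s0, t0)"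
      using e(2)[OF in1] by blast
    ultimately have "(s1 - s0)\<^sup>2 + (t1 - t0)\<^sup>2 < e\<^sup>2"
      using v(2) by (simp add: along_def \<phi>'_def q_def)
    then have "(s1 - s0)\<^sup>2 < e\<^sup>2" "(t1 - t0)\<^sup>2 < e\<^sup>2"
      using zero_le_power2[of "s1 - s0"] zero_le_power2[of "t1 - t0"] by linarith+
    then have in2: "\<bar>s1 - s0\<bar> < e" "\<bar>t1 - t0\<bar> < e"
      using e(1) by (metis abs_of_pos power2_abs abs_ge_zero power2_less_imp_less less_imp_le)+
    have "(s1, t1) \<in> U'" using KU z(1) z1 by auto
    then have U1: "(s1, t1) \<in> U" "0 < s1" "s1 < 1" "T0 < t1" by (auto simp: U'_def)
    have "supertangent (along v \<gamma>) \<phi>' (s1, t1)" unfolding supertangent_on_def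
    proof
      show "C1_near \<phi>' (s1, t1)" unfolding \<phi>'_def by (rule C1_near_add[OF U(5)[OF U1(1)] qC1])
      show "\<forall>\<^sub>F y in nhds (s1, t1). y \<in> UNIV \<longrightarrow>
          along v \<gamma> y - \<phi>' y \<le> along v \<gamma> (s1, t1) - \<phi>' (s1, t1)"
        by (rule eventually_nhds_box[of "s0 - e" _ "s0 + e" "t0 - e" _ "t0 + e"])
          (use z(2) in2 in \<open>auto simp: K_def z1 abs_less_iff\<close>)
    qed
    then have "deriv_t \<phi>' s1 t1 + H \<gamma> s1 (deriv_s \<phi>' s1 t1) \<le> 0"
      using subsolD(2)[OF sub[OF v(1)] g U1(2-4)] unfolding sub_arc_def by blast
    moreover have "\<Psi> (s1, t1) > 0" using e(2)[OF in1] by blast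
    ultimately show False unfolding ds[OF U1(1)] dt[OF U1(1)] \<Psi>_def by simp
  qed
next
  fix x t0 assume x: "x \<in> vertices E" and t0: "T0 < t0"
  show "sub_vertex u x t0" unfolding sub_vertex_def
  proof (intro allI impI, rule ccontr)
    fix \<phi> assume sup: "supertangent (\<lambda>t. u (x, t)) \<phi> t0" and neg: "\<not> deriv \<phi> t0 \<le> c x"
    have C1: "C1_near \<phi> t0" using sup unfolding supertangent_on_def by blast
    obtain U where U: "open U" "t0 \<in> U" "continuous_on U (deriv \<phi>)"
      "\<And>y. y \<in> U \<Longrightarrow> C1_near \<phi> y"
      "\<And>y. y \<in> U \<Longrightarrow> (\<phi> has_real_derivative deriv \<phi> y) (at y)"
      using C1_near_imp_has_real_derivative[OF C1] by metis
    \<comment> \<open>The same perturbation in the time variable alone.\<close>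
    define \<phi>' where "\<phi>' = (\<lambda>t. \<phi> t + (t - t0)\<^sup>2)"
    have d': "(\<phi>' has_real_derivative deriv \<phi> t + 2 * (t - t0)) (at t)" if "t \<in> U" for t
      unfolding \<phi>'_def using U(5)[OF that] by (auto intro!: derivative_eq_intros)
    define U' where "U' = U \<inter> {T0<..}"
    have U': "open U'" "t0 \<in> U'" unfolding U'_def using U t0 by auto
    have "continuous_on U' (\<lambda>t. deriv \<phi> t + 2 * (t - t0))"
      by (intro continuous_intros continuous_on_subset[OF U(3)]) (auto simp: U'_def)
    then have "((\<lambda>t. deriv \<phi> t + 2 * (t - t0)) \<longlongrightarrow> deriv \<phi> t0 + 2 * (t0 - t0)) (at t0)"
      using U' continuous_on_eq_continuous_at[OF U'(1)] isCont_def by blast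
    then have "\<forall>\<^sub>F t in at t0. deriv \<phi> t + 2 * (t - t0) > c x"
      by (rule order_tendstoD) (use neg in simp)
    then have "\<forall>\<^sub>F t in nhds t0. deriv \<phi> t + 2 * (t - t0) > c x"
      using neg by (auto simp: eventually_at_filter elim: eventually_mono)
    moreover have "\<forall>\<^sub>F t in nhds t0. t \<in> U'"
      using U' by (simp add: eventually_nhds_in_open)
    moreover have "\<forall>\<^sub>F t in nhds t0. u (x, t) - \<phi> t \<le> u (x, t0) - \<phi> t0"
      using sup unfolding supertangent_on_def by auto
    ultimately have "\<forall>\<^sub>F t in nhds t0. deriv \<phi> t + 2 * (t - t0) > c x \<and> t \<in> U' \<and>
        u (x, t) - \<phi> t \<le> u (x, t0) - \<phi> t0"
      by eventually_elim auto
    then obtain e' where e': "e' > 0" "\<And>t. dist t t0 < e' \<Longrightarrow> deriv \<phi> t + 2 * (t - t0) > c x \<and> t \<in> U' \<and>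
        u (x, t) - \<phi> t \<le> u (x, t0) - \<phi> t0"
      unfolding eventually_nhds_metric by blast
    define e where "e = e' / 2"
    have e: "e > 0" "\<And>t. \<bar>t - t0\<bar> \<le> e \<Longrightarrow> deriv \<phi> t + 2 * (t - t0) > c x \<and> t \<in> U' \<and>
        u (x, t) - \<phi> t \<le> u (x, t0) - \<phi> t0"
      using e' unfolding e_def by (auto simp: dist_real_def)
    define K where "K = {t0 - e..t0 + e}"
    have KU: "K \<subseteq> U'" using e(2) unfolding K_def by (auto simp: abs_le_iff)
    have "(x, t0) \<in> \<Gamma> \<times> {T0..}" using vertex_in[OF x] t0 by auto
    then obtain v where v: "v \<in> F" "u (x, t0) - e\<^sup>2 < v (x, t0)"
      using approx e(1) by (metis zero_less_power)
    have "continuous_on K (\<lambda>t. v (x, t) - \<phi>' t)"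
    proof (intro continuous_intros)
      show "continuous_on K (\<lambda>t. v (x, t))"
        by (rule continuous_on_compose2[OF subsolD(1)[OF sub[OF v(1)]]])
          (use KU vertex_in[OF x] in \<open>auto simp: U'_def intro!: continuous_intros\<close>)
      show "continuous_on K \<phi>'"
        using d' KU by (intro DERIV_continuous_on[where D = "\<lambda>t. deriv \<phi> t + 2 * (t - t0)"])
          (auto simp: U'_def intro: has_field_derivative_at_within)
    qed
    moreover have "compact K" "K \<noteq> {}" unfolding K_def using e(1) by auto
    ultimately obtain t1 where z: "t1 \<in> K" "\<And>t. t \<in> K \<Longrightarrow> v (x, t) - \<phi>' t \<le> v (x, t1) - \<phi>' t1"
      using continuous_attains_sup[of K "\<lambda>t. v (x, t) - \<phi>' t"] by blast
    have in1: "\<bar>t1 - t0\<bar> \<le> e" using z(1) unfolding K_def by auto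
    have "(x, t1) \<in> \<Gamma> \<times> {T0..}" using KU z(1) vertex_in[OF x] unfolding U'_def by auto
    then have "v (x, t1) \<le> u (x, t1)" using le v(1) by blast
    moreover have "v (x, t0) - \<phi>' t0 \<le> v (x, t1) - \<phi>' t1"
      using z(2)[of t0] e(1) unfolding K_def by auto
    moreover have "u (x, t1) - \<phi> t1 \<le> u (x, t0) - \<phi> t0" using e(2)[OF in1] by blast
    ultimately have "(t1 - t0)\<^sup>2 < e\<^sup>2" using v(2) by (simp add: \<phi>'_def)
    then have in2: "\<bar>t1 - t0\<bar> < e"
      using e(1) by (metis abs_of_pos power2_abs abs_ge_zero power2_less_imp_less less_imp_le)
    have U1: "t1 \<in> U" "T0 < t1" using KU z(1) by (auto simp: U'_def)
    have "supertangent (\<lambda>t. v (x, t)) \<phi>' t1" unfolding supertangent_on_def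
    proof
      show "C1_near \<phi>' t1"
        by (rule C1_near_realI[OF U(1) U1(1) d']) (auto intro!: continuous_intros U(3))
      show "\<forall>\<^sub>F t in nhds t1. t \<in> UNIV \<longrightarrow> v (x, t) - \<phi>' t \<le> v (x, t1) - \<phi>' t1"
        by (rule eventually_nhds_in_open[of "{t0 - e<..<t0 + e}", THEN eventually_mono])
          (use z(2) in2 in \<open>auto simp: K_def abs_less_iff\<close>)
    qed
    then have "deriv \<phi>' t1 \<le> c x"
      using subsolD(3)[OF sub[OF v(1)] x U1(2)] unfolding sub_vertex_def by blast
    then show False using e(2)[OF in1] DERIV_imp_deriv[OF d'[OF U1(1)]] by auto
  qed
qed (rule cont)

text \<open>In this pointwise form \<open>h\<close> may be negative, which
  \<open>running_supremum\<close> exploits. Only the global version \<open>subsol_shift\<close>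
  needs \<open>h \<ge> 0\<close>, to stay within times after \<open>T0\<close>.\<close>

lemma sub_arc_shift:
  assumes "sub_arc v \<gamma> s (t + h)"
  shows "sub_arc (\<lambda>(x, t). v (x, t + h) - k) \<gamma> s t"
  unfolding sub_arc_def
proof (intro allI impI)
  fix \<phi> assume "supertangent (along (\<lambda>(x, t). v (x, t + h) - k) \<gamma>) \<phi> (s, t)"
  then have C1: "C1_near \<phi> (s, t)"
    and ev: "\<forall>\<^sub>F y in nhds (s, t). along v \<gamma> (y + (0, h)) - k - \<phi> y \<le> along v \<gamma> (s, t + h) - k - \<phi> (s, t)"
    unfolding supertangent_on_def by (auto simp: along_def case_prod_unfold)
  have "((\<lambda>y. y - (0, h)) \<longlongrightarrow> (s, t + h) - (0, h)) (nhds (s, t + h))"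
    by (intro tendsto_intros filterlim_ident)
  then have "filterlim (\<lambda>y. y - (0, h)) (nhds (s, t)) (nhds (s, t + h))" by simp
  from eventually_compose_filterlim[OF ev this]
  have "supertangent (along v \<gamma>) (\<lambda>y. \<phi> (y - (0, h))) (s, t + h)"
    using C1_near_shift[OF C1, of "(0, h)"] unfolding supertangent_on_def
    by (auto elim: eventually_mono)
  with assms show "deriv_t \<phi> s t + H \<gamma> s (deriv_s \<phi> s t) \<le> 0"
    unfolding sub_arc_def using deriv_partial_shift[of \<phi> h s "t + h"] by fastforce
qed

lemma sub_vertex_shift:
  assumes "sub_vertex v x (t + h)"
  shows "sub_vertex (\<lambda>(x, t). v (x, t + h) - k) x t"
  unfolding sub_vertex_def
proof (intro allI impI)
  fix \<phi> assume "supertangent (\<lambda>t. (\<lambda>(x, t). v (x, t + h) - k) (x, t)) \<phi> t"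
  then have C1: "C1_near \<phi> t"
    and ev: "\<forall>\<^sub>F y in nhds t. v (x, y + h) - k - \<phi> y \<le> v (x, t + h) - k - \<phi> t"
    unfolding supertangent_on_def by auto
  have "((\<lambda>y. y - h) \<longlongrightarrow> (t + h) - h) (nhds (t + h))"
    by (intro tendsto_intros filterlim_ident)
  then have "filterlim (\<lambda>y. y - h) (nhds t) (nhds (t + h))" by simp
  from eventually_compose_filterlim[OF ev this]
  have "supertangent (\<lambda>t. v (x, t)) (\<lambda>y. \<phi> (y - h)) (t + h)"
    using C1_near_shift[OF C1, of h] unfolding supertangent_on_def
    by (auto elim: eventually_mono)
  then have "deriv (\<lambda>y. \<phi> (y - h)) (t + h) \<le> c x"
    using assms unfolding sub_vertex_def by blast
  moreover have "(\<phi> has_real_derivative deriv \<phi> t) (at t)"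
    using C1_near_imp_has_real_derivative[OF C1] by metis
  then have "((\<lambda>y. \<phi> (y - h)) has_real_derivative deriv \<phi> t) (at (t + h))"
    using DERIV_shift[of "\<lambda>y. \<phi> (y - h)" "deriv \<phi> t" t h] by simp
  ultimately show "deriv \<phi> t \<le> c x" by (simp add: DERIV_imp_deriv)
qed

lemma subsol_shift:
  assumes "subsol v" "h \<ge> 0"
  shows "subsol (\<lambda>(x, t). v (x, t + h) - k)"
  unfolding subsol_def
proof (intro conjI ballI allI impI)
  show "continuous_on (\<Gamma> \<times> {T0..}) (\<lambda>(x, t). v (x, t + h) - k)"
    unfolding case_prod_unfold
    by (intro continuous_intros continuous_on_compose2[OF subsolD(1)[OF assms(1)]])
      (use assms(2) in auto)
qed (use assms in \<open>auto intro!: sub_arc_shift sub_vertex_shift subsolD(2,3)[OF assms(1)]\<close>)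

lemma subsol_minus_const: "subsol v \<Longrightarrow> subsol (\<lambda>z. v z - k)"
  using subsol_shift[of v 0 k] by (simp add: case_prod_unfold)

lemma subsol_max:
  assumes "subsol v" "subsol w"
  shows "subsol (\<lambda>z. max (v z) (w z))"
proof (rule subsol_Sup[of "{v, w}"])
  show "continuous_on (\<Gamma> \<times> {T0..}) (\<lambda>z. max (v z) (w z))"
    using assms by (intro continuous_intros subsolD)
  show "\<exists>v'\<in>{v, w}. max (v z) (w z) - e < v' z" if "e > 0" for z and e :: real
    using that by (cases "v z \<le> w z") (auto simp: max_def)
qed (use assms in auto)

section \<open>Barriers and comparison with them\<close>

text \<open>
  For such \<open>g\<close> and \<open>M\<close>, the functions \<open>g - M (t - T\<^sub>0)\<close> and \<open>g + M (t - T\<^sub>0)\<close> are a strict subsolution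
  and a strict supersolution.
\<close>

definition speed_bound :: "('a \<Rightarrow> real) \<Rightarrow> real \<Rightarrow> bool" where
  "speed_bound g M \<longleftrightarrow> continuous_on \<Gamma> g \<and> (\<forall>x\<in>vertices E. \<bar>c x\<bar> < M) \<and>
     (\<forall>\<gamma>\<in>E. \<exists>D. continuous_on {0<..<1} D \<and>
        (\<forall>s\<in>{0<..<1}. ((\<lambda>s. g (\<gamma> s)) has_real_derivative D s) (at s) \<and> \<bar>H \<gamma> s (D s)\<bar> < M))"

lemma speed_boundE:
  assumes "speed_bound g M" "\<gamma> \<in> E"
  obtains D where "continuous_on {0<..<1} D"
    "\<And>s. 0 < s \<Longrightarrow> s < 1 \<Longrightarrow> ((\<lambda>s. g (\<gamma> s)) has_real_derivative D s) (at s)"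
    "\<And>s. 0 < s \<Longrightarrow> s < 1 \<Longrightarrow> \<bar>H \<gamma> s (D s)\<bar> < M"
  using assms unfolding speed_bound_def by fastforce

text \<open>The barrier is differentiable in each variable, so every supertangent shares its slopes
  \<open>D s\<close> and \<open>- M\<close>, and the inequality reduces to
  \<open>H \<gamma> s (D s) < M\<close>.\<close>

lemma barrier_sub_arc:
  assumes "speed_bound g M" "\<gamma> \<in> E" "0 < s" "s < 1"
  shows "sub_arc (\<lambda>(x, t). g x - M * (t - T0)) \<gamma> s t"
  unfolding sub_arc_def
proof (intro allI impI)
  fix \<phi> assume sup: "supertangent (along (\<lambda>(x, t). g x - M * (t - T0)) \<gamma>) \<phi> (s, t)"
  obtain D where D: "((\<lambda>s. g (\<gamma> s)) has_real_derivative D s) (at s)" "\<bar>H \<gamma> s (D s)\<bar> < M"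
    using speed_boundE[OF assms(1,2)] assms(3,4) by metis
  have C1: "C1_near \<phi> (s, t)" and ev: "\<forall>\<^sub>F y in nhds (s, t).
      g (\<gamma> (fst y)) - M * (snd y - T0) - \<phi> y \<le> g (\<gamma> s) - M * (t - T0) - \<phi> (s, t)"
    using sup unfolding supertangent_on_def along_def by (auto simp: case_prod_unfold)
  note d = C1_near_DERIV_partials[OF C1]
  have "((\<lambda>\<sigma>. g (\<gamma> \<sigma>) - M * (t - T0) - \<phi> (\<sigma>, t)) has_real_derivative D s - deriv_s \<phi> s t) (at s)"
    by (auto intro!: derivative_eq_intros d D)
  then have "D s - deriv_s \<phi> s t = 0"
    by (rule DERIV_eventually_max) (use eventually_nhds_Pair(1)[OF ev] in simp)
  moreover have "((\<lambda>\<tau>. g (\<gamma> s) - M * (\<tau> - T0) - \<phi> (s, \<tau>)) has_real_derivative - M - deriv_t \<phi> s t) (at t)"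
    by (auto intro!: derivative_eq_intros d)
  then have "- M - deriv_t \<phi> s t = 0"
    by (rule DERIV_eventually_max) (use eventually_nhds_Pair(2)[OF ev] in simp)
  ultimately show "deriv_t \<phi> s t + H \<gamma> s (deriv_s \<phi> s t) \<le> 0" using D(2) by simp
qed

lemma barrier_sub_vertex:
  assumes "speed_bound g M" "x \<in> vertices E"
  shows "sub_vertex (\<lambda>(x, t). g x - M * (t - T0)) x t"
  unfolding sub_vertex_def
proof (intro allI impI)
  fix \<phi> assume "supertangent (\<lambda>t. (\<lambda>(x, t). g x - M * (t - T0)) (x, t)) \<phi> t"
  then have "\<bar>deriv \<phi> t - - M\<bar> \<le> 0"
    by (rule supertangent_slope) (simp add: algebra_simps)
  then show "deriv \<phi> t \<le> c x" using assms unfolding speed_bound_def by force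
qed

lemma barrier_subsol:
  assumes "speed_bound g M"
  shows "subsol (\<lambda>(x, t). g x - M * (t - T0))"
  unfolding subsol_def
proof (intro conjI ballI allI impI)
  show "continuous_on (\<Gamma> \<times> {T0..}) (\<lambda>(x, t). g x - M * (t - T0))"
    unfolding case_prod_unfold using assms
    by (auto intro!: continuous_intros continuous_on_compose2[of \<Gamma> g] simp: speed_bound_def)
qed (use assms in \<open>auto intro: barrier_sub_arc barrier_sub_vertex\<close>)

text \<open>Induction over polynomials shows that \<open>g\<close> is C1 along each arc up to the
  endpoints; including the endpoints is what gives a bound by compactness.\<close>

lemma speed_bound_exists:
  assumes g: "real_polynomial_function g"
  obtains M where "M > 0" "speed_bound g M"
proof -
  have "\<exists>D. continuous_on {0..1} D \<and>
      (\<forall>s\<in>{0..1}. ((\<lambda>s. g (\<gamma> s)) has_real_derivative D s) (at s within {0..1}))" if \<gamma>: "\<gamma> \<in> E" for \<gamma>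
    using g
  proof induction
    case (linear f)
    have "C1_regular \<gamma>" using network \<gamma> unfolding network_def by (elim conjE) simp
    then obtain D where D: "\<And>s. s \<in> {0..1} \<Longrightarrow> (\<gamma> has_vector_derivative D s) (at s within {0..1})"
        "continuous_on {0..1} D"
      unfolding C1_regular_def by blast
    show ?case
    proof (intro exI[of _ "\<lambda>s. f (D s)"] conjI ballI)
      show "continuous_on {0..1} (\<lambda>s. f (D s))"
        by (rule bounded_linear.continuous_on[OF linear D(2)])
      show "((\<lambda>s. f (\<gamma> s)) has_real_derivative f (D s)) (at s within {0..1})" if "s \<in> {0..1}" for s
        using bounded_linear.has_vector_derivative[OF linear D(1)[OF that]]
        by (simp add: has_real_derivative_iff_has_vector_derivative)
    qed
  next
    case (const k)
    show ?case by (intro exI[of _ "\<lambda>_. 0"]) auto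
  next
    case (add f h)
    then obtain D D' where
      "continuous_on {0..1} D" "\<forall>s\<in>{0..1}. ((\<lambda>s. f (\<gamma> s)) has_real_derivative D s) (at s within {0..1})"
      "continuous_on {0..1} D'" "\<forall>s\<in>{0..1}. ((\<lambda>s. h (\<gamma> s)) has_real_derivative D' s) (at s within {0..1})"
      by blast
    then show ?case
      by (intro exI[of _ "\<lambda>s. D s + D' s"]) (auto intro!: continuous_intros derivative_intros)
  next
    case (mult f h)
    then obtain D D' where D:
      "continuous_on {0..1} D" "\<forall>s\<in>{0..1}. ((\<lambda>s. f (\<gamma> s)) has_real_derivative D s) (at s within {0..1})"
      "continuous_on {0..1} D'" "\<forall>s\<in>{0..1}. ((\<lambda>s. h (\<gamma> s)) has_real_derivative D' s) (at s within {0..1})"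
      by blast
    then have "continuous_on {0..1} (\<lambda>s. f (\<gamma> s))" "continuous_on {0..1} (\<lambda>s. h (\<gamma> s))"
      by (auto intro: DERIV_continuous_on)
    with D show ?case
      by (intro exI[of _ "\<lambda>s. f (\<gamma> s) * D' s + D s * h (\<gamma> s)"])
        (auto intro!: continuous_intros DERIV_mult')
  qed
  then obtain D where D: "\<And>\<gamma>. \<gamma> \<in> E \<Longrightarrow> continuous_on {0..1} (D \<gamma>)"
    "\<And>\<gamma> s. \<gamma> \<in> E \<Longrightarrow> s \<in> {0..1} \<Longrightarrow> ((\<lambda>s. g (\<gamma> s)) has_real_derivative D \<gamma> s) (at s within {0..1})"
    by metis
  have "\<exists>M. \<forall>s\<in>{0..1}. \<bar>H \<gamma> s (D \<gamma> s)\<bar> \<le> M" if "\<gamma> \<in> E" for \<gamma>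
  proof -
    have "compact ((\<lambda>s. H \<gamma> s (D \<gamma> s)) ` {0..1})"
      using that by (intro compact_continuous_image H_continuous_on D(1)) auto
    then have "bounded ((\<lambda>s. H \<gamma> s (D \<gamma> s)) ` {0..1})" by (rule compact_imp_bounded)
    then show ?thesis unfolding bounded_iff by auto
  qed
  then obtain b where b: "\<And>\<gamma> s. \<gamma> \<in> E \<Longrightarrow> s \<in> {0..1} \<Longrightarrow> \<bar>H \<gamma> s (D \<gamma> s)\<bar> \<le> b \<gamma>" by metis
  define A where "A = insert 0 (b ` E \<union> (\<lambda>x. \<bar>c x\<bar>) ` vertices E)"
  have A: "finite A" unfolding A_def using finite_E finite_vertices by simp
  \<comment> \<open>The added 1 makes all bounds strict, and \<open>0 \<in> A\<close> makes
    \<open>M\<close> positive.\<close>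
  define M where "M = Max A + 1"
  have M: "a < M" if "a \<in> A" for a unfolding M_def using Max_ge[OF A that] by simp
  have "speed_bound g M" unfolding speed_bound_def
  proof (intro conjI ballI)
    show "continuous_on \<Gamma> g" using continuous_on_polymonial_function g real_polynomial_function_eq by blast
    show "\<bar>c x\<bar> < M" if "x \<in> vertices E" for x using that by (intro M) (auto simp: A_def)
    show "\<exists>D. continuous_on {0<..<1} D \<and>
        (\<forall>s\<in>{0<..<1}. ((\<lambda>s. g (\<gamma> s)) has_real_derivative D s) (at s) \<and> \<bar>H \<gamma> s (D s)\<bar> < M)"
      if \<gamma>: "\<gamma> \<in> E" for \<gamma>
    proof (intro exI[of _ "D \<gamma>"] conjI ballI)
      show "continuous_on {0<..<1} (D \<gamma>)" using D(1)[OF \<gamma>] by (rule continuous_on_subset) auto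
      fix s :: real assume s: "s \<in> {0<..<1}"
      have "((\<lambda>s. g (\<gamma> s)) has_real_derivative D \<gamma> s) (at s within {0<..<1})"
        using D(2)[OF \<gamma>, of s] s by (auto intro: DERIV_subset)
      then show "((\<lambda>s. g (\<gamma> s)) has_real_derivative D \<gamma> s) (at s)"
        unfolding at_within_open[OF s open_greaterThanLessThan] .
      have "b \<gamma> < M" using \<gamma> by (intro M) (auto simp: A_def)
      moreover have "\<bar>H \<gamma> s (D \<gamma> s)\<bar> \<le> b \<gamma>" using b[OF \<gamma>, of s] s by simp
      ultimately show "\<bar>H \<gamma> s (D \<gamma> s)\<bar> < M" by simp
    qed
  qed
  moreover have "M > 0" by (rule M) (simp add: A_def)
  ultimately show ?thesis using that by blast
qed

text \<open>Where the difference to the barrier has a positive maximum, the barrier with its penalty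
  is a test function for \<open>v\<close> with time slope at least \<open>M\<close>. This exceeds
  both what \<open>H\<close> along an arc and what \<open>c\<close> at a vertex allow. The time
  horizon is extended to \<open>t + 1\<close> so that the maximum is attained at an interior
  time.\<close>

lemma comparison:
  assumes v: "subsol v" and init: "\<And>x. x \<in> \<Gamma> \<Longrightarrow> v (x, T0) \<le> g x" and g: "speed_bound g M"
    and x: "x \<in> \<Gamma>" and t: "T0 \<le> t"
  shows "v (x, t) \<le> g x + M * (t - T0)"
proof (rule ccontr)
  assume neg: "\<not> ?thesis"
  define K where "K = \<Gamma> \<times> {T0..t + 1}"
  have K: "compact K" unfolding K_def using compact_network by (intro compact_Times) auto
  define F where "F = (\<lambda>z. v z - g (fst z) - M * (snd z - T0))"
  have cg: "continuous_on \<Gamma> g" using g by (simp add: speed_bound_def)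
  have cF: "continuous_on K F" unfolding F_def
    by (intro continuous_intros continuous_on_subset[OF subsolD(1)[OF v]] continuous_on_compose2[OF cg])
      (auto simp: K_def)
  then obtain B where B: "\<And>z. z \<in> K \<Longrightarrow> \<bar>F z\<bar> \<le> B"
    using compact_imp_bounded[OF compact_continuous_image[OF cF K]] unfolding bounded_iff by auto
  define C where "C = max 0 B"
  \<comment> \<open>The penalty is zero at \<open>(x, t)\<close>, so the maximum of \<open>G\<close>
    remains positive. At time \<open>t + 1\<close> the penalty equals \<open>C\<close>, which
    dominates \<open>F\<close>.\<close>
  define G where "G = (\<lambda>z. F z - C * (max 0 (snd z - t))\<^sup>2)"
  have "continuous_on K G" unfolding G_def by (intro continuous_intros cF)
  moreover have "(x, t) \<in> K" unfolding K_def using x t by auto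
  ultimately obtain z where z: "z \<in> K" "\<And>y. y \<in> K \<Longrightarrow> G y \<le> G z"
    using continuous_attains_sup[OF K, of G] by blast
  obtain x1 t1 where z1: "z = (x1, t1)" by (cases z)
  have pos: "G z > 0" using z(2)[OF \<open>(x, t) \<in> K\<close>] neg by (simp add: G_def F_def)
  have x1: "x1 \<in> \<Gamma>" "T0 \<le> t1" "t1 \<le> t + 1" using z(1) unfolding z1 K_def by auto
  have "t1 \<noteq> T0" using pos init[OF x1(1)] t by (auto simp: G_def F_def z1)
  moreover have "t1 \<noteq> t + 1"
  proof
    assume "t1 = t + 1"
    then have "G z = F z - C" by (simp add: G_def z1)
    then show False using B[OF z(1)] pos by (auto simp: C_def)
  qed
  ultimately have t1: "T0 < t1" "t1 < t + 1" using x1 by auto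
  define b where "b \<tau> = M * (\<tau> - T0) + C * (max 0 (\<tau> - t))\<^sup>2" for \<tau>
  define b' where "b' \<tau> = M + C * (2 * max 0 (\<tau> - t))" for \<tau>
  have b: "(b has_real_derivative b' \<tau>) (at \<tau>)" for \<tau>
    unfolding b_def b'_def
    by (rule DERIV_add[OF _ has_real_derivative_max_0_square]) (auto intro!: derivative_eq_intros)
  have cb: "continuous_on A b'" for A unfolding b'_def by (intro continuous_intros)
  have b1: "b' t1 \<ge> M" unfolding b'_def C_def by simp
  have mx: "v (y, \<tau>) - g y - b \<tau> \<le> v (x1, t1) - g x1 - b t1" if "y \<in> \<Gamma>" "T0 \<le> \<tau>" "\<tau> \<le> t + 1" for y \<tau>
    using z(2)[of "(y, \<tau>)"] that by (auto simp: K_def z1 G_def F_def b_def)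
  show False
  proof (cases "x1 \<in> vertices E")
    case True
    have "supertangent (\<lambda>t. v (x1, t)) b t1" unfolding supertangent_on_def
    proof
      show "C1_near b t1" by (rule C1_near_realI[OF open_UNIV _ b cb]) simp
      show "\<forall>\<^sub>F \<tau> in nhds t1. \<tau> \<in> UNIV \<longrightarrow> v (x1, \<tau>) - b \<tau> \<le> v (x1, t1) - b t1"
        by (rule eventually_nhds_in_open[of "{T0<..<t + 1}", THEN eventually_mono])
          (use t1 in \<open>auto dest!: mx[OF x1(1) less_imp_le less_imp_le]\<close>)
    qed
    then have "deriv b t1 \<le> c x1"
      using subsolD(3)[OF v True t1(1)] unfolding sub_vertex_def by blast
    moreover have "\<bar>c x1\<bar> < M" using g True by (auto simp: speed_bound_def)
    ultimately show False using DERIV_imp_deriv[OF b] b1 by simp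
  next
    case False
    obtain \<gamma> s where \<gamma>: "\<gamma> \<in> E" "s \<in> {0..1}" "x1 = \<gamma> s" using network_pointE[OF x1(1)] .
    have "s \<noteq> 0" "s \<noteq> 1" using False endpoint_vertex[OF \<gamma>(1)] \<gamma>(3) by auto
    then have s: "0 < s" "s < 1" using \<gamma>(2) by auto
    obtain D where D: "continuous_on {0<..<1} D"
        "\<And>s. 0 < s \<Longrightarrow> s < 1 \<Longrightarrow> ((\<lambda>s. g (\<gamma> s)) has_real_derivative D s) (at s)"
        "\<And>s. 0 < s \<Longrightarrow> s < 1 \<Longrightarrow> \<bar>H \<gamma> s (D s)\<bar> < M"
      using speed_boundE[OF g \<gamma>(1)] by metis
    have "supertangent (along v \<gamma>) (\<lambda>(\<sigma>, \<tau>). g (\<gamma> \<sigma>) + b \<tau>) (s, t1)" unfolding supertangent_on_def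
    proof
      show "C1_near (\<lambda>(\<sigma>, \<tau>). g (\<gamma> \<sigma>) + b \<tau>) (s, t1)"
        by (rule C1_near_separable[of "{0<..<1}" _ _ D UNIV _ _ b']) (use s D b cb in auto)
      show "\<forall>\<^sub>F y in nhds (s, t1). y \<in> UNIV \<longrightarrow> along v \<gamma> y - (case y of (\<sigma>, \<tau>) \<Rightarrow> g (\<gamma> \<sigma>) + b \<tau>)
          \<le> along v \<gamma> (s, t1) - (case (s, t1) of (\<sigma>, \<tau>) \<Rightarrow> g (\<gamma> \<sigma>) + b \<tau>)"
      proof (rule eventually_nhds_box[of 0 _ 1 T0 _ "t + 1"])
        fix \<sigma> \<tau> :: real assume "0 < \<sigma>" "\<sigma> < 1" "T0 < \<tau>" "\<tau> < t + 1"
        then show "(\<sigma>, \<tau>) \<in> UNIV \<longrightarrow> along v \<gamma> (\<sigma>, \<tau>) - (case (\<sigma>, \<tau>) of (\<sigma>, \<tau>) \<Rightarrow> g (\<gamma> \<sigma>) + b \<tau>)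
          \<le> along v \<gamma> (s, t1) - (case (s, t1) of (\<sigma>, \<tau>) \<Rightarrow> g (\<gamma> \<sigma>) + b \<tau>)"
          using mx[of "\<gamma> \<sigma>" \<tau>] arc_point_in[OF \<gamma>(1), of \<sigma>] \<gamma>(3) by (simp add: along_def)
      qed (use s t1 in auto)
    qed
    then have "b' t1 + H \<gamma> s (D s) \<le> 0"
      using subsolD(2)[OF v \<gamma>(1) s t1(1)] unfolding sub_arc_def
      by (metis deriv_separable[OF D(2)[OF s] b])
    then show False using b1 D(3)[OF s] by simp
  qed
qed

section \<open>Lipschitz bound in space from coercivity\<close>

text \<open>
  Where a test function touches \<open>v\<close> from above, its time derivative is at least \<open>- M\<close>, so that its
  slope in space is less than \<open>R\<close>.
\<close>

lemma spatial_slope_interior: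
  assumes v: "subsol v"
    and mono: "\<And>x t t'. x \<in> \<Gamma> \<Longrightarrow> T0 \<le> t \<Longrightarrow> t \<le> t' \<Longrightarrow> v (x, t) - M * (t' - t) \<le> v (x, t')"
    and R: "R > 0" "\<And>\<gamma> s p. \<gamma> \<in> E \<Longrightarrow> s \<in> {0..1} \<Longrightarrow> \<bar>p\<bar> \<ge> R \<Longrightarrow> H \<gamma> s p \<ge> M + 1"
    and \<gamma>: "\<gamma> \<in> E" and ab: "0 < a" "a < b" "b < 1" and t0: "T0 < t0"
  shows "v (\<gamma> b, t0) - v (\<gamma> a, t0) \<le> R * (b - a)"
proof (rule ccontr)
  define V where "V = along v \<gamma>"
  assume neg: "\<not> ?thesis"
  define m where "m = V (b, t0) - V (a, t0) - R * (b - a)"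
  have m: "m > 0" using neg by (simp add: m_def V_def along_def)
  have cV: "continuous_on ({0..1} \<times> {T0..}) V"
    unfolding V_def by (rule along_continuous[OF subsolD(1)[OF v] \<gamma>])
  \<comment> \<open>The strip between \<open>b\<close> and \<open>b'\<close> leaves room for a
    penalty that keeps the maximum away from the right end.\<close>
  define b' where "b' = (b + 1) / 2"
  have b': "b < b'" "b' < 1" using ab by (auto simp: b'_def)
  obtain d where d: "d > 0" "\<And>y. y \<in> {0..1} \<times> {T0..} \<Longrightarrow> dist y (a, t0) < d \<Longrightarrow> dist (V y) (V (a, t0)) < m / 2"
    using cV[unfolded continuous_on_iff, rule_format, of "(a, t0)" "m / 2"] ab t0 m by auto
  define \<delta> where "\<delta> = min (d / 2) ((t0 - T0) / 2)"
  have \<delta>: "\<delta> > 0" "T0 < t0 - \<delta>" "\<delta> < d" unfolding \<delta>_def using d t0 by (auto simp: min_def field_simps)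
  have near: "V (a, t) < V (a, t0) + m / 2" if "\<bar>t - t0\<bar> \<le> \<delta>" for t
  proof -
    have "(a, t) \<in> {0..1} \<times> {T0..}" using ab that \<delta> by (auto simp: abs_le_iff)
    moreover have "dist (a, t) (a, t0) < d" using that \<delta> by (simp add: dist_Pair_Pair dist_real_def)
    ultimately have "dist (V (a, t)) (V (a, t0)) < m / 2" by (rule d(2))
    then show ?thesis unfolding dist_real_def by linarith
  qed
  define K where "K = {a..b'} \<times> {t0 - \<delta>..t0 + \<delta>}"
  have K: "compact K" "K \<noteq> {}" "K \<subseteq> {0..1} \<times> {T0..}"
    unfolding K_def using ab b' \<delta> by (auto intro!: compact_Times)
  have cVK: "continuous_on K V" by (rule continuous_on_subset[OF cV K(3)])
  obtain B where B: "\<And>z. z \<in> K \<Longrightarrow> \<bar>V z\<bar> \<le> B"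
    using compact_imp_bounded[OF compact_continuous_image[OF cVK K(1)]] unfolding bounded_iff by auto
  \<comment> \<open>At \<open>s = b'\<close> the penalty exceeds the oscillation
    \<open>2 * B\<close> of \<open>V\<close> on \<open>K\<close>. The time penalty must in addition
    absorb the linear part of \<open>\<zeta>\<close>, which contributes at most \<open>R\<close>,
    since \<open>s\<close> ranges in \<open>[0,1]\<close>.\<close>
  define C1 where "C1 = (2 * B + 1) / (b' - b)\<^sup>2"
  define C2 where "C2 = (2 * B + R + 1) / \<delta>\<^sup>2"
  have zK: "(b, t0) \<in> K" unfolding K_def using ab b' \<delta> by auto
  have Bnn: "B \<ge> 0" using B[OF zK] by linarith
  have C12: "C1 \<ge> 0" "C2 \<ge> 0" "C1 * (b' - b)\<^sup>2 = 2 * B + 1" "C2 * \<delta>\<^sup>2 = 2 * B + R + 1"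
    unfolding C1_def C2_def using Bnn R(1) b' \<delta> by auto
  define \<zeta> where "\<zeta> s = R * s + C1 * (max 0 (s - b))\<^sup>2" for s
  define \<zeta>' where "\<zeta>' s = R + C1 * (2 * max 0 (s - b))" for s
  define \<kappa> where "\<kappa> t = C2 * (t - t0)\<^sup>2" for t
  define \<kappa>' where "\<kappa>' t = C2 * (2 * (t - t0))" for t
  have d\<zeta>: "(\<zeta> has_real_derivative \<zeta>' s) (at s)" for s unfolding \<zeta>_def \<zeta>'_def
    by (rule DERIV_add[OF _ has_real_derivative_max_0_square]) (auto intro!: derivative_eq_intros)
  have d\<kappa>: "(\<kappa> has_real_derivative \<kappa>' t) (at t)" for t unfolding \<kappa>_def \<kappa>'_def
    by (auto intro!: derivative_eq_intros)
  have cont: "continuous_on A \<zeta>" "continuous_on A \<zeta>'" "continuous_on A \<kappa>" "continuous_on A \<kappa>'" for A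
    unfolding \<zeta>_def \<zeta>'_def \<kappa>_def \<kappa>'_def by (intro continuous_intros)+
  define F where "F = (\<lambda>z. V z - (\<zeta> (fst z) + \<kappa> (snd z)))"
  have "continuous_on K F" unfolding F_def
    by (intro continuous_intros cVK continuous_on_compose2[OF cont(1)[of UNIV]]
        continuous_on_compose2[OF cont(3)[of UNIV]]) auto
  then obtain z where z: "z \<in> K" "\<And>y. y \<in> K \<Longrightarrow> F y \<le> F z"
    using continuous_attains_sup[OF K(1,2), of F] by blast
  obtain s1 t1 where z1: "z = (s1, t1)" by (cases z)
  have in1: "a \<le> s1" "s1 \<le> b'" "\<bar>t1 - t0\<bar> \<le> \<delta>" using z(1) unfolding z1 K_def by auto
  have ge: "V (b, t0) - R * b \<le> V (s1, t1) - \<zeta> s1 - \<kappa> t1"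
    using z(2)[OF zK] by (simp add: F_def z1 \<zeta>_def \<kappa>_def)
  have Vb: "- B \<le> V (b, t0)" "V (s1, t1) \<le> B" using B[OF zK] B[OF z(1)] z1 by auto
  have \<zeta>1: "\<zeta> s1 \<ge> R * s1" and \<kappa>1: "\<kappa> t1 \<ge> 0" using C12 by (simp_all add: \<zeta>_def \<kappa>_def)
  \<comment> \<open>On the left end the excess \<open>m\<close> of the increment of \<open>V\<close>
    over slope \<open>R\<close> decides, because \<open>V (a, t)\<close> rises by less than
    \<open>m / 2\<close> within \<open>\<delta>\<close>.\<close>
  have "s1 \<noteq> a"
  proof
    assume "s1 = a"
    then have "V (b, t0) - R * b \<le> V (a, t1) - R * a" using ge \<zeta>1 \<kappa>1 by simp
    then have "V (a, t0) + m \<le> V (a, t1)" by (simp add: m_def algebra_simps)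
    then show False using near[OF in1(3)] m by linarith
  qed
  moreover have "s1 \<noteq> b'"
  proof
    assume "s1 = b'"
    then have "\<zeta> s1 = R * b' + (2 * B + 1)" using b' C12(3) by (simp add: \<zeta>_def)
    moreover have "R * b \<le> R * b'" using b' R(1) by simp
    ultimately show False using ge \<kappa>1 Vb by linarith
  qed
  moreover have "\<bar>t1 - t0\<bar> \<noteq> \<delta>"
  proof
    assume "\<bar>t1 - t0\<bar> = \<delta>"
    then have "(t1 - t0)\<^sup>2 = \<delta>\<^sup>2" by (metis power2_abs)
    then have "\<kappa> t1 = 2 * B + R + 1" using C12(4) by (simp add: \<kappa>_def)
    moreover have "R * b \<le> R * 1" "0 \<le> R * s1" using ab in1 R(1) by simp_all
    ultimately show False using ge \<zeta>1 Vb by linarith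
  qed
  ultimately have in2: "a < s1" "s1 < b'" "t0 - \<delta> < t1" "t1 < t0 + \<delta>"
    using in1 by (auto simp: abs_if split: if_splits)
  have st: "0 < s1" "s1 < 1" "T0 < t1" using in2 ab b' \<delta> by auto
  have mx: "V (\<sigma>, \<tau>) - (\<zeta> \<sigma> + \<kappa> \<tau>) \<le> V (s1, t1) - (\<zeta> s1 + \<kappa> t1)"
    if "a < \<sigma>" "\<sigma> < b'" "t0 - \<delta> < \<tau>" "\<tau> < t0 + \<delta>" for \<sigma> \<tau>
    using z(2)[of "(\<sigma>, \<tau>)"] that unfolding F_def z1 K_def by auto
  have "supertangent V (\<lambda>(\<sigma>, \<tau>). \<zeta> \<sigma> + \<kappa> \<tau>) (s1, t1)" unfolding supertangent_on_def
  proof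
    show "C1_near (\<lambda>(\<sigma>, \<tau>). \<zeta> \<sigma> + \<kappa> \<tau>) (s1, t1)"
      by (rule C1_near_separable[OF open_UNIV _ d\<zeta> cont(2) open_UNIV _ d\<kappa> cont(4)]) auto
    show "\<forall>\<^sub>F y in nhds (s1, t1). y \<in> UNIV \<longrightarrow> V y - (case y of (\<sigma>, \<tau>) \<Rightarrow> \<zeta> \<sigma> + \<kappa> \<tau>)
          \<le> V (s1, t1) - (case (s1, t1) of (\<sigma>, \<tau>) \<Rightarrow> \<zeta> \<sigma> + \<kappa> \<tau>)"
      by (rule eventually_nhds_box[OF in2]) (use mx in auto)
  qed
  then have "\<kappa>' t1 + H \<gamma> s1 (\<zeta>' s1) \<le> 0"
    using subsolD(2)[OF v \<gamma> st] unfolding sub_arc_def V_def by (metis deriv_separable[OF d\<zeta> d\<kappa>])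
  moreover have "H \<gamma> s1 (\<zeta>' s1) \<ge> M + 1"
  proof -
    have "0 \<le> C1 * (2 * max 0 (s1 - b))" using C12(1) by simp
    then have "R \<le> \<bar>\<zeta>' s1\<bar>" unfolding \<zeta>'_def by linarith
    then show ?thesis using st by (intro R(2) \<gamma>) auto
  qed
  \<comment> \<open>The test function would decrease in time faster than at rate \<open>M\<close>.
    Since it touches \<open>v\<close> from above, so would \<open>v\<close>, against
    \<open>mono\<close>; a small step \<open>h\<close> forward in time makes this explicit.\<close>
  ultimately have lt: "\<kappa>' t1 + M < 0" by simp
  have "((\<lambda>t. \<kappa> t + M * t) has_real_derivative \<kappa>' t1 + M) (at t1)"
    by (auto intro!: derivative_eq_intros d\<kappa>)
  from DERIV_neg_dec_right[OF this lt] obtain e where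
    e: "e > 0" "\<And>h. 0 < h \<Longrightarrow> h < e \<Longrightarrow> \<kappa> (t1 + h) + M * (t1 + h) < \<kappa> t1 + M * t1" by auto
  define h where "h = min (e / 2) ((t0 + \<delta> - t1) / 2)"
  have h: "0 < h" "h < e" "t1 + h < t0 + \<delta>" unfolding h_def using e in2 by (auto simp: min_def field_simps)
  have "V (s1, t1 + h) - \<kappa> (t1 + h) \<le> V (s1, t1) - \<kappa> t1" using mx[of s1 "t1 + h"] in2 h by simp
  moreover have "V (s1, t1) - M * h \<le> V (s1, t1 + h)"
    using mono[of "\<gamma> s1" t1 "t1 + h"] arc_point_in[OF \<gamma>, of s1] st h by (simp add: V_def along_def)
  ultimately show False using e(2)[OF h(1,2)] by (simp add: algebra_simps)
qed

text \<open>The inverse arc turns the one-sided bound into a two-sided one. The endpoints of the arc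
  and the initial time, where the arc equation is not imposed, are reached by continuity.\<close>

lemma spatial_lipschitz:
  assumes v: "subsol v"
    and mono: "\<And>x t t'. x \<in> \<Gamma> \<Longrightarrow> T0 \<le> t \<Longrightarrow> t \<le> t' \<Longrightarrow> v (x, t) - M * (t' - t) \<le> v (x, t')"
    and R: "R > 0" "\<And>\<gamma> s p. \<gamma> \<in> E \<Longrightarrow> s \<in> {0..1} \<Longrightarrow> \<bar>p\<bar> \<ge> R \<Longrightarrow> H \<gamma> s p \<ge> M + 1"
    and \<gamma>: "\<gamma> \<in> E" and s: "s \<in> {0..1}" "s' \<in> {0..1}" and t: "T0 \<le> t"
  shows "\<bar>v (\<gamma> s, t) - v (\<gamma> s', t)\<bar> \<le> R * \<bar>s - s'\<bar>"
proof -
  have core: "v (\<gamma> b, t) - v (\<gamma> a, t) \<le> R * (b - a)"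
    if "\<gamma> \<in> E" "0 < a" "a < b" "b < 1" "T0 < t" for \<gamma> a b t
    by (rule spatial_slope_interior[OF v, where M = M]) (use mono R that in auto)
  have one: "\<bar>v (\<gamma> b, t) - v (\<gamma> a, t)\<bar> \<le> R * (b - a)" if "0 < a" "a < b" "b < 1" "T0 < t" for a b t
  proof -
    have "v (reversepath \<gamma> (1 - a), t) - v (reversepath \<gamma> (1 - b), t) \<le> R * ((1 - a) - (1 - b))"
      by (rule core) (use that reversepath_E[OF \<gamma>] in auto)
    then show ?thesis using core[OF \<gamma> that] by (auto simp: reversepath_def abs_le_iff)
  qed
  have int: "\<bar>v (\<gamma> b, t) - v (\<gamma> a, t)\<bar> \<le> R * \<bar>b - a\<bar>" if "0 < a" "a < 1" "0 < b" "b < 1" "T0 < t" for a b t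
    using one[of a b t] one[of b a t] that by (cases a b rule: linorder_cases) (auto simp: abs_minus_commute)
  define \<delta> where "\<delta> n = 1 / real (n + 2)" for n
  have \<delta>: "0 < \<delta> n" "\<delta> n < 1" for n by (auto simp: \<delta>_def)
  have lim\<delta>: "\<delta> \<longlonglongrightarrow> 0"
    unfolding \<delta>_def using LIMSEQ_ignore_initial_segment[OF lim_1_over_n, of 2] by simp
  \<comment> \<open>Contraction towards the midpoint, which moves both endpoints into the open
    arc.\<close>
  define f where "f a n = (1 - \<delta> n) * a + \<delta> n / 2" for a n
  have f: "0 < f a n" "f a n < 1" if "a \<in> {0..1}" for a n
  proof -
    have "0 \<le> (1 - \<delta> n) * a" "(1 - \<delta> n) * a \<le> 1 - \<delta> n"
      using that \<delta>[of n] mult_left_mono[of a 1 "1 - \<delta> n"] by auto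
    then have "0 < f a n \<and> f a n < 1" unfolding f_def using \<delta>[of n] by (safe; linarith)
    then show "0 < f a n" "f a n < 1" by auto
  qed
  have limf: "f a \<longlonglongrightarrow> a" for a
    unfolding f_def by (auto intro!: tendsto_eq_intros lim\<delta>)
  have lim: "(\<lambda>n. v (\<gamma> (f a n), t + \<delta> n)) \<longlonglongrightarrow> v (\<gamma> a, t)" if "a \<in> {0..1}" for a
  proof -
    have "(\<lambda>n. along v \<gamma> (f a n, t + \<delta> n)) \<longlonglongrightarrow> along v \<gamma> (a, t)"
    proof (rule continuous_on_tendsto_compose[OF along_continuous[OF subsolD(1)[OF v] \<gamma>]])
      show "(\<lambda>n. (f a n, t + \<delta> n)) \<longlonglongrightarrow> (a, t)"
        by (auto intro!: tendsto_eq_intros lim\<delta> limf)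
      show "\<forall>\<^sub>F n in sequentially. (f a n, t + \<delta> n) \<in> {0..1} \<times> {T0..}"
        using f[OF that] \<delta> t by (auto intro!: always_eventually simp: less_imp_le add_increasing2)
    qed (use that t in auto)
    then show ?thesis by (simp add: along_def)
  qed
  have "(\<lambda>n. \<bar>v (\<gamma> (f s n), t + \<delta> n) - v (\<gamma> (f s' n), t + \<delta> n)\<bar>) \<longlonglongrightarrow> \<bar>v (\<gamma> s, t) - v (\<gamma> s', t)\<bar>"
    by (intro tendsto_intros lim s)
  moreover have "(\<lambda>n. R * \<bar>f s n - f s' n\<bar>) \<longlonglongrightarrow> R * \<bar>s - s'\<bar>"
    by (intro tendsto_intros limf)
  moreover have "\<bar>v (\<gamma> (f s n), t + \<delta> n) - v (\<gamma> (f s' n), t + \<delta> n)\<bar> \<le> R * \<bar>f s n - f s' n\<bar>" for n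
    using int[of "f s' n" "f s n" "t + \<delta> n"] f s \<delta>[of n] t by auto
  ultimately show ?thesis by (intro LIMSEQ_le) auto
qed

section \<open>Enlarging a subsolution so that its time derivative is bounded below\<close>

text \<open>
  The function \<open>w\<close> is the supremum of \<open>v (x, r) - M (t - r)\<close> over \<open>r \<in> [T\<^sub>0, t]\<close>. It is touched from below
  by a time shift of \<open>v\<close> if the supremum is attained at some \<open>r > T\<^sub>0\<close>, and by the barrier otherwise.
\<close>

lemma running_supremum:
  assumes v: "subsol v" and g: "speed_bound g M"
    and init: "\<And>x. x \<in> \<Gamma> \<Longrightarrow> v (x, T0) = g x"
    and above: "\<And>x t. x \<in> \<Gamma> \<Longrightarrow> T0 \<le> t \<Longrightarrow> g x - M * (t - T0) \<le> v (x, t)"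
  obtains w where "subsol w" "\<And>x. x \<in> \<Gamma> \<Longrightarrow> w (x, T0) = g x"
    "\<And>x t. x \<in> \<Gamma> \<Longrightarrow> T0 \<le> t \<Longrightarrow> v (x, t) \<le> w (x, t)"
    "\<And>x t t'. x \<in> \<Gamma> \<Longrightarrow> T0 \<le> t \<Longrightarrow> t \<le> t' \<Longrightarrow> w (x, t) - M * (t' - t) \<le> w (x, t')"
proof -
  \<comment> \<open>Writing \<open>r = T0 + \<theta> * (t - T0)\<close> replaces the interval
    \<open>[T0, t]\<close>, which depends on \<open>t\<close>, by the fixed compact parameter set
    \<open>[0,1]\<close>. Continuity of the supremum then follows from continuity uniform in
    \<open>\<theta>\<close>.\<close>
  define f where "f = (\<lambda>(z, \<theta>). v (fst z, T0 + \<theta> * (snd z - T0)) - M * ((1 - \<theta>) * (snd z - T0)))"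
  have cf: "continuous_on ((\<Gamma> \<times> {T0..}) \<times> {0..1}) f"
    unfolding f_def case_prod_unfold
    by (intro continuous_intros continuous_on_compose2[OF subsolD(1)[OF v]]) auto
  have "\<exists>w. (\<exists>\<theta>\<in>{0..1}. w = f (z, \<theta>)) \<and> (\<forall>\<theta>\<in>{0..1}. f (z, \<theta>) \<le> w)" if "z \<in> \<Gamma> \<times> {T0..}" for z
  proof -
    have "continuous_on {0..1} (\<lambda>\<theta>. f (z, \<theta>))"
      by (rule continuous_on_compose2[OF cf]) (use that in \<open>auto intro!: continuous_intros\<close>)
    from continuous_attains_sup[OF _ _ this] show ?thesis by fastforce
  qed
  then obtain w where w: "\<And>z. z \<in> \<Gamma> \<times> {T0..} \<Longrightarrow> \<exists>\<theta>\<in>{0..1}. w z = f (z, \<theta>)"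
    "\<And>z \<theta>. z \<in> \<Gamma> \<times> {T0..} \<Longrightarrow> \<theta> \<in> {0..1} \<Longrightarrow> f (z, \<theta>) \<le> w z" by metis
  have w1: "\<exists>r\<in>{T0..t}. w (x, t) = v (x, r) - M * (t - r)" if xt: "x \<in> \<Gamma>" "T0 \<le> t" for x t
  proof -
    obtain \<theta> where \<theta>: "\<theta> \<in> {0..1}" "w (x, t) = f ((x, t), \<theta>)" using w(1)[of "(x, t)"] xt by auto
    have "\<theta> * (t - T0) \<le> 1 * (t - T0)" using \<theta> xt by (intro mult_right_mono) auto
    moreover have "0 \<le> \<theta> * (t - T0)" using \<theta> xt by simp
    ultimately have "T0 + \<theta> * (t - T0) \<in> {T0..t}" by simp
    then show ?thesis using \<theta> xt
      by (intro bexI[of _ "T0 + \<theta> * (t - T0)"]) (simp_all add: f_def algebra_simps)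
  qed
  have w2: "v (x, r) - M * (t - r) \<le> w (x, t)" if "x \<in> \<Gamma>" "T0 \<le> r" "r \<le> t" for x t r
  proof (cases "t = T0")
    case True
    then show ?thesis using w(2)[of "(x, t)" 1] that by (auto simp: f_def)
  next
    case False
    define \<theta> where "\<theta> = (r - T0) / (t - T0)"
    have "\<theta> \<in> {0..1}" "\<theta> * (t - T0) = r - T0" unfolding \<theta>_def using False that by (auto simp: divide_le_eq)
    then have "T0 + \<theta> * (t - T0) = r" "(1 - \<theta>) * (t - T0) = t - r" by (auto simp: left_diff_distrib)
    then have "f ((x, t), \<theta>) = v (x, r) - M * (t - r)" by (simp add: f_def)
    then show ?thesis using w(2)[of "(x, t)" \<theta>] \<open>\<theta> \<in> {0..1}\<close> that by auto
  qed
  have cw: "continuous_on (\<Gamma> \<times> {T0..}) w"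
    unfolding continuous_on_iff
  proof (intro ballI allI impI)
    fix z and e :: real assume z: "z \<in> \<Gamma> \<times> {T0..}" and "e > 0"
    then have "e / 2 > 0" by simp
    from continuous_on_prod_compactE[OF cf compact_Icc z this]
    obtain X where X: "z \<in> X" "open X"
      "\<forall>y\<in>X \<inter> \<Gamma> \<times> {T0..}. \<forall>\<theta>\<in>{0..1}. dist (f (y, \<theta>)) (f (z, \<theta>)) \<le> e / 2" by blast
    obtain d where d: "d > 0" "\<And>y. dist y z < d \<Longrightarrow> y \<in> X" using X(1,2) unfolding open_dist by blast
    have "dist (w y) (w z) < e" if y: "y \<in> \<Gamma> \<times> {T0..}" "dist y z < d" for y
    proof -
      obtain \<theta> \<theta>' where "\<theta> \<in> {0..1}" "w y = f (y, \<theta>)" "\<theta>' \<in> {0..1}" "w z = f (z, \<theta>')"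
        using w(1)[OF y(1)] w(1)[OF z] by blast
      moreover have "dist (f (y, \<theta>)) (f (z, \<theta>)) \<le> e / 2" "dist (f (y, \<theta>')) (f (z, \<theta>')) \<le> e / 2"
        using X(3) d(2)[OF y(2)] y(1) calculation by auto
      moreover have "f (z, \<theta>) \<le> w z" "f (y, \<theta>') \<le> w y"
        using w(2)[OF z, of \<theta>] w(2)[OF y(1), of \<theta>'] calculation by blast+
      ultimately show ?thesis using \<open>e > 0\<close> unfolding dist_real_def by argo
    qed
    then show "\<exists>d>0. \<forall>x'\<in>\<Gamma> \<times> {T0..}. dist x' z < d \<longrightarrow> dist (w x') (w z) < e" using d(1) by blast
  qed
  have barrier: "g x - M * (t - T0) \<le> w (x, t)" if "x \<in> \<Gamma>" "T0 \<le> t" for x t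
    using w2[of x t t] above[of x t] that by simp
  show ?thesis
  proof (rule that)
    show "subsol w" unfolding subsol_def
    proof (intro conjI ballI allI impI)
      fix \<gamma> s t assume \<gamma>: "\<gamma> \<in> E" and s: "s \<in> {0<..<1::real}" and t: "T0 < t"
      have in\<Gamma>: "\<gamma> \<sigma> \<in> \<Gamma>" if "0 < \<sigma>" "\<sigma> < 1" for \<sigma> using arc_point_in[OF \<gamma>, of \<sigma>] that by auto
      obtain r where r: "r \<in> {T0..t}" "w (\<gamma> s, t) = v (\<gamma> s, r) - M * (t - r)"
        using w1[of "\<gamma> s" t] in\<Gamma> s t by auto
      show "sub_arc w \<gamma> s t"
      proof (cases "r = T0")
        case True
        show ?thesis
        proof (rule sub_arc_touch[OF barrier_sub_arc[OF g \<gamma>]])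
          show "(\<lambda>(x, t). g x - M * (t - T0)) (\<gamma> s, t) = w (\<gamma> s, t)" using r True init in\<Gamma> s by simp
          show "\<forall>\<^sub>F y in nhds (s, t). along (\<lambda>(x, t). g x - M * (t - T0)) \<gamma> y \<le> along w \<gamma> y"
            by (rule eventually_nhds_box[of 0 _ 1 T0 _ "t + 1"])
              (use s t barrier in\<Gamma> in \<open>auto simp: along_def\<close>)
        qed (use s in auto)
      next
        case False
        have "sub_arc v \<gamma> s (t + (r - t))" using subsolD(2)[OF v \<gamma>, of s r] s r(1) False by simp
        from sub_arc_shift[OF this, of "M * (t - r)"] show ?thesis
        proof (rule sub_arc_touch)
          show "(\<lambda>(x, \<tau>). v (x, \<tau> + (r - t)) - M * (t - r)) (\<gamma> s, t) = w (\<gamma> s, t)" using r by simp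
          show "\<forall>\<^sub>F y in nhds (s, t). along (\<lambda>(x, \<tau>). v (x, \<tau> + (r - t)) - M * (t - r)) \<gamma> y \<le> along w \<gamma> y"
          \<comment> \<open>The box begins where the shifted time \<open>\<tau> + (r - t)\<close>
            equals \<open>T0\<close>; it contains \<open>t\<close> because
            \<open>r > T0\<close>.\<close>
          proof (rule eventually_nhds_box[of 0 _ 1 "T0 + (t - r)" _ "t + 1"])
            fix \<sigma> \<tau> :: real assume "0 < \<sigma>" "\<sigma> < 1" "T0 + (t - r) < \<tau>"
            then show "along (\<lambda>(x, \<tau>). v (x, \<tau> + (r - t)) - M * (t - r)) \<gamma> (\<sigma>, \<tau>) \<le> along w \<gamma> (\<sigma>, \<tau>)"
              using w2[of "\<gamma> \<sigma>" "\<tau> + (r - t)" \<tau>] in\<Gamma> r(1) by (simp add: along_def)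
          qed (use s r False in auto)
        qed
      qed
    next
      fix x t assume x: "x \<in> vertices E" and t: "T0 < t"
      obtain r where r: "r \<in> {T0..t}" "w (x, t) = v (x, r) - M * (t - r)"
        using w1[of x t] vertex_in[OF x] t by auto
      show "sub_vertex w x t"
      proof (cases "r = T0")
        case True
        show ?thesis
        proof (rule sub_vertex_touch[OF barrier_sub_vertex[OF g x]])
          show "(\<lambda>(x, t). g x - M * (t - T0)) (x, t) = w (x, t)"
            using r True init vertex_in[OF x] by simp
          show "\<forall>\<^sub>F \<tau> in nhds t. (\<lambda>(x, t). g x - M * (t - T0)) (x, \<tau>) \<le> w (x, \<tau>)"
            by (rule eventually_nhds_in_open[of "{T0<..}", THEN eventually_mono])
              (use t barrier vertex_in[OF x] in auto)
        qed
      next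
        case False
        have "sub_vertex v x (t + (r - t))" using subsolD(3)[OF v x, of r] r(1) False by simp
        from sub_vertex_shift[OF this, of "M * (t - r)"] show ?thesis
        proof (rule sub_vertex_touch)
          show "(\<lambda>(x, \<tau>). v (x, \<tau> + (r - t)) - M * (t - r)) (x, t) = w (x, t)" using r by simp
          show "\<forall>\<^sub>F \<tau> in nhds t. (\<lambda>(x, \<tau>). v (x, \<tau> + (r - t)) - M * (t - r)) (x, \<tau>) \<le> w (x, \<tau>)"
          proof (rule eventually_nhds_in_open[of "{T0 + (t - r)<..}", THEN eventually_mono])
            fix \<tau> assume "\<tau> \<in> {T0 + (t - r)<..}"
            then show "(\<lambda>(x, \<tau>). v (x, \<tau> + (r - t)) - M * (t - r)) (x, \<tau>) \<le> w (x, \<tau>)"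
              using w2[of x "\<tau> + (r - t)" \<tau>] vertex_in[OF x] r(1) by simp
          qed (use r False in auto)
        qed
      qed
    qed (rule cw)
    show "w (x, T0) = g x" if "x \<in> \<Gamma>" for x using w1[of x T0] init that by auto
    show "v (x, t) \<le> w (x, t)" if "x \<in> \<Gamma>" "T0 \<le> t" for x t using w2[of x t t] that by simp
    show "w (x, t) - M * (t' - t) \<le> w (x, t')" if xt: "x \<in> \<Gamma>" "T0 \<le> t" "t \<le> t'" for x t t'
    proof -
      obtain r where "r \<in> {T0..t}" "w (x, t) = v (x, r) - M * (t - r)" using w1[OF xt(1,2)] by blast
      then show ?thesis using w2[of x r t'] xt by (simp add: algebra_simps)
    qed
  qed
qed


section \<open>The Perron function\<close>

definition candidates :: "('a \<Rightarrow> real) \<Rightarrow> ('a \<times> real \<Rightarrow> real) set" where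
  "candidates g = {v. subsol v \<and> (\<forall>x\<in>\<Gamma>. v (x, T0) \<le> g x)}"

text \<open>Outside \<open>\<Gamma> \<times> [T\<^sub>0, \<infinity>)\<close> the candidates are unbounded and the supremum is a junk value.\<close>

definition perron :: "('a \<Rightarrow> real) \<Rightarrow> 'a \<times> real \<Rightarrow> real" where
  "perron g z = (SUP v\<in>candidates g. v z)"

lemma approximate_datum:
  assumes "continuous_on \<Gamma> g" "e > 0"
  obtains G M where "M > 0" "speed_bound G M" "\<And>x. x \<in> \<Gamma> \<Longrightarrow> \<bar>g x - G x\<bar> \<le> e"
proof -
  obtain G where G: "real_polynomial_function G" "\<And>x. x \<in> \<Gamma> \<Longrightarrow> \<bar>g x - G x\<bar> < e"
    using Stone_Weierstrass_real_polynomial_function[OF compact_network assms] by blast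
  obtain M where "M > 0" "speed_bound G M" using speed_bound_exists[OF G(1)] .
  with G(2) show ?thesis using that less_imp_le by metis
qed

lemma candidates_nonempty:
  assumes "continuous_on \<Gamma> g"
  shows "candidates g \<noteq> {}"
proof -
  obtain G M where G: "speed_bound G M" "\<And>x. x \<in> \<Gamma> \<Longrightarrow> \<bar>g x - G x\<bar> \<le> 1"
    using approximate_datum[OF assms zero_less_one] by metis
  have "G x - 1 \<le> g x" if "x \<in> \<Gamma>" for x using G(2)[OF that] by linarith
  then have "(\<lambda>z. (\<lambda>(x, t). G x - M * (t - T0)) z - 1) \<in> candidates g"
    using subsol_minus_const[OF barrier_subsol[OF G(1)], of 1] by (simp add: candidates_def)
  then show ?thesis by blast
qed

lemma candidates_bdd_above:
  assumes "continuous_on \<Gamma> g" "z \<in> \<Gamma> \<times> {T0..}"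
  shows "bdd_above ((\<lambda>v. v z) ` candidates g)"
proof -
  obtain G M where G: "speed_bound G M" "\<And>x. x \<in> \<Gamma> \<Longrightarrow> \<bar>g x - G x\<bar> \<le> 1"
    using approximate_datum[OF assms(1) zero_less_one] by metis
  have "v z \<le> G (fst z) + M * (snd z - T0) + 1" if "v \<in> candidates g" for v
  proof -
    have v: "subsol v" "\<And>x. x \<in> \<Gamma> \<Longrightarrow> v (x, T0) \<le> g x" using that by (auto simp: candidates_def)
    have "v (x, T0) - 1 \<le> G x" if "x \<in> \<Gamma>" for x using v(2)[OF that] G(2)[OF that] by linarith
    from comparison[OF subsol_minus_const[OF v(1)] this G(1), of "fst z" "snd z"]
    show ?thesis using assms(2) by auto
  qed
  then show ?thesis by (intro bdd_aboveI2)
qed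

lemma perron_upper:
  "continuous_on \<Gamma> g \<Longrightarrow> v \<in> candidates g \<Longrightarrow> z \<in> \<Gamma> \<times> {T0..} \<Longrightarrow> v z \<le> perron g z"
  unfolding perron_def by (intro cSUP_upper candidates_bdd_above)

lemma perron_least:
  "continuous_on \<Gamma> g \<Longrightarrow> (\<And>v. v \<in> candidates g \<Longrightarrow> v z \<le> b) \<Longrightarrow> perron g z \<le> b"
  unfolding perron_def by (intro cSUP_least candidates_nonempty)

lemma perron_approx:
  assumes "continuous_on \<Gamma> g" "e > 0"
  shows "\<exists>v\<in>candidates g. perron g z - e < v z"
proof (rule ccontr)
  assume "\<not> ?thesis"
  then have "perron g z \<le> perron g z - e" using assms(1) by (intro perron_least) force+
  with \<open>e > 0\<close> show False by simp
qed

text \<open>The equation involves only derivatives of the unknown, so lowering a candidate for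
  \<open>g\<close> by \<open>e\<close> gives a candidate for \<open>h\<close>.\<close>

lemma perron_mono_diff:
  assumes "continuous_on \<Gamma> g" "continuous_on \<Gamma> h" "\<And>x. x \<in> \<Gamma> \<Longrightarrow> g x \<le> h x + e" "z \<in> \<Gamma> \<times> {T0..}"
  shows "perron g z \<le> perron h z + e"
proof (rule perron_least[OF assms(1)])
  fix v assume v: "v \<in> candidates g"
  have "v (x, T0) - e \<le> h x" if "x \<in> \<Gamma>" for x
    using v assms(3)[OF that] that by (force simp: candidates_def)
  then have "(\<lambda>z. v z - e) \<in> candidates h"
    using v subsol_minus_const by (auto simp: candidates_def)
  from perron_upper[OF assms(2) this assms(4)] show "v z \<le> perron h z + e" by simp
qed

lemma perron_nonexpansive:
  assumes "continuous_on \<Gamma> g" "continuous_on \<Gamma> h" "\<And>x. x \<in> \<Gamma> \<Longrightarrow> \<bar>g x - h x\<bar> \<le> e" "z \<in> \<Gamma> \<times> {T0..}"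
  shows "\<bar>perron g z - perron h z\<bar> \<le> e"
proof -
  have "g x \<le> h x + e" "h x \<le> g x + e" if "x \<in> \<Gamma>" for x using assms(3)[OF that] by linarith+
  then have "perron g z \<le> perron h z + e" "perron h z \<le> perron g z + e"
    using assms by (auto intro!: perron_mono_diff)
  then show ?thesis by linarith
qed

section \<open>Regularity of the Perron function for data with a speed bound\<close>

context
  fixes G M assumes G: "speed_bound G M"
begin

lemma speed_bound_continuous: "continuous_on \<Gamma> G"
  using G by (simp add: speed_bound_def)

text \<open>Such enlarged candidates suffice for the supremum. Taking the maximum with the lower
  barrier first provides what \<open>running_supremum\<close> requires: the exact initial value
  \<open>G\<close> and the bound from below.\<close>

lemma regular_candidate:
  assumes "v \<in> candidates G"
  shows "\<exists>w\<in>candidates G. (\<forall>x\<in>\<Gamma>. \<forall>t\<ge>T0. v (x, t) \<le> w (x, t)) \<and>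
    (\<forall>x\<in>\<Gamma>. \<forall>t\<ge>T0. \<forall>t'\<ge>t. w (x, t) - M * (t' - t) \<le> w (x, t'))"
proof -
  define v' where "v' = (\<lambda>z. max (v z) ((\<lambda>(x, t). G x - M * (t - T0)) z))"
  have v: "subsol v" "\<And>x. x \<in> \<Gamma> \<Longrightarrow> v (x, T0) \<le> G x" using assms by (auto simp: candidates_def)
  obtain w where w: "subsol w" "\<And>x. x \<in> \<Gamma> \<Longrightarrow> w (x, T0) = G x"
    "\<And>x t. x \<in> \<Gamma> \<Longrightarrow> T0 \<le> t \<Longrightarrow> v' (x, t) \<le> w (x, t)"
    "\<And>x t t'. x \<in> \<Gamma> \<Longrightarrow> T0 \<le> t \<Longrightarrow> t \<le> t' \<Longrightarrow> w (x, t) - M * (t' - t) \<le> w (x, t')"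
  proof (rule running_supremum[OF _ G, of v'])
    show "subsol v'" unfolding v'_def by (intro subsol_max v barrier_subsol G)
  qed (use v(2) in \<open>auto simp: v'_def max_def\<close>)
  have "v (x, t) \<le> w (x, t)" if "x \<in> \<Gamma>" "T0 \<le> t" for x t
    using w(3)[OF that] by (simp add: v'_def)
  with w show ?thesis by (intro bexI[of _ w]) (auto simp: candidates_def)
qed

lemma perron_time_lower:
  assumes "x \<in> \<Gamma>" "T0 \<le> t" "t \<le> t'"
  shows "perron G (x, t) \<le> perron G (x, t') + M * (t' - t)"
proof (rule perron_least[OF speed_bound_continuous])
  fix v assume "v \<in> candidates G"
  then obtain w where w: "w \<in> candidates G" "v (x, t) \<le> w (x, t)" "w (x, t) - M * (t' - t) \<le> w (x, t')"
    using regular_candidate[of v] assms by blast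
  with perron_upper[OF speed_bound_continuous w(1), of "(x, t')"] assms
  show "v (x, t) \<le> perron G (x, t') + M * (t' - t)" by auto
qed

text \<open>A candidate observed only from time \<open>T0 + (t' - t)\<close> on and lowered by
  \<open>M * (t' - t)\<close> is again a candidate, since comparison bounds how far it has risen
  above \<open>G\<close> by then.\<close>

lemma perron_time_upper:
  assumes "x \<in> \<Gamma>" "T0 \<le> t" "t \<le> t'"
  shows "perron G (x, t') \<le> perron G (x, t) + M * (t' - t)"
proof (rule perron_least[OF speed_bound_continuous])
  fix v assume "v \<in> candidates G"
  then have v: "subsol v" "\<And>x. x \<in> \<Gamma> \<Longrightarrow> v (x, T0) \<le> G x" by (auto simp: candidates_def)
  have "v (y, T0 + (t' - t)) - M * (t' - t) \<le> G y" if "y \<in> \<Gamma>" for y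
    using comparison[OF v G that, of "T0 + (t' - t)"] assms by simp
  then have "(\<lambda>(x, \<tau>). v (x, \<tau> + (t' - t)) - M * (t' - t)) \<in> candidates G"
    using subsol_shift[OF v(1), of "t' - t"] assms by (simp add: candidates_def)
  from perron_upper[OF speed_bound_continuous this, of "(x, t)"] assms
  show "v (x, t') \<le> perron G (x, t) + M * (t' - t)" by simp
qed

text \<open>The constant \<open>R\<close> comes from coercivity at level \<open>M + 1\<close> and is
  the same for all candidates, so the bound passes to the supremum.\<close>

lemma perron_space: "\<exists>R>0. \<forall>\<gamma>\<in>E. \<forall>s\<in>{0..1}. \<forall>s'\<in>{0..1}. \<forall>t\<ge>T0.
    \<bar>perron G (\<gamma> s, t) - perron G (\<gamma> s', t)\<bar> \<le> R * \<bar>s - s'\<bar>"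
proof -
  obtain R where R: "R > 0" "\<And>\<gamma> s p. \<gamma> \<in> E \<Longrightarrow> s \<in> {0..1} \<Longrightarrow> \<bar>p\<bar> \<ge> R \<Longrightarrow> H \<gamma> s p \<ge> M + 1"
    using H_coercive_uniform[of "M + 1"] by blast
  have one: "perron G (\<gamma> s, t) \<le> perron G (\<gamma> s', t) + R * \<bar>s - s'\<bar>"
    if \<gamma>: "\<gamma> \<in> E" "s \<in> {0..1}" "s' \<in> {0..1}" "T0 \<le> t" for \<gamma> s s' t
  proof (rule perron_least[OF speed_bound_continuous])
    fix v assume "v \<in> candidates G"
    then obtain w where w: "w \<in> candidates G" "\<And>x t. x \<in> \<Gamma> \<Longrightarrow> T0 \<le> t \<Longrightarrow> v (x, t) \<le> w (x, t)"
      "\<And>x t t'. x \<in> \<Gamma> \<Longrightarrow> T0 \<le> t \<Longrightarrow> t \<le> t' \<Longrightarrow> w (x, t) - M * (t' - t) \<le> w (x, t')"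
      using regular_candidate[of v] by blast
    have "subsol w" using w(1) by (simp add: candidates_def)
    then have "\<bar>w (\<gamma> s, t) - w (\<gamma> s', t)\<bar> \<le> R * \<bar>s - s'\<bar>"
      by (rule spatial_lipschitz[where M = M]) (use w(3) R \<gamma> in auto)
    moreover have "v (\<gamma> s, t) \<le> w (\<gamma> s, t)" using w(2) arc_point_in \<gamma> by blast
    moreover have "w (\<gamma> s', t) \<le> perron G (\<gamma> s', t)"
      using perron_upper[OF speed_bound_continuous w(1), of "(\<gamma> s', t)"] arc_point_in[OF \<gamma>(1,3)] \<gamma>(4) by auto
    ultimately show "v (\<gamma> s, t) \<le> perron G (\<gamma> s', t) + R * \<bar>s - s'\<bar>" by linarith
  qed
  have "\<bar>perron G (\<gamma> s, t) - perron G (\<gamma> s', t)\<bar> \<le> R * \<bar>s - s'\<bar>"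
    if "\<gamma> \<in> E" "s \<in> {0..1}" "s' \<in> {0..1}" "T0 \<le> t" for \<gamma> s s' t
    using one[of \<gamma> s s' t] one[of \<gamma> s' s t] that by (simp add: abs_le_iff abs_minus_commute)
  with R(1) show ?thesis by blast
qed

text \<open>The constant \<open>R\<close> refers to arc parameters, while points close in Euclidean
  distance may lie on different arcs. Hence only equicontinuity of the time slices is derived, and
  made uniform by compactness of \<open>\<Gamma>\<close>. Times range over an unbounded set and are
  handled by the Lipschitz bound with constant \<open>M\<close>.\<close>

lemma perron_uniformly_continuous_speed_bound:
  assumes Mpos: "M > 0"
  shows "uniformly_continuous_on (\<Gamma> \<times> {T0..}) (perron G)"
  unfolding uniformly_continuous_on_def
proof (intro allI impI)
  fix e :: real assume e: "e > 0"
  obtain R where R: "R > 0" "\<And>\<gamma> s s' t. \<gamma> \<in> E \<Longrightarrow> s \<in> {0..1} \<Longrightarrow> s' \<in> {0..1} \<Longrightarrow> T0 \<le> t \<Longrightarrow>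
      \<bar>perron G (\<gamma> s, t) - perron G (\<gamma> s', t)\<bar> \<le> R * \<bar>s - s'\<bar>"
    using perron_space by blast
  define \<F> where "\<F> = (\<lambda>t x. perron G (x, t)) ` {T0..}"
  have equi: "\<exists>\<delta>>0. \<forall>f\<in>\<F>. \<forall>x'\<in>\<Gamma>. dist x' x < \<delta> \<longrightarrow> dist (f x') (f x) < \<epsilon>"
    if "x \<in> \<Gamma>" "\<epsilon> > 0" for x and \<epsilon> :: real
  proof -
    have "\<exists>\<rho>>0. \<forall>y\<in>\<Gamma>. dist y x < \<rho> \<longrightarrow> (\<forall>f\<in>\<F>. dist (f y) (f x) < \<epsilon>)"
    proof (rule near_point)
      fix \<gamma> s0 assume \<gamma>: "\<gamma> \<in> E" "s0 \<in> {0..1}" "\<gamma> s0 = x"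
      have "dist (f (\<gamma> s)) (f x) < \<epsilon>" if s: "s \<in> {0..1}" "\<bar>s - s0\<bar> < \<epsilon> / R" and f: "f \<in> \<F>" for s f
      proof -
        obtain t where t: "T0 \<le> t" "f = (\<lambda>x. perron G (x, t))" using f unfolding \<F>_def by auto
        have "\<bar>f (\<gamma> s) - f (\<gamma> s0)\<bar> \<le> R * \<bar>s - s0\<bar>" unfolding t(2) by (rule R(2)) (use \<gamma> s t in auto)
        also have "\<dots> < \<epsilon>" using s(2) R(1) by (simp add: field_simps)
        finally show ?thesis using \<gamma>(3) by (simp add: dist_real_def)
      qed
      then show "\<exists>r>0. \<forall>s\<in>{0..1}. \<bar>s - s0\<bar> < r \<longrightarrow> (\<forall>f\<in>\<F>. dist (f (\<gamma> s)) (f x) < \<epsilon>)"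
        using R(1) \<open>\<epsilon> > 0\<close> by (intro exI[of _ "\<epsilon> / R"]) auto
    qed
    then show ?thesis by blast
  qed
  obtain \<delta> where \<delta>: "\<delta> > 0"
    "\<And>f x x'. f \<in> \<F> \<Longrightarrow> x \<in> \<Gamma> \<Longrightarrow> x' \<in> \<Gamma> \<Longrightarrow> dist x' x < \<delta> \<Longrightarrow> dist (f x') (f x) < e / 2"
    using compact_uniformly_equicontinuous[OF compact_network equi, of "e / 2"] e half_gt_zero by metis
  have time: "\<bar>perron G (x, t') - perron G (x, t)\<bar> \<le> M * \<bar>t' - t\<bar>" if "x \<in> \<Gamma>" "T0 \<le> t" "T0 \<le> t'" for x t t'
    using perron_time_lower[of x t t'] perron_time_upper[of x t t']
      perron_time_lower[of x t' t] perron_time_upper[of x t' t] that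
    by (cases "t \<le> t'") (auto simp: abs_if)
  show "\<exists>d>0. \<forall>x\<in>\<Gamma> \<times> {T0..}. \<forall>x'\<in>\<Gamma> \<times> {T0..}. dist x' x < d \<longrightarrow> dist (perron G x') (perron G x) < e"
  proof (intro exI[of _ "min \<delta> (e / (2 * M))"] conjI ballI impI)
    show "0 < min \<delta> (e / (2 * M))" using \<delta> e Mpos by simp
    fix z z' assume z: "z \<in> \<Gamma> \<times> {T0..}" "z' \<in> \<Gamma> \<times> {T0..}" "dist z' z < min \<delta> (e / (2 * M))"
    obtain x t x' t' where zz: "z = (x, t)" "z' = (x', t')" by (cases z, cases z')
    have "dist x' x < \<delta>" "dist t' t < e / (2 * M)"
      using z(3) dist_fst_le[of z' z] dist_snd_le[of z' z] unfolding zz by auto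
    then have "dist (perron G (x', t')) (perron G (x, t')) < e / 2" "M * \<bar>t' - t\<bar> < e / 2"
      using \<delta>(2)[of "\<lambda>x. perron G (x, t')" x x'] z(1,2) Mpos
      by (auto simp: zz \<F>_def dist_real_def field_simps)
    moreover have "\<bar>perron G (x, t') - perron G (x, t)\<bar> \<le> M * \<bar>t' - t\<bar>"
      using z(1,2) by (intro time) (auto simp: zz)
    ultimately show "dist (perron G z') (perron G z) < e" unfolding zz dist_real_def by linarith
  qed
qed

lemma perron_initial_speed_bound:
  assumes x: "x \<in> \<Gamma>"
  shows "perron G (x, T0) = G x"
proof (rule antisym)
  show "perron G (x, T0) \<le> G x"
    using x by (intro perron_least[OF speed_bound_continuous]) (auto simp: candidates_def)
  have "(\<lambda>(x, t). G x - M * (t - T0)) \<in> candidates G"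
    using barrier_subsol[OF G] by (simp add: candidates_def)
  from perron_upper[OF speed_bound_continuous this, of "(x, T0)"] x show "G x \<le> perron G (x, T0)" by simp
qed

end

section \<open>Arbitrary continuous data\<close>

lemma perron_uniformly_continuous:
  assumes g: "continuous_on \<Gamma> g"
  shows "uniformly_continuous_on (\<Gamma> \<times> {T0..}) (perron g)"
  unfolding uniformly_continuous_on_def
proof (intro allI impI)
  fix e :: real assume "e > 0"
  then have e: "e / 3 > 0" by simp
  obtain G M where G: "M > 0" "speed_bound G M" "\<And>x. x \<in> \<Gamma> \<Longrightarrow> \<bar>g x - G x\<bar> \<le> e / 3"
    using approximate_datum[OF g e] by metis
  obtain d where d: "d > 0" "\<And>z z'. z \<in> \<Gamma> \<times> {T0..} \<Longrightarrow> z' \<in> \<Gamma> \<times> {T0..} \<Longrightarrow> dist z' z < d \<Longrightarrow>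
      dist (perron G z') (perron G z) < e / 3"
    using perron_uniformly_continuous_speed_bound[OF G(2,1)] e unfolding uniformly_continuous_on_def by metis
  have near: "\<bar>perron g z - perron G z\<bar> \<le> e / 3" if "z \<in> \<Gamma> \<times> {T0..}" for z
    by (rule perron_nonexpansive[OF g speed_bound_continuous[OF G(2)] G(3) that])
  show "\<exists>d>0. \<forall>x\<in>\<Gamma> \<times> {T0..}. \<forall>x'\<in>\<Gamma> \<times> {T0..}. dist x' x < d \<longrightarrow> dist (perron g x') (perron g x) < e"
  proof (intro exI[of _ d] conjI ballI impI)
    fix z z' assume "z \<in> \<Gamma> \<times> {T0..}" "z' \<in> \<Gamma> \<times> {T0..}" "dist z' z < d"
    with d(2)[of z z'] near[of z] near[of z'] show "dist (perron g z') (perron g z) < e"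
      unfolding dist_real_def by linarith
  qed (rule d(1))
qed

lemma perron_initial:
  assumes g: "continuous_on \<Gamma> g" and x: "x \<in> \<Gamma>"
  shows "perron g (x, T0) = g x"
proof -
  have "\<bar>perron g (x, T0) - g x\<bar> \<le> e" if e: "e > 0" for e
  proof -
    obtain G M where G: "M > 0" "speed_bound G M" "\<And>x. x \<in> \<Gamma> \<Longrightarrow> \<bar>g x - G x\<bar> \<le> e / 2"
      using approximate_datum[OF g half_gt_zero[OF e]] by metis
    have "\<bar>perron g (x, T0) - perron G (x, T0)\<bar> \<le> e / 2"
      by (rule perron_nonexpansive[OF g speed_bound_continuous[OF G(2)] G(3)]) (use x in auto)
    then show ?thesis using perron_initial_speed_bound[OF G(2) x] G(3)[OF x] by linarith
  qed
  then have "\<bar>perron g (x, T0) - g x\<bar> \<le> 0" by (rule field_le_epsilon) simp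
  then show ?thesis by simp
qed

lemma perron_subsol:
  assumes g: "continuous_on \<Gamma> g"
  shows "subsol (perron g)"
  by (rule subsol_Sup[of "candidates g"])
    (use perron_upper[OF g] perron_approx[OF g]
      uniformly_continuous_imp_continuous[OF perron_uniformly_continuous[OF g]]
      in \<open>auto simp: candidates_def\<close>)

end


section \<open>Subdifferentials\<close>

text \<open>The first-order subjet of \<open>U\<close> at \<open>(s0, t0)\<close> relative to
  \<open>[0,1]\<close> in space, with \<open>a\<close> the slope in time and \<open>p\<close> in
  space. Recording slopes instead of test functions allows them to be exchanged on one arc and
  assembled over several arcs.\<close>

definition subdiff :: "(real \<times> real \<Rightarrow> real) \<Rightarrow> real \<Rightarrow> real \<Rightarrow> real \<Rightarrow> real \<Rightarrow> bool" where
  "subdiff U s0 t0 a p \<longleftrightarrow> (\<forall>\<epsilon>>0. \<exists>r>0. \<forall>s\<in>{0..1}. \<forall>t. \<bar>s - s0\<bar> < r \<and> \<bar>t - t0\<bar> < r \<longrightarrow>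
     U (s0, t0) + a * (t - t0) + p * (s - s0) - \<epsilon> * (\<bar>s - s0\<bar> + \<bar>t - t0\<bar>) \<le> U (s, t))"

lemma subdiffD:
  assumes "subdiff U s0 t0 a p" "\<epsilon> > 0"
  obtains r where "r > 0" "\<And>s t. s \<in> {0..1} \<Longrightarrow> \<bar>s - s0\<bar> < r \<Longrightarrow> \<bar>t - t0\<bar> < r \<Longrightarrow>
     U (s0, t0) + a * (t - t0) + p * (s - s0) - \<epsilon> * (\<bar>s - s0\<bar> + \<bar>t - t0\<bar>) \<le> U (s, t)"
  using assms unfolding subdiff_def by meson

lemma subdiff_reversepath:
  assumes "subdiff (along u \<gamma>) s0 t0 a p"
  shows "subdiff (along u (reversepath \<gamma>)) (1 - s0) t0 a (- p)"
  unfolding subdiff_def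
proof (intro allI impI)
  fix \<epsilon> :: real assume "\<epsilon> > 0"
  then obtain r where r: "r > 0" "\<And>s t. s \<in> {0..1} \<Longrightarrow> \<bar>s - s0\<bar> < r \<Longrightarrow> \<bar>t - t0\<bar> < r \<Longrightarrow>
     along u \<gamma> (s0, t0) + a * (t - t0) + p * (s - s0) - \<epsilon> * (\<bar>s - s0\<bar> + \<bar>t - t0\<bar>) \<le> along u \<gamma> (s, t)"
    using subdiffD[OF assms] by metis
  show "\<exists>r>0. \<forall>s\<in>{0..1}. \<forall>t. \<bar>s - (1 - s0)\<bar> < r \<and> \<bar>t - t0\<bar> < r \<longrightarrow>
     along u (reversepath \<gamma>) (1 - s0, t0) + a * (t - t0) + - p * (s - (1 - s0))
      - \<epsilon> * (\<bar>s - (1 - s0)\<bar> + \<bar>t - t0\<bar>) \<le> along u (reversepath \<gamma>) (s, t)"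
  proof (intro exI conjI ballI allI impI, rule r(1))
    fix s t assume s: "s \<in> {0..1}" "\<bar>s - (1 - s0)\<bar> < r \<and> \<bar>t - t0\<bar> < r"
    have eq: "(1 - s) - s0 = - (s - (1 - s0))" by simp
    have "\<bar>(1 - s) - s0\<bar> = \<bar>s - (1 - s0)\<bar>" unfolding eq by (rule abs_minus_cancel)
    then have "along u \<gamma> (s0, t0) + a * (t - t0) + p * ((1 - s) - s0)
        - \<epsilon> * (\<bar>(1 - s) - s0\<bar> + \<bar>t - t0\<bar>) \<le> along u \<gamma> (1 - s, t)"
      using s by (intro r(2)) auto
    moreover have "along u (reversepath \<gamma>) (1 - s0, t0) = along u \<gamma> (s0, t0)"
      "along u (reversepath \<gamma>) (s, t) = along u \<gamma> (1 - s, t)"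
      by (simp_all add: along_def reversepath_def)
    ultimately show "along u (reversepath \<gamma>) (1 - s0, t0) + a * (t - t0) + - p * (s - (1 - s0))
      - \<epsilon> * (\<bar>s - (1 - s0)\<bar> + \<bar>t - t0\<bar>) \<le> along u (reversepath \<gamma>) (s, t)"
      unfolding eq abs_minus_cancel mult_minus_right mult_minus_left by simp
  qed
qed

text \<open>The error term is the differentiability remainder of \<open>\<phi>\<close>. As
  \<open>T\<close> is a neighbourhood of \<open>t0\<close>, the constraint in time
  disappears.\<close>

lemma subtangent_imp_subdiff:
  assumes sub: "subtangent_on ({0..1} \<times> T) w \<phi> (s0, t0)" and T: "\<forall>\<^sub>F t in nhds t0. t \<in> T"
  shows "subdiff w s0 t0 (deriv_t \<phi> s0 t0) (deriv_s \<phi> s0 t0)"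
  unfolding subdiff_def
proof (intro allI impI)
  fix \<epsilon> :: real assume \<epsilon>: "\<epsilon> > 0"
  let ?a = "deriv_t \<phi> s0 t0" and ?p = "deriv_s \<phi> s0 t0"
  have C1: "C1_near \<phi> (s0, t0)"
    and ev: "\<forall>\<^sub>F y in nhds (s0, t0). y \<in> {0..1} \<times> T \<longrightarrow> w (s0, t0) - \<phi> (s0, t0) \<le> w y - \<phi> y"
    using sub unfolding subtangent_on_def by auto
  obtain d where d: "d > 0" "\<And>y. norm (y - (s0, t0)) < d \<Longrightarrow>
      norm (\<phi> y - \<phi> (s0, t0) - (?p * fst (y - (s0, t0)) + ?a * snd (y - (s0, t0)))) \<le> \<epsilon> * norm (y - (s0, t0))"
    using \<epsilon> C1_near_has_derivative[OF C1] unfolding has_derivative_at_alt by blast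
  obtain e where e: "e > 0" "\<And>\<sigma> \<tau>. \<bar>\<sigma> - s0\<bar> < e \<Longrightarrow> \<bar>\<tau> - t0\<bar> < e \<Longrightarrow>
      (\<sigma>, \<tau>) \<in> {0..1} \<times> T \<longrightarrow> w (s0, t0) - \<phi> (s0, t0) \<le> w (\<sigma>, \<tau>) - \<phi> (\<sigma>, \<tau>)"
    using eventually_nhds_boxE[OF ev] by metis
  obtain e' where e': "e' > 0" "\<And>\<tau>. \<bar>\<tau> - t0\<bar> < e' \<Longrightarrow> \<tau> \<in> T"
    using T unfolding eventually_nhds_metric by (auto simp: dist_real_def)
  define r where "r = Min {d / 2, e, e'}"
  have r: "r > 0" "r \<le> d / 2" "r \<le> e" "r \<le> e'" unfolding r_def using d e e' by auto
  show "\<exists>r>0. \<forall>s\<in>{0..1}. \<forall>t. \<bar>s - s0\<bar> < r \<and> \<bar>t - t0\<bar> < r \<longrightarrow>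
     w (s0, t0) + ?a * (t - t0) + ?p * (s - s0) - \<epsilon> * (\<bar>s - s0\<bar> + \<bar>t - t0\<bar>) \<le> w (s, t)"
  proof (intro exI conjI ballI allI impI, rule r(1))
    fix s t assume s: "s \<in> {0..1}" "\<bar>s - s0\<bar> < r \<and> \<bar>t - t0\<bar> < r"
    have n: "norm ((s, t) - (s0, t0)) \<le> \<bar>s - s0\<bar> + \<bar>t - t0\<bar>"
      using real_sqrt_sum_squares_triangle_ineq[of "s - s0" 0 0 "t - t0"] by (simp add: norm_Pair)
    then have "norm (\<phi> (s, t) - \<phi> (s0, t0) - (?p * (s - s0) + ?a * (t - t0))) \<le> \<epsilon> * norm ((s, t) - (s0, t0))"
      using d(2)[of "(s, t)"] s(2) r by simp
    also have "\<dots> \<le> \<epsilon> * (\<bar>s - s0\<bar> + \<bar>t - t0\<bar>)" using n \<epsilon> by (intro mult_left_mono) auto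
    finally have "\<bar>\<phi> (s, t) - \<phi> (s0, t0) - (?p * (s - s0) + ?a * (t - t0))\<bar> \<le> \<epsilon> * (\<bar>s - s0\<bar> + \<bar>t - t0\<bar>)"
      by simp
    moreover have "w (s0, t0) - \<phi> (s0, t0) \<le> w (s, t) - \<phi> (s, t)"
      using e(2)[of s t] e'(2)[of t] s r by auto
    ultimately show "w (s0, t0) + ?a * (t - t0) + ?p * (s - s0) - \<epsilon> * (\<bar>s - s0\<bar> + \<bar>t - t0\<bar>) \<le> w (s, t)"
      by linarith
  qed
qed

lemma subtangent_imp_lower_slope:
  fixes w :: "real \<Rightarrow> real"
  assumes sub: "subtangent w \<phi> t0" and \<epsilon>: "\<epsilon> > 0"
  shows "\<exists>r>0. \<forall>t. \<bar>t - t0\<bar> < r \<longrightarrow> w t0 + deriv \<phi> t0 * (t - t0) - \<epsilon> * \<bar>t - t0\<bar> \<le> w t"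
proof -
  have C1: "C1_near \<phi> t0" and ev: "\<forall>\<^sub>F y in nhds t0. w t0 - \<phi> t0 \<le> w y - \<phi> y"
    using sub unfolding subtangent_on_def by auto
  have "(\<phi> has_derivative (*) (deriv \<phi> t0)) (at t0)"
    using C1_near_imp_has_real_derivative[OF C1] by (metis has_field_derivative_def)
  then obtain d where d: "d > 0" "\<And>y. norm (y - t0) < d \<Longrightarrow>
      norm (\<phi> y - \<phi> t0 - deriv \<phi> t0 * (y - t0)) \<le> \<epsilon> * norm (y - t0)"
    using \<epsilon> unfolding has_derivative_at_alt by blast
  obtain e where e: "e > 0" "\<And>\<tau>. \<bar>\<tau> - t0\<bar> < e \<Longrightarrow> w t0 - \<phi> t0 \<le> w \<tau> - \<phi> \<tau>"
    using ev unfolding eventually_nhds_metric by (auto simp: dist_real_def)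
  have "w t0 + deriv \<phi> t0 * (t - t0) - \<epsilon> * \<bar>t - t0\<bar> \<le> w t" if "\<bar>t - t0\<bar> < min d e" for t
    using d(2)[of t] e(2)[of t] that unfolding real_norm_def by (simp add: abs_le_iff)
  then show ?thesis using d(1) e(1) by (intro exI[of _ "min d e"]) auto
qed

text \<open>
  Since \<open>a < b\<close>, only times \<open>t\<^sub>1 < t\<^sub>0\<close> matter. If the inequality for \<open>(a, \<pi>)\<close> fails at \<open>(s\<^sub>1, t\<^sub>1)\<close>, compare
  \<open>U\<close> with the affine function of slopes \<open>(b2, \<pi>)\<close> through the violated value, with \<open>b2\<close> slightly larger
  than \<open>b\<close>. The larger time slope makes it lie below \<open>U\<close> at earlier times, the known
  subdifferential \<open>(b, q)\<close> with \<open>q < \<pi>\<close> does so away from the endpoint, and the trace bound does so at the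
  endpoint for times until shortly after \<open>t\<^sub>1\<close>. Later times are penalized, which does not affect
  the sign of \<open>b2 + h s \<pi>\<close>. So \<open>U\<close> minus the test function attains a minimum in the interior,
  which contradicts the supersolution property.
\<close>

lemma subdiff_slope_transfer:
  fixes U :: "real \<times> real \<Rightarrow> real" and h :: "real \<Rightarrow> real \<Rightarrow> real"
  assumes ch: "continuous_on ({0..1} \<times> UNIV) (\<lambda>(s, p). h s p)"
    and cU: "continuous_on ({0..1} \<times> {T0..}) U" and t0: "T0 < t0"
    and super: "\<And>s t \<phi>. 0 < s \<Longrightarrow> s < 1 \<Longrightarrow> T0 < t \<Longrightarrow> subtangent U \<phi> (s, t) \<Longrightarrow>
      0 \<le> deriv_t \<phi> s t + h s (deriv_s \<phi> s t)"
    and trace: "\<And>\<epsilon>. \<epsilon> > 0 \<Longrightarrow> \<exists>r>0. \<forall>t. \<bar>t - t0\<bar> < r \<longrightarrow> U (1, t0) + a * (t - t0) - \<epsilon> * \<bar>t - t0\<bar> \<le> U (1, t)"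
    and sd: "subdiff U 1 t0 b q" and neg: "b + h 1 q < 0" and ab: "a < b"
  shows "\<exists>\<pi>. subdiff U 1 t0 a \<pi> \<and> a + h 1 \<pi> < 0"
proof -
  define m where "m = - (b + h 1 q)"
  have m: "m > 0" using neg by (simp add: m_def)
  obtain d where d: "d > 0" "\<And>y. y \<in> {0..1} \<times> UNIV \<Longrightarrow> dist y (1, q) < d \<Longrightarrow>
      dist (case y of (s, p) \<Rightarrow> h s p) (h 1 q) < m / 2"
    using ch[unfolded continuous_on_iff, rule_format, of "(1, q)" "m / 2"] m by auto
  \<comment> \<open>Of the increase \<open>2 * k\<close> over \<open>q\<close>, one \<open>k\<close>
    absorbs the error in the subdifferential and the other leaves the margin
    \<open>k * (1 - s)\<close> away from the endpoint. The choices \<open>d / 4\<close> and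
    \<open>m / 4\<close> keep \<open>(s, \<pi>)\<close> within \<open>d\<close> of
    \<open>(1, q)\<close> and \<open>b2 + h s \<pi>\<close> negative.\<close>
  define k where "k = d / 4"
  define \<pi> where "\<pi> = q + 2 * k"
  define b2 where "b2 = b + m / 4"
  have k: "k > 0" using d(1) by (simp add: k_def)
  have b2: "b < b2" using m by (simp add: b2_def)
  have hneg: "b2 + h s \<pi> < 0" if "s \<in> {0..1}" "1 - s \<le> k" for s
  proof -
    have "dist (s, \<pi>) (1, q) \<le> \<bar>s - 1\<bar> + \<bar>\<pi> - q\<bar>"
      using real_sqrt_sum_squares_triangle_ineq[of "s - 1" 0 0 "\<pi> - q"]
      by (simp add: dist_Pair_Pair dist_real_def)
    also have "\<dots> < d" using that d(1) unfolding \<pi>_def k_def by auto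
    finally have "dist (h s \<pi>) (h 1 q) < m / 2" using d(2)[of "(s, \<pi>)"] that(1) by auto
    then have "\<bar>h s \<pi> - h 1 q\<bar> < m / 2" by (simp add: dist_real_def)
    moreover have "b + h 1 q = - m" by (simp add: m_def)
    ultimately show ?thesis unfolding b2_def using m by linarith
  qed
  define u0 where "u0 = U (1, t0)"
  have "subdiff U 1 t0 a \<pi>" unfolding subdiff_def
  proof (intro allI impI)
    fix \<epsilon> :: real assume \<epsilon>: "\<epsilon> > 0"
    \<comment> \<open>This prepares the chain \<open>a1 < a2 < b < b1 < b2\<close>. Here
      \<open>a1\<close> is the slope of the trace bound including its error, \<open>a2\<close> the
      slope of the bound to be proved, \<open>b1\<close> the known slope including its error, and
      \<open>b2\<close> that of the test function. The gaps decide the signs on the sides of the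
      box.\<close>
    define \<epsilon>1 where "\<epsilon>1 = min \<epsilon> ((b - a) / 2)"
    have \<epsilon>1: "\<epsilon>1 > 0" "\<epsilon>1 \<le> \<epsilon>" "a + \<epsilon>1 < b" unfolding \<epsilon>1_def using \<epsilon> ab by (auto simp: min_def field_simps)
    define a2 where "a2 = a + \<epsilon>1"
    define a1 where "a1 = a + \<epsilon>1 / 2"
    define l where "l = Min {\<epsilon>, k, m / 8}"
    have l: "l > 0" "l \<le> \<epsilon>" "l \<le> k" "l \<le> m / 8" unfolding l_def using \<epsilon> k m by auto
    define b1 where "b1 = b + l"
    have order: "a1 < a2" "a2 < b" "b < b1" "b1 < b2"
      unfolding a1_def a2_def b1_def b2_def using \<epsilon>1 l m by auto
    obtain rs where rs: "rs > 0" "\<And>s t. s \<in> {0..1} \<Longrightarrow> \<bar>s - 1\<bar> < rs \<Longrightarrow> \<bar>t - t0\<bar> < rs \<Longrightarrow>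
        u0 + b * (t - t0) + q * (s - 1) - l * (\<bar>s - 1\<bar> + \<bar>t - t0\<bar>) \<le> U (s, t)"
      using subdiffD[OF sd l(1)] unfolding u0_def by metis
    obtain rt where rt: "rt > 0" "\<And>t. \<bar>t - t0\<bar> < rt \<Longrightarrow> u0 + a * (t - t0) - \<epsilon>1 / 2 * \<bar>t - t0\<bar> \<le> U (1, t)"
      using trace[of "\<epsilon>1 / 2"] \<epsilon>1(1) unfolding u0_def by auto
    define \<rho> where "\<rho> = Min {k, rs / 2, rt / 2, 1 / 2, (t0 - T0) / 2}"
    have "\<rho> > 0" unfolding \<rho>_def using k rs rt t0 by simp
    moreover have "\<rho> \<le> k" "\<rho> \<le> rs / 2" "\<rho> \<le> rt / 2" "\<rho> \<le> 1 / 2" "\<rho> \<le> (t0 - T0) / 2"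
      unfolding \<rho>_def by (rule Min_le; simp)+
    ultimately have \<rho>: "\<rho> > 0" "\<rho> \<le> k" "\<rho> < rs" "\<rho> < rt" "\<rho> < 1" "\<rho> < t0 - T0"
      using rs(1) rt(1) t0 by auto
    have low: "u0 - b1 * (t0 - t) + (\<pi> - k) * (s - 1) \<le> U (s, t)"
      if "1 - \<rho> \<le> s" "s \<le> 1" "t0 - \<rho> \<le> t" "t \<le> t0" for s t
    proof -
      have "u0 + b * (t - t0) + q * (s - 1) - l * (\<bar>s - 1\<bar> + \<bar>t - t0\<bar>) \<le> U (s, t)"
        using that \<rho> by (intro rs(2)) auto
      moreover have "\<bar>s - 1\<bar> = 1 - s" "\<bar>t - t0\<bar> = t0 - t" using that by auto
      moreover have "l * (1 - s) \<le> k * (1 - s)" using l that by (intro mult_right_mono) auto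
      ultimately show ?thesis unfolding b1_def \<pi>_def by (simp add: algebra_simps)
    qed
    have lowt: "u0 - a1 * (t0 - t) \<le> U (1, t)" if "t0 - \<rho> \<le> t" "t \<le> t0" for t
    proof -
      have "u0 + a * (t - t0) - \<epsilon>1 / 2 * \<bar>t - t0\<bar> \<le> U (1, t)" using that \<rho> by (intro rt(2)) auto
      moreover have "\<bar>t - t0\<bar> = t0 - t" using that by auto
      ultimately show ?thesis unfolding a1_def by (simp add: algebra_simps)
    qed
    \<comment> \<open>The second entry will give \<open>\<tau>3 < \<rho>\<close>, so that the box
      fits, and the third \<open>(b2 - a2) * \<tau>1 < k * \<rho>\<close>, which settles the side
      \<open>s = 1 - \<rho>\<close>.\<close>
    define r where "r = Min {\<rho>, \<rho> * (b2 - b1) / (b2 - a2), k * \<rho> / (b2 - a2)}"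
    have r: "r > 0" "r \<le> \<rho>" "r \<le> \<rho> * (b2 - b1) / (b2 - a2)" "r \<le> k * \<rho> / (b2 - a2)"
      unfolding r_def using \<rho> k order by auto
    have main: "u0 - a2 * (t0 - t1) + \<pi> * (s1 - 1) \<le> U (s1, t1)"
      if s1: "s1 \<in> {0..1}" "1 - s1 < r" and t1: "t1 \<le> t0" "t0 - t1 < r" for s1 t1
    proof (rule ccontr)
      assume viol: "\<not> ?thesis"
      define \<tau>1 where "\<tau>1 = t0 - t1"
      have "\<tau>1 \<noteq> 0"
      proof
        assume "\<tau>1 = 0"
        then have "u0 + (\<pi> - k) * (s1 - 1) \<le> U (s1, t1)"
          using low[of s1 t1] s1 t1 r(2) \<rho> by (simp add: \<tau>1_def)
        moreover have "k * (s1 - 1) \<le> 0" using k s1 by (simp add: mult_nonneg_nonpos)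
        ultimately show False using viol \<open>\<tau>1 = 0\<close> by (simp add: \<tau>1_def algebra_simps)
      qed
      then have \<tau>1: "\<tau>1 > 0" "\<tau>1 < r" using t1 by (auto simp: \<tau>1_def)
      define W where "W = (\<lambda>(s, t). U (s, t) - (u0 - a2 * \<tau>1 + \<pi> * (s - 1) + b2 * (t - t1)))"
      have W1: "W (s1, t1) < 0" using viol by (simp add: W_def \<tau>1_def)
      have Wlow: "k * (1 - s) + (b2 - b1) * (t0 - t) - (b2 - a2) * \<tau>1 \<le> W (s, t)"
        if "1 - \<rho> \<le> s" "s \<le> 1" "t0 - \<rho> \<le> t" "t \<le> t0" for s t
        using low[OF that] unfolding W_def \<tau>1_def by (simp add: algebra_simps)
      have Wlowt: "(b2 - a1) * (t0 - t) - (b2 - a2) * \<tau>1 \<le> W (1, t)"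
        if "t0 - \<rho> \<le> t" "t \<le> t0" for t
        using lowt[OF that] unfolding W_def \<tau>1_def by (simp add: algebra_simps)
      \<comment> \<open>In terms of the time lag before \<open>t0\<close>, \<open>W\<close> is
        nonnegative from lag \<open>\<tau>3\<close> on, and on the side \<open>s = 1\<close> already
        from lag \<open>\<tau>2\<close> on. The order of the slopes yields
        \<open>\<tau>2 < \<tau>1 < \<tau>3\<close>, with \<open>\<tau>1\<close> the lag of the
        violation.\<close>
      define \<tau>3 where "\<tau>3 = \<tau>1 * (b2 - a2) / (b2 - b1)"
      have \<tau>3: "(b2 - b1) * \<tau>3 = (b2 - a2) * \<tau>1" unfolding \<tau>3_def using order by simp
      have lt_r: "\<tau>1 * (b2 - a2) < r * (b2 - a2)" using \<tau>1(2) order by simp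
      also have "\<dots> \<le> \<rho> * (b2 - b1)" using r(3) order by (simp add: pos_le_divide_eq)
      finally have "\<tau>1 * (b2 - a2) < \<rho> * (b2 - b1)" .
      then have "\<tau>3 < \<rho>" unfolding \<tau>3_def using order by (simp add: field_simps)
      have "\<tau>1 * (b2 - b1) < \<tau>1 * (b2 - a2)" using \<tau>1 order by simp
      then have "\<tau>1 < \<tau>3" unfolding \<tau>3_def using order by (simp add: field_simps)
      define \<tau>2 where "\<tau>2 = \<tau>1 * (b2 - a2) / (b2 - a1)"
      have \<tau>2: "(b2 - a1) * \<tau>2 = (b2 - a2) * \<tau>1" unfolding \<tau>2_def using order by simp
      have "\<tau>1 * (b2 - a2) < \<tau>1 * (b2 - a1)" using \<tau>1 order by simp
      then have "\<tau>2 < \<tau>1" unfolding \<tau>2_def using order by (simp add: field_simps)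
      have "0 < \<tau>2" unfolding \<tau>2_def using \<tau>1 order by simp
      have "r * (b2 - a2) \<le> k * \<rho>" using r(4) order by (simp add: pos_le_divide_eq)
      then have kr: "(b2 - a2) * \<tau>1 < k * \<rho>" using lt_r by (simp add: mult.commute)
      \<comment> \<open>Halfway between the lags \<open>\<tau>1\<close> and \<open>\<tau>2\<close>:
        later than the violation, yet early enough for the trace bound to control the side
        \<open>s = 1\<close> of the whole box.\<close>
      define tf where "tf = t0 - (\<tau>1 + \<tau>2) / 2"
      have tf: "t1 < tf" "tf < t0" "t0 - tf > \<tau>2"
        unfolding tf_def using \<open>\<tau>2 < \<tau>1\<close> \<open>0 < \<tau>2\<close> \<tau>1 by (auto simp: \<tau>1_def field_simps)
      define tL where "tL = t0 - \<tau>3"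
      have tL: "tL < t1" "t0 - \<rho> < tL" "T0 < tL"
        unfolding tL_def using \<open>\<tau>1 < \<tau>3\<close> \<open>\<tau>3 < \<rho>\<close> \<rho> by (auto simp: \<tau>1_def)
      define K where "K = {1 - \<rho>..1} \<times> {tL..tf}"
      have K: "compact K" "K \<subseteq> {0..1} \<times> {T0..}"
        unfolding K_def using \<rho> tL by (auto intro!: compact_Times)
      have zK: "(s1, t1) \<in> K" unfolding K_def using s1 r(2) tL tf by auto
      have cW: "continuous_on K W" unfolding W_def case_prod_unfold
        using continuous_on_subset[OF cU K(2)] by (auto intro!: continuous_intros)
      obtain B where B: "\<And>z. z \<in> K \<Longrightarrow> \<bar>W z\<bar> \<le> B"
        using compact_imp_bounded[OF compact_continuous_image[OF cW K(1)]] unfolding bounded_iff by auto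
      have Bnn: "B \<ge> 0" using B[OF zK] by linarith
      \<comment> \<open>At time \<open>tf\<close> the penalty exceeds the bound \<open>B\<close> of
        \<open>W\<close>, while it is absent at the violation; so the minimum is not attained at the
        final time.\<close>
      define C where "C = (B + 1) / (tf - t1)\<^sup>2"
      have C: "C \<ge> 0" "C * (tf - t1)\<^sup>2 = B + 1" unfolding C_def using Bnn tf by auto
      define F where "F = (\<lambda>z. W z + C * (max 0 (snd z - t1))\<^sup>2)"
      have "continuous_on K F" unfolding F_def by (intro continuous_intros cW)
      then obtain z where z: "z \<in> K" "\<And>y. y \<in> K \<Longrightarrow> F z \<le> F y"
        using continuous_attains_inf[OF K(1), of F] zK by blast
      obtain s2 t2 where z2: "z = (s2, t2)" by (cases z)
      have in2: "1 - \<rho> \<le> s2" "s2 \<le> 1" "tL \<le> t2" "t2 \<le> tf" using z(1) by (auto simp: z2 K_def)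
      have in2': "t0 - \<rho> \<le> t2" "t2 \<le> t0" using in2 tL tf by auto
      have Fneg: "F (s2, t2) < 0" using z(2)[OF zK] W1 by (simp add: F_def z2)
      have pen: "C * (max 0 (t2 - t1))\<^sup>2 \<ge> 0" using C(1) by simp
      have Wneg: "W (s2, t2) < 0" using Fneg pen by (simp add: F_def)
      have nn: "0 \<le> k * (1 - s2)" "0 \<le> (b2 - b1) * (t0 - t2)" using k in2 in2' order by auto
      have "s2 \<noteq> 1"
      proof
        assume "s2 = 1"
        then have "(b2 - a1) * (t0 - t2) - (b2 - a2) * \<tau>1 < 0" using Wlowt[OF in2'] Wneg by simp
        moreover have "(b2 - a1) * \<tau>2 \<le> (b2 - a1) * (t0 - t2)"
          using in2 tf order by (intro mult_left_mono) auto
        ultimately show False using \<tau>2 by simp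
      qed
      moreover have "s2 \<noteq> 1 - \<rho>"
      proof
        assume "s2 = 1 - \<rho>"
        then have "k * \<rho> + (b2 - b1) * (t0 - t2) - (b2 - a2) * \<tau>1 < 0"
          using Wlow[OF in2(1,2) in2'] Wneg by simp
        then show False using kr nn by linarith
      qed
      moreover have "t2 \<noteq> tL"
      proof
        assume "t2 = tL"
        then have "t0 - t2 = \<tau>3" by (simp add: tL_def)
        then have "k * (1 - s2) + (b2 - b1) * \<tau>3 - (b2 - a2) * \<tau>1 < 0"
          using Wlow[OF in2(1,2) in2'] Wneg by simp
        then show False using \<tau>3 nn by linarith
      qed
      moreover have "t2 \<noteq> tf"
      proof
        assume "t2 = tf"
        then have "C * (max 0 (t2 - t1))\<^sup>2 = B + 1" using C(2) tf by simp
        then show False using Fneg B[OF z(1)] by (auto simp: F_def z2)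
      qed
      ultimately have in3: "1 - \<rho> < s2" "s2 < 1" "tL < t2" "t2 < tf" using in2 by auto
      define f where "f t = b2 * t - C * (max 0 (t - t1))\<^sup>2" for t
      define f' where "f' t = b2 - C * (2 * max 0 (t - t1))" for t
      have df: "(f has_real_derivative f' t) (at t)" for t unfolding f_def f'_def
        by (rule DERIV_diff[OF _ has_real_derivative_max_0_square]) (auto intro!: derivative_eq_intros)
      have d\<pi>: "((\<lambda>s. \<pi> * s) has_real_derivative \<pi>) (at s)" for s
        by (auto intro!: derivative_eq_intros)
      have "subtangent U (\<lambda>(\<sigma>, \<tau>). \<pi> * \<sigma> + f \<tau>) (s2, t2)" unfolding subtangent_on_def
      proof
        show "C1_near (\<lambda>(\<sigma>, \<tau>). \<pi> * \<sigma> + f \<tau>) (s2, t2)"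
          by (rule C1_near_separable[OF open_UNIV _ d\<pi> _ open_UNIV _ df])
            (auto simp: f'_def intro!: continuous_intros)
        show "\<forall>\<^sub>F y in nhds (s2, t2). y \<in> UNIV \<longrightarrow>
            U (s2, t2) - (case (s2, t2) of (\<sigma>, \<tau>) \<Rightarrow> \<pi> * \<sigma> + f \<tau>) \<le> U y - (case y of (\<sigma>, \<tau>) \<Rightarrow> \<pi> * \<sigma> + f \<tau>)"
        proof (rule eventually_nhds_box[OF in3])
          fix \<sigma> \<tau> assume "1 - \<rho> < \<sigma>" "\<sigma> < 1" "tL < \<tau>" "\<tau> < tf"
          then have "F (s2, t2) \<le> F (\<sigma>, \<tau>)" using z(2)[of "(\<sigma>, \<tau>)"] by (auto simp: z2 K_def)
          then show "(\<sigma>, \<tau>) \<in> UNIV \<longrightarrow> U (s2, t2) - (case (s2, t2) of (\<sigma>, \<tau>) \<Rightarrow> \<pi> * \<sigma> + f \<tau>)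
              \<le> U (\<sigma>, \<tau>) - (case (\<sigma>, \<tau>) of (\<sigma>, \<tau>) \<Rightarrow> \<pi> * \<sigma> + f \<tau>)"
            by (simp add: F_def W_def f_def algebra_simps)
        qed
      qed
      from super[OF _ _ _ this] have "0 \<le> f' t2 + h s2 \<pi>"
        using in3 \<rho> tL by (simp add: deriv_separable[OF d\<pi> df])
      moreover have "f' t2 \<le> b2" using C(1) by (simp add: f'_def)
      moreover have "b2 + h s2 \<pi> < 0" using in3 \<rho> by (intro hneg) auto
      ultimately show False by simp
    qed
    show "\<exists>r>0. \<forall>s\<in>{0..1}. \<forall>t. \<bar>s - 1\<bar> < r \<and> \<bar>t - t0\<bar> < r \<longrightarrow>
       U (1, t0) + a * (t - t0) + \<pi> * (s - 1) - \<epsilon> * (\<bar>s - 1\<bar> + \<bar>t - t0\<bar>) \<le> U (s, t)"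
    proof (intro exI conjI ballI allI impI, rule r(1))
      fix s t assume s: "s \<in> {0..1}" and st: "\<bar>s - 1\<bar> < r \<and> \<bar>t - t0\<bar> < r"
      have z: "\<bar>s - 1\<bar> = 1 - s" "0 \<le> \<epsilon> * (1 - s)" using s \<epsilon> by auto
      show "U (1, t0) + a * (t - t0) + \<pi> * (s - 1) - \<epsilon> * (\<bar>s - 1\<bar> + \<bar>t - t0\<bar>) \<le> U (s, t)"
      proof (cases "t \<le> t0")
        case True
        then have "\<bar>t - t0\<bar> = t0 - t" by simp
        moreover have "u0 - a2 * (t0 - t) + \<pi> * (s - 1) \<le> U (s, t)" using True s st by (intro main) auto
        moreover have "\<epsilon>1 * (t0 - t) \<le> \<epsilon> * (t0 - t)" using \<epsilon>1 True by (intro mult_right_mono) auto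
        ultimately show ?thesis using z unfolding a2_def u0_def[symmetric] by (simp add: algebra_simps)
      next
        case False
        then have "\<bar>t - t0\<bar> = t - t0" by simp
        moreover have "u0 + b * (t - t0) + q * (s - 1) - l * (\<bar>s - 1\<bar> + \<bar>t - t0\<bar>) \<le> U (s, t)"
          using s st r(2) \<rho> by (intro rs(2)) auto
        moreover have "l * (\<bar>s - 1\<bar> + \<bar>t - t0\<bar>) \<le> \<epsilon> * (\<bar>s - 1\<bar> + \<bar>t - t0\<bar>)"
          using l by (intro mult_right_mono) auto
        moreover have "a * (t - t0) \<le> b * (t - t0)" using ab False by (intro mult_right_mono) auto
        moreover have "\<pi> * (s - 1) \<le> q * (s - 1)"
          using k s unfolding \<pi>_def by (intro mult_right_mono_neg) auto
        ultimately show ?thesis unfolding u0_def[symmetric] by linarith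
      qed
    qed
  qed
  moreover have "a + h 1 \<pi> < 0" using hneg[of 1] k b2 ab by simp
  ultimately show ?thesis by blast
qed


section \<open>Maximality\<close>

context hj_network
begin

text \<open>
  Near \<open>y\<^sub>0\<close>, a point other than \<open>y\<^sub>0\<close> lies on a single arc up to orientation, so that the antisymmetry
  of \<open>p\<close> makes the profile well defined.
\<close>

lemma cone_profile:
  assumes y0: "y0 \<in> \<Gamma>" and p: "\<And>\<gamma>. \<gamma> \<in> E \<Longrightarrow> p (reversepath \<gamma>) = - p \<gamma>"
    and \<rho>: "\<And>x. x \<in> vertices E \<Longrightarrow> dist x y0 < \<rho> \<Longrightarrow> x = y0"
  obtains f where "f y0 = 0" "\<And>\<gamma> s s0. \<gamma> \<in> E \<Longrightarrow> s \<in> {0..1} \<Longrightarrow> s0 \<in> {0..1} \<Longrightarrow> \<gamma> s0 = y0 \<Longrightarrow>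
      dist (\<gamma> s) y0 < \<rho> \<Longrightarrow> f (\<gamma> s) = p \<gamma> * (s - s0) - \<eta> * \<bar>s - s0\<bar>"
proof -
  define C where "C y k \<longleftrightarrow> (\<exists>\<gamma>\<in>E. \<exists>s\<in>{0..1}. \<exists>s0\<in>{0..1}. \<gamma> s0 = y0 \<and> y = \<gamma> s \<and>
      k = p \<gamma> * (s - s0) - \<eta> * \<bar>s - s0\<bar>)" for y k
  have uniq: "k = p \<gamma> * (s - s0) - \<eta> * \<bar>s - s0\<bar>"
    if C: "C (\<gamma> s) k" and \<gamma>: "\<gamma> \<in> E" "s \<in> {0..1}" "s0 \<in> {0..1}" "\<gamma> s0 = y0" "dist (\<gamma> s) y0 < \<rho>" for \<gamma> s s0 k
  proof -
    obtain \<gamma>' s' s0' where \<gamma>': "\<gamma>' \<in> E" "s' \<in> {0..1}" "s0' \<in> {0..1}" "\<gamma>' s0' = y0" "\<gamma> s = \<gamma>' s'"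
      and k: "k = p \<gamma>' * (s' - s0') - \<eta> * \<bar>s' - s0'\<bar>"
      using C unfolding C_def by blast
    show ?thesis
    proof (cases "0 < s \<and> s < 1")
      case True
      then have "0 < s" "s < 1" by auto
      from arcs_meet[OF \<gamma>(1) \<gamma>'(1) this \<gamma>'(2,5)] show ?thesis
      proof (elim disjE conjE)
        assume 1: "\<gamma>' = \<gamma>" "s' = s"
        then have "\<gamma> s0' = \<gamma> s0" using \<gamma>(4) \<gamma>'(4) by simp
        then have "s0' = s0" by (rule inj_E[OF \<gamma>(1) _ \<gamma>'(3) \<gamma>(3)])
        with 1 k show ?thesis by simp
      next
        assume 2: "\<gamma>' = reversepath \<gamma>" "s' = 1 - s"
        then have "\<gamma> (1 - s0') = \<gamma> s0" using \<gamma>(4) \<gamma>'(4) by (simp add: reversepath_def)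
        then have "1 - s0' = s0" by (rule inj_E[OF \<gamma>(1) _ _ \<gamma>(3)]) (use \<gamma>'(3) in auto)
        then have eq: "s' - s0' = s0 - s" using 2 by simp
        show ?thesis unfolding k eq 2(1) p[OF \<gamma>(1)]
          by (simp add: abs_minus_commute algebra_simps)
      qed
    next
      case False
      \<comment> \<open>An endpoint closer than \<open>\<rho>\<close> to \<open>y0\<close> is
        \<open>y0\<close> itself, where every representation yields the value 0.\<close>
      then have "s = 0 \<or> s = 1" using \<gamma>(2) by auto
      then have "\<gamma> s = y0" using endpoint_vertex[OF \<gamma>(1)] by (intro \<rho> \<gamma>(5)) auto
      then have "\<gamma> s = \<gamma> s0" "\<gamma>' s' = \<gamma>' s0'" using \<gamma>(4) \<gamma>'(4,5) by simp_all
      then have "s = s0" "s' = s0'" using inj_E \<gamma>(1-3) \<gamma>'(1-3) by blast+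
      with k show ?thesis by simp
    qed
  qed
  define f where "f y = (if y = y0 then 0 else SOME k. C y k)" for y
  show ?thesis
  proof (rule that[of f])
    fix \<gamma> s s0 assume \<gamma>: "\<gamma> \<in> E" "s \<in> {0..1}" "s0 \<in> {0..1}" "\<gamma> s0 = y0" "dist (\<gamma> s) y0 < \<rho>"
    show "f (\<gamma> s) = p \<gamma> * (s - s0) - \<eta> * \<bar>s - s0\<bar>"
    proof (cases "\<gamma> s = y0")
      case True
      then have "s = s0" using inj_E[OF \<gamma>(1)] \<gamma> by metis
      with True show ?thesis by (simp add: f_def)
    next
      case False
      have "C (\<gamma> s) (p \<gamma> * (s - s0) - \<eta> * \<bar>s - s0\<bar>)" unfolding C_def using \<gamma> by blast
      then have "C (\<gamma> s) (SOME k. C (\<gamma> s) k)" by (rule someI)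
      from uniq[OF this \<gamma>] False show ?thesis by (simp add: f_def)
    qed
  qed (simp add: f_def)
qed

text \<open>This is where the maximality of the Perron function is used: the maximum of
  \<open>u\<close> and a lifted cone would be a candidate exceeding \<open>u\<close> at
  \<open>(y0, t0)\<close>. Interior points and vertices are treated together, since the hypotheses
  range over all arcs through \<open>y0\<close> and \<open>vertex\<close> is vacuous inside an
  arc.\<close>

lemma no_strict_subdiff:
  assumes g: "continuous_on \<Gamma> g" and y0: "y0 \<in> \<Gamma>" and t0: "T0 < t0"
    and p: "\<And>\<gamma>. \<gamma> \<in> E \<Longrightarrow> p (reversepath \<gamma>) = - p \<gamma>"
    and sub: "\<And>\<gamma> s0. \<gamma> \<in> E \<Longrightarrow> s0 \<in> {0..1} \<Longrightarrow> \<gamma> s0 = y0 \<Longrightarrow> subdiff (along (perron g) \<gamma>) s0 t0 a (p \<gamma>)"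
    and strict: "\<And>\<gamma> s0. \<gamma> \<in> E \<Longrightarrow> s0 \<in> {0..1} \<Longrightarrow> \<gamma> s0 = y0 \<Longrightarrow> a + H \<gamma> s0 (p \<gamma>) < 0"
    and vertex: "y0 \<in> vertices E \<Longrightarrow> a < c y0"
  shows False
proof -
  define u where "u = perron g"
  note u_sub = perron_subsol[OF g, folded u_def]
  have "\<exists>r>0. \<forall>\<gamma>\<in>E. \<forall>s0\<in>{0..1}. \<gamma> s0 = y0 \<longrightarrow> (\<forall>s\<in>{0..1}. \<bar>s - s0\<bar> < r \<longrightarrow>
      (\<forall>a' p'. \<bar>a' - a\<bar> \<le> r \<longrightarrow> \<bar>p' - p \<gamma>\<bar> \<le> r \<longrightarrow> a' + H \<gamma> s p' < 0))"
  proof (rule finite_E_common_radius)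
    fix \<gamma> assume \<gamma>: "\<gamma> \<in> E"
    show "\<exists>r>0. \<forall>s0\<in>{0..1}. \<gamma> s0 = y0 \<longrightarrow> (\<forall>s\<in>{0..1}. \<bar>s - s0\<bar> < r \<longrightarrow>
      (\<forall>a' p'. \<bar>a' - a\<bar> \<le> r \<longrightarrow> \<bar>p' - p \<gamma>\<bar> \<le> r \<longrightarrow> a' + H \<gamma> s p' < 0))"
    proof (cases "\<exists>s0\<in>{0..1}. \<gamma> s0 = y0")
      case True
      then obtain s0 where s0: "s0 \<in> {0..1}" "\<gamma> s0 = y0" by blast
      have only: "s = s0" if "s \<in> {0..1}" "\<gamma> s = y0" for s using inj_E[OF \<gamma>] s0 that by metis
      define m where "m = - (a + H \<gamma> s0 (p \<gamma>))"
      have m: "m > 0" using strict[OF \<gamma> s0] by (simp add: m_def)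
      obtain d where d: "d > 0" "\<And>y. y \<in> {0..1} \<times> UNIV \<Longrightarrow> dist y (s0, p \<gamma>) < d \<Longrightarrow>
          dist (case y of (s, p) \<Rightarrow> H \<gamma> s p) (H \<gamma> s0 (p \<gamma>)) < m / 2"
        using H_continuous[OF \<gamma>, unfolded continuous_on_iff, rule_format, of "(s0, p \<gamma>)" "m / 2"] s0 m
        by auto
      define r where "r = min (d / 4) (m / 4)"
      have r: "r > 0" "r \<le> d / 4" "r \<le> m / 4" unfolding r_def using d(1) m by auto
      have "a' + H \<gamma> s p' < 0" if "s \<in> {0..1}" "\<bar>s - s0\<bar> < r" "\<bar>a' - a\<bar> \<le> r" "\<bar>p' - p \<gamma>\<bar> \<le> r" for s a' p'
      proof -
        have "dist (s, p') (s0, p \<gamma>) \<le> \<bar>s - s0\<bar> + \<bar>p' - p \<gamma>\<bar>"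
          using real_sqrt_sum_squares_triangle_ineq[of "s - s0" 0 0 "p' - p \<gamma>"]
          by (simp add: dist_Pair_Pair dist_real_def)
        also have "\<dots> < d" using that r d(1) by linarith
        finally have "dist (H \<gamma> s p') (H \<gamma> s0 (p \<gamma>)) < m / 2" using d(2)[of "(s, p')"] that(1) by auto
        then have "\<bar>H \<gamma> s p' - H \<gamma> s0 (p \<gamma>)\<bar> < m / 2" by (simp add: dist_real_def)
        moreover have "a + H \<gamma> s0 (p \<gamma>) = - m" by (simp add: m_def)
        ultimately show ?thesis using that(3) r(3) m by linarith
      qed
      with only r(1) show ?thesis by blast
    next
      case False
      then show ?thesis by (intro exI[of _ 1]) auto
    qed
  next
    fix \<gamma> and r r' :: real
    assume A: "\<forall>s0\<in>{0..1}. \<gamma> s0 = y0 \<longrightarrow> (\<forall>s\<in>{0..1}. \<bar>s - s0\<bar> < r \<longrightarrow>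
      (\<forall>a' p'. \<bar>a' - a\<bar> \<le> r \<longrightarrow> \<bar>p' - p \<gamma>\<bar> \<le> r \<longrightarrow> a' + H \<gamma> s p' < 0))" and r: "0 < r'" "r' \<le> r"
    show "\<forall>s0\<in>{0..1}. \<gamma> s0 = y0 \<longrightarrow> (\<forall>s\<in>{0..1}. \<bar>s - s0\<bar> < r' \<longrightarrow>
      (\<forall>a' p'. \<bar>a' - a\<bar> \<le> r' \<longrightarrow> \<bar>p' - p \<gamma>\<bar> \<le> r' \<longrightarrow> a' + H \<gamma> s p' < 0))"
    proof (intro ballI allI impI)
      fix s0 s a' p' assume B: "s0 \<in> {0..1}" "\<gamma> s0 = y0" "s \<in> {0..1}" "\<bar>s - s0\<bar> < r'"
        "\<bar>a' - a\<bar> \<le> r'" "\<bar>p' - p \<gamma>\<bar> \<le> r'"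
      then have C: "\<bar>s - s0\<bar> < r" "\<bar>a' - a\<bar> \<le> r" "\<bar>p' - p \<gamma>\<bar> \<le> r" using r by linarith+
      show "a' + H \<gamma> s p' < 0" by (rule A[rule_format, OF B(1-3) C])
    qed
  qed
  then obtain r1 where r1: "r1 > 0"
    and all: "\<forall>\<gamma>\<in>E. \<forall>s0\<in>{0..1}. \<gamma> s0 = y0 \<longrightarrow> (\<forall>s\<in>{0..1}. \<bar>s - s0\<bar> < r1 \<longrightarrow>
      (\<forall>a' p'. \<bar>a' - a\<bar> \<le> r1 \<longrightarrow> \<bar>p' - p \<gamma>\<bar> \<le> r1 \<longrightarrow> a' + H \<gamma> s p' < 0))"
    by (elim exE conjE)
  note r1 = r1 all[rule_format]
  \<comment> \<open>The opening of the cone, which is also the deviation of its supertangents from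
    the slopes \<open>a\<close> and \<open>p \<gamma>\<close>. It must preserve strictness on the
    arcs and, at a vertex, the bound by \<open>c y0\<close>.\<close>
  define \<eta> where "\<eta> = (if y0 \<in> vertices E then min r1 (c y0 - a) else r1)"
  have \<eta>: "\<eta> > 0" "\<eta> \<le> r1" "y0 \<in> vertices E \<Longrightarrow> a + \<eta> \<le> c y0"
    unfolding \<eta>_def using r1(1) vertex by auto
  \<comment> \<open>Relative to the affine function, \<open>u\<close> falls at rate at most
    \<open>\<epsilon>\<close> and the cone at rate \<open>2 * \<epsilon>\<close>, so a lift by
    \<open>\<epsilon> * \<kappa>\<close> is used up at distance \<open>\<kappa>\<close>.\<close>
  define \<epsilon> where "\<epsilon> = \<eta> / 2"
  have \<epsilon>: "\<epsilon> > 0" unfolding \<epsilon>_def using \<eta> by simp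
  have "\<exists>r>0. \<forall>\<gamma>\<in>E. \<forall>s0\<in>{0..1}. \<gamma> s0 = y0 \<longrightarrow> (\<forall>s\<in>{0..1}. \<forall>t. \<bar>s - s0\<bar> < r \<and> \<bar>t - t0\<bar> < r \<longrightarrow>
      u (y0, t0) + a * (t - t0) + p \<gamma> * (s - s0) - \<epsilon> * (\<bar>s - s0\<bar> + \<bar>t - t0\<bar>) \<le> u (\<gamma> s, t))"
  proof (rule finite_E_common_radius)
    fix \<gamma> assume \<gamma>: "\<gamma> \<in> E"
    show "\<exists>r>0. \<forall>s0\<in>{0..1}. \<gamma> s0 = y0 \<longrightarrow> (\<forall>s\<in>{0..1}. \<forall>t. \<bar>s - s0\<bar> < r \<and> \<bar>t - t0\<bar> < r \<longrightarrow>
      u (y0, t0) + a * (t - t0) + p \<gamma> * (s - s0) - \<epsilon> * (\<bar>s - s0\<bar> + \<bar>t - t0\<bar>) \<le> u (\<gamma> s, t))"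
    proof (cases "\<exists>s0\<in>{0..1}. \<gamma> s0 = y0")
      case True
      then obtain s0 where s0: "s0 \<in> {0..1}" "\<gamma> s0 = y0" by blast
      have only: "s = s0" if "s \<in> {0..1}" "\<gamma> s = y0" for s using inj_E[OF \<gamma>] s0 that by metis
      have "\<exists>r>0. \<forall>s\<in>{0..1}. \<forall>t. \<bar>s - s0\<bar> < r \<and> \<bar>t - t0\<bar> < r \<longrightarrow>
        u (y0, t0) + a * (t - t0) + p \<gamma> * (s - s0) - \<epsilon> * (\<bar>s - s0\<bar> + \<bar>t - t0\<bar>) \<le> u (\<gamma> s, t)"
        using sub[OF \<gamma> s0, folded u_def, unfolded subdiff_def, rule_format, OF \<epsilon>] s0(2) by (simp add: along_def)
      with only show ?thesis by metis
    next
      case False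
      then show ?thesis by (intro exI[of _ 1]) auto
    qed
  qed (meson less_le_trans)
  then obtain r2 where r2: "r2 > 0"
    and all: "\<forall>\<gamma>\<in>E. \<forall>s0\<in>{0..1}. \<gamma> s0 = y0 \<longrightarrow> (\<forall>s\<in>{0..1}. \<forall>t. \<bar>s - s0\<bar> < r2 \<and> \<bar>t - t0\<bar> < r2 \<longrightarrow>
      u (y0, t0) + a * (t - t0) + p \<gamma> * (s - s0) - \<epsilon> * (\<bar>s - s0\<bar> + \<bar>t - t0\<bar>) \<le> u (\<gamma> s, t))"
    by (elim exE conjE)
  note r2 = r2 all[rule_format, OF _ _ _ _ conjI]
  define r where "r = min r1 r2"
  have r: "r > 0" "r \<le> r1" "r \<le> r2" unfolding r_def using r1 r2 by auto
  obtain \<rho>0 where \<rho>0: "\<rho>0 > 0" "\<And>\<gamma> s. \<gamma> \<in> E \<Longrightarrow> s \<in> {0..1} \<Longrightarrow> dist (\<gamma> s) y0 < \<rho>0 \<Longrightarrow>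
      \<exists>s0\<in>{0..1}. \<gamma> s0 = y0 \<and> \<bar>s - s0\<bar> < r"
    using near_coordinate[OF r(1), of y0] by blast
  obtain \<rho>1 where \<rho>1: "\<rho>1 > 0" "\<And>x. x \<in> vertices E \<Longrightarrow> x \<noteq> y0 \<Longrightarrow> \<rho>1 \<le> dist y0 x"
    using finite_set_avoid[OF finite_vertices, of y0] by blast
  \<comment> \<open>The four entries give coordinates close to that of \<open>y0\<close>, exclude
    other vertices, keep the subdifferential bound valid in time, and separate \<open>N\<close> from
    the initial time.\<close>
  define \<rho> where "\<rho> = Min {\<rho>0, \<rho>1, r, t0 - T0}"
  have \<rho>: "\<rho> > 0" "\<rho> \<le> \<rho>0" "\<rho> \<le> \<rho>1" "\<rho> \<le> r" "\<rho> \<le> t0 - T0"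
    unfolding \<rho>_def using \<rho>0 \<rho>1 r t0 by auto
  have \<rho>v: "x = y0" if "x \<in> vertices E" "dist x y0 < \<rho>" for x
    using \<rho>1(2)[OF that(1)] that(2) \<rho>(3) by (force simp: dist_commute)
  have coord: "\<exists>s0\<in>{0..1}. \<gamma> s0 = y0 \<and> \<bar>s - s0\<bar> < r" if "\<gamma> \<in> E" "s \<in> {0..1}" "dist (\<gamma> s) y0 < \<rho>" for \<gamma> s
    using \<rho>0(2)[OF that(1,2)] that(3) \<rho>(2) by simp
  have "\<exists>r>0. \<forall>\<gamma>\<in>E. \<forall>s0\<in>{0..1}. \<gamma> s0 = y0 \<longrightarrow> (\<forall>s\<in>{0..1}. \<bar>s - s0\<bar> < r \<longrightarrow> dist (\<gamma> s) y0 < \<rho>)"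
  proof (rule finite_E_common_radius)
    fix \<gamma> assume \<gamma>: "\<gamma> \<in> E"
    show "\<exists>r>0. \<forall>s0\<in>{0..1}. \<gamma> s0 = y0 \<longrightarrow> (\<forall>s\<in>{0..1}. \<bar>s - s0\<bar> < r \<longrightarrow> dist (\<gamma> s) y0 < \<rho>)"
    proof (cases "\<exists>s0\<in>{0..1}. \<gamma> s0 = y0")
      case True
      then obtain s0 where s0: "s0 \<in> {0..1}" "\<gamma> s0 = y0" by blast
      have only: "s = s0" if "s \<in> {0..1}" "\<gamma> s = y0" for s using inj_E[OF \<gamma>] s0 that by metis
      have "\<exists>r>0. \<forall>s\<in>{0..1}. \<bar>s - s0\<bar> < r \<longrightarrow> dist (\<gamma> s) y0 < \<rho>"
        using continuous_E[OF \<gamma>, unfolded continuous_on_iff, rule_format, OF s0(1) \<rho>(1)] s0(2)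
        by (simp add: dist_real_def)
      with only show ?thesis by metis
    next
      case False
      then show ?thesis by (intro exI[of _ 1]) auto
    qed
  qed (meson less_le_trans)
  then obtain r3 where r3: "r3 > 0"
    and all: "\<forall>\<gamma>\<in>E. \<forall>s0\<in>{0..1}. \<gamma> s0 = y0 \<longrightarrow> (\<forall>s\<in>{0..1}. \<bar>s - s0\<bar> < r3 \<longrightarrow> dist (\<gamma> s) y0 < \<rho>)"
    by (elim exE conjE)
  note r3 = r3 all[rule_format]
  \<comment> \<open>All points at coordinate distance at most \<open>\<kappa>\<close> lie in
    \<open>N\<close>, so the cone has dropped below \<open>u\<close> before the boundary of
    \<open>N\<close> is reached.\<close>
  define \<kappa> where "\<kappa> = min r3 \<rho> / 2"
  have \<kappa>: "\<kappa> > 0" "\<kappa> < r3" "\<kappa> < \<rho>" unfolding \<kappa>_def using r3(1) \<rho>(1) by (auto simp: min_def)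
  obtain f where f: "f y0 = 0" "\<And>\<gamma> s s0. \<gamma> \<in> E \<Longrightarrow> s \<in> {0..1} \<Longrightarrow> s0 \<in> {0..1} \<Longrightarrow> \<gamma> s0 = y0 \<Longrightarrow>
      dist (\<gamma> s) y0 < \<rho> \<Longrightarrow> f (\<gamma> s) = p \<gamma> * (s - s0) - \<eta> * \<bar>s - s0\<bar>"
    using cone_profile[where p = p and \<eta> = \<eta>, OF y0 p \<rho>v] by blast
  define \<psi> where "\<psi> = (\<lambda>(y, t). u (y0, t0) + \<epsilon> * \<kappa> + a * (t - t0) - \<eta> * \<bar>t - t0\<bar> + f y)"
  define N where "N = {(y, t). dist y y0 < \<rho> \<and> \<bar>t - t0\<bar> < \<rho>}"
  \<comment> \<open>The profile \<open>f\<close> is controlled only within \<open>\<rho>\<close> of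
    \<open>y0\<close>, which is why the maximum is confined to \<open>N\<close>.\<close>
  define w where "w z = (if z \<in> N then max (u z) (\<psi> z) else u z)" for z
  define cone where "cone \<gamma> s0 = (\<lambda>(s, t). u (y0, t0) + \<epsilon> * \<kappa> + a * (t - t0) + p \<gamma> * (s - s0)
      - \<eta> * (\<bar>s - s0\<bar> + \<bar>t - t0\<bar>))" for \<gamma> s0
  have \<psi>_cone: "\<psi> (\<gamma> s, t) = cone \<gamma> s0 (s, t)"
    if "\<gamma> \<in> E" "s \<in> {0..1}" "s0 \<in> {0..1}" "\<gamma> s0 = y0" "dist (\<gamma> s) y0 < \<rho>" for \<gamma> s s0 t
    unfolding \<psi>_def cone_def using f(2)[OF that] by (simp add: algebra_simps)
  have cone_le: "cone \<gamma> s0 (s, t) \<le> u (\<gamma> s, t)"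
    if \<gamma>: "\<gamma> \<in> E" "s \<in> {0..1}" "s0 \<in> {0..1}" "\<gamma> s0 = y0" "dist (\<gamma> s) y0 < \<rho>" "\<bar>t - t0\<bar> < \<rho>"
      and far: "\<kappa> \<le> \<bar>s - s0\<bar> + \<bar>t - t0\<bar>" for \<gamma> s s0 t
  proof -
    obtain s0' where "s0' \<in> {0..1}" "\<gamma> s0' = y0" "\<bar>s - s0'\<bar> < r" using coord[OF \<gamma>(1,2,5)] by blast
    then have "\<bar>s - s0\<bar> < r2" using inj_E[OF \<gamma>(1), of s0' s0] \<gamma> r by auto
    moreover have "\<bar>t - t0\<bar> < r2" using \<gamma>(6) \<rho> r by linarith
    ultimately have "u (y0, t0) + a * (t - t0) + p \<gamma> * (s - s0) - \<epsilon> * (\<bar>s - s0\<bar> + \<bar>t - t0\<bar>) \<le> u (\<gamma> s, t)"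
      by (rule r2(2)[OF \<gamma>(1,3,4,2)])
    moreover have "\<epsilon> * \<kappa> \<le> \<epsilon> * (\<bar>s - s0\<bar> + \<bar>t - t0\<bar>)" using far \<epsilon> by (intro mult_left_mono) auto
    moreover have "\<eta> * (\<bar>s - s0\<bar> + \<bar>t - t0\<bar>) = 2 * (\<epsilon> * (\<bar>s - s0\<bar> + \<bar>t - t0\<bar>))" by (simp add: \<epsilon>_def)
    ultimately show ?thesis unfolding cone_def prod.case by linarith
  qed
  have u_le_w: "u z \<le> w z" for z by (simp add: w_def)
  have cont: "continuous_on ({0..1} \<times> {T0..}) (along w \<gamma>)" if \<gamma>: "\<gamma> \<in> E" for \<gamma>
  proof -
    have cu: "continuous_on ({0..1} \<times> {T0..}) (along u \<gamma>)"
      by (rule along_continuous[OF subsolD(1)[OF u_sub] \<gamma>])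
    show ?thesis
    proof (cases "\<exists>s0\<in>{0..1}. \<gamma> s0 = y0")
      case True
      then obtain s0 where s0: "s0 \<in> {0..1}" "\<gamma> s0 = y0" by blast
      \<comment> \<open>Along the arc, membership in \<open>N\<close> can be replaced by the
        condition \<open>h y \<le> \<kappa>\<close>. On the level set \<open>h y = \<kappa>\<close>
        the two expressions for \<open>w\<close> agree, which gives continuity.\<close>
      define h :: "real \<times> real \<Rightarrow> real" where "h = (\<lambda>y. \<bar>fst y - s0\<bar> + \<bar>snd y - t0\<bar>)"
      have eq: "along w \<gamma> y = (if h y \<le> \<kappa> then max (along u \<gamma> y) (cone \<gamma> s0 y) else along u \<gamma> y)"
        if y: "y \<in> {0..1} \<times> {T0..}" for y
      proof -
        obtain s t where st: "y = (s, t)" "s \<in> {0..1}" using y by auto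
        show ?thesis
        proof (cases "h y \<le> \<kappa>")
          case True
          then have "\<bar>s - s0\<bar> < r3" "\<bar>t - t0\<bar> < \<rho>" using \<kappa> by (auto simp: h_def st)
          then have d: "dist (\<gamma> s) y0 < \<rho>" "(\<gamma> s, t) \<in> N" using r3(2)[OF \<gamma> s0 st(2)] by (auto simp: N_def)
          then show ?thesis using True \<psi>_cone[OF \<gamma> st(2) s0 d(1)] by (simp add: along_def st w_def)
        next
          case False
          have "\<psi> (\<gamma> s, t) \<le> u (\<gamma> s, t)" if "(\<gamma> s, t) \<in> N"
            using \<psi>_cone[OF \<gamma> st(2) s0] cone_le[OF \<gamma> st(2) s0, of t] that False
            by (auto simp: N_def h_def st)
          then show ?thesis using False by (auto simp: along_def st w_def max_def)
        qed
      qed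
      have "continuous_on ({0..1} \<times> {T0..})
          (\<lambda>y. if h y \<le> \<kappa> then max (along u \<gamma> y) (cone \<gamma> s0 y) else along u \<gamma> y)"
      proof (rule continuous_on_cases_le)
        have "continuous_on A (cone \<gamma> s0)" for A
          unfolding cone_def case_prod_unfold by (intro continuous_intros)
        then show "continuous_on {x \<in> {0..1} \<times> {T0..}. h x \<le> \<kappa>} (\<lambda>y. max (along u \<gamma> y) (cone \<gamma> s0 y))"
          by (intro continuous_intros continuous_on_subset[OF cu]) auto
        show "continuous_on {x \<in> {0..1} \<times> {T0..}. \<kappa> \<le> h x} (along u \<gamma>)"
          by (rule continuous_on_subset[OF cu]) auto
        show "continuous_on ({0..1} \<times> {T0..}) h" unfolding h_def by (intro continuous_intros)
        show "max (along u \<gamma> y) (cone \<gamma> s0 y) = along u \<gamma> y"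
          if y: "y \<in> {0..1} \<times> {T0..}" "h y = \<kappa>" for y
        proof -
          obtain s t where st: "y = (s, t)" "s \<in> {0..1}" using y(1) by auto
          have "\<bar>s - s0\<bar> < r3" "\<bar>t - t0\<bar> < \<rho>" using \<kappa> y(2) by (auto simp: h_def st)
          moreover from this have "dist (\<gamma> s) y0 < \<rho>" using r3(2)[OF \<gamma> s0 st(2)] by blast
          ultimately have "cone \<gamma> s0 (s, t) \<le> u (\<gamma> s, t)"
            using cone_le[OF \<gamma> st(2) s0] y(2) by (simp add: h_def st)
          then show ?thesis by (simp add: st along_def)
        qed
      qed
      then show ?thesis by (rule continuous_on_eq) (rule eq[symmetric])
    next
      case False
      then have "along u \<gamma> y = along w \<gamma> y" if "y \<in> {0..1} \<times> {T0..}" for y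
        using coord[OF \<gamma>, of "fst y"] that by (auto simp: along_def w_def N_def)
      with cu show ?thesis by (rule continuous_on_eq)
    qed
  qed
  have "subsol w" unfolding subsol_def
  proof (intro conjI ballI allI impI)
    show "continuous_on (\<Gamma> \<times> {T0..}) w" by (rule continuous_on_network_times[OF cont])
  next
    fix \<gamma> s t assume \<gamma>: "\<gamma> \<in> E" and s: "s \<in> {0<..<1::real}" and t: "T0 < t"
    show "sub_arc w \<gamma> s t"
    proof (cases "w (\<gamma> s, t) = u (\<gamma> s, t)")
      case True
      show ?thesis
        by (rule sub_arc_touch[OF subsolD(2)[OF u_sub \<gamma>]]) (use s t True u_le_w in \<open>auto simp: along_def case_prod_unfold\<close>)
    next
      case False
      then have N: "dist (\<gamma> s) y0 < \<rho>" "\<bar>t - t0\<bar> < \<rho>" and w\<psi>: "w (\<gamma> s, t) = \<psi> (\<gamma> s, t)"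
        by (auto simp: w_def N_def max_def split: if_splits)
      have s01: "s \<in> {0..1}" using s by auto
      obtain s0 where s0: "s0 \<in> {0..1}" "\<gamma> s0 = y0" "\<bar>s - s0\<bar> < r" using coord[OF \<gamma> s01 N(1)] by blast
      show ?thesis unfolding sub_arc_def
      proof (intro allI impI)
        fix \<phi> assume sup: "supertangent (along w \<gamma>) \<phi> (s, t)"
        have "continuous_on {0<..<1} \<gamma>"
          by (rule continuous_on_subset[OF continuous_E[OF \<gamma>]]) auto
        then have "\<forall>x\<in>{0<..<1}. isCont \<gamma> x"
          by (simp only: continuous_on_eq_continuous_at[OF open_greaterThanLessThan])
        then have "isCont \<gamma> s" using s by (rule bspec)
        then have "isCont (\<lambda>y. \<gamma> (fst y)) (s, t)"
          by (intro isCont_o2[where g = \<gamma> and f = fst] isCont_fst continuous_ident) (simp only: fst_conv)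
        then have "isCont (\<lambda>y. dist (\<gamma> (fst y)) y0) (s, t)"
          by (intro continuous_dist continuous_const)
        then have "((\<lambda>y. dist (\<gamma> (fst y)) y0) \<longlongrightarrow> dist (\<gamma> s) y0) (nhds (s, t))"
          using tendsto_at_iff_tendsto_nhds[of "\<lambda>y. dist (\<gamma> (fst y)) y0" "(s, t)"]
          unfolding isCont_def by simp
        then have "\<forall>\<^sub>F y in nhds (s, t). dist (\<gamma> (fst y)) y0 < \<rho>"
          using N(1) by (rule order_tendstoD)
        moreover have "\<forall>\<^sub>F y in nhds (s, t). fst y \<in> {0..1} \<and> \<bar>snd y - t0\<bar> < \<rho>"
          by (rule eventually_nhds_box[of 0 _ 1 "t0 - \<rho>" _ "t0 + \<rho>"])
            (use s N in \<open>auto simp: abs_less_iff\<close>)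
        ultimately have "\<forall>\<^sub>F y in nhds (s, t). along w \<gamma> y \<ge> along w \<gamma> (s, t) + a * (snd y - t)
            + p \<gamma> * (fst y - s) - \<eta> * (\<bar>fst y - s\<bar> + \<bar>snd y - t\<bar>)"
        proof eventually_elim
          case (elim y)
          obtain \<sigma> \<tau> where y: "y = (\<sigma>, \<tau>)" by (cases y)
          have "along w \<gamma> y \<ge> \<psi> (\<gamma> \<sigma>, \<tau>)" using elim by (simp add: y along_def w_def N_def)
          moreover have "\<psi> (\<gamma> \<sigma>, \<tau>) = cone \<gamma> s0 (\<sigma>, \<tau>)" using elim s0 by (intro \<psi>_cone \<gamma>) (auto simp: y)
          moreover have "along w \<gamma> (s, t) = cone \<gamma> s0 (s, t)"
            using \<psi>_cone[OF \<gamma> s01 s0(1,2) N(1)] w\<psi> by (simp add: along_def)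
          moreover have "\<eta> * (\<bar>\<sigma> - s0\<bar> + \<bar>\<tau> - t0\<bar>) \<le> \<eta> * ((\<bar>s - s0\<bar> + \<bar>t - t0\<bar>) + (\<bar>\<sigma> - s\<bar> + \<bar>\<tau> - t\<bar>))"
            using \<eta>(1) by (intro mult_left_mono) auto
          ultimately show ?case unfolding cone_def by (simp add: y algebra_simps)
        qed
        from supertangent_slopes[OF sup this]
        have "deriv_t \<phi> s t + H \<gamma> s (deriv_s \<phi> s t) < 0"
          using \<eta>(2) r s0 s01 by (intro r1(2)[OF \<gamma> s0(1,2)]) auto
        then show "deriv_t \<phi> s t + H \<gamma> s (deriv_s \<phi> s t) \<le> 0" by simp
      qed
    qed
  next
    fix x t assume x: "x \<in> vertices E" and t: "T0 < t"
    show "sub_vertex w x t"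
    proof (cases "w (x, t) = u (x, t)")
      case True
      show ?thesis
        by (rule sub_vertex_touch[OF subsolD(3)[OF u_sub x t]]) (use True u_le_w in auto)
    next
      case False
      then have N: "dist x y0 < \<rho>" "\<bar>t - t0\<bar> < \<rho>" and w\<psi>: "w (x, t) = \<psi> (x, t)"
        by (auto simp: w_def N_def max_def split: if_splits)
      have xy: "x = y0" by (rule \<rho>v[OF x N(1)])
      show ?thesis unfolding sub_vertex_def
      proof (intro allI impI)
        fix \<phi> assume sup: "supertangent (\<lambda>t. w (x, t)) \<phi> t"
        have "\<forall>\<^sub>F \<tau> in nhds t. \<tau> \<in> {t0 - \<rho><..<t0 + \<rho>}"
          using N by (intro eventually_nhds_in_open) (auto simp: abs_less_iff)
        then have "\<forall>\<^sub>F \<tau> in nhds t. w (x, \<tau>) \<ge> w (x, t) + a * (\<tau> - t) - \<eta> * \<bar>\<tau> - t\<bar>"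
        proof eventually_elim
          case (elim \<tau>)
          then have "w (x, \<tau>) \<ge> \<psi> (x, \<tau>)" using N by (simp add: w_def N_def abs_less_iff)
          moreover have "\<eta> * \<bar>\<tau> - t0\<bar> \<le> \<eta> * (\<bar>t - t0\<bar> + \<bar>\<tau> - t\<bar>)"
            using \<eta>(1) by (intro mult_left_mono) auto
          ultimately show ?case using w\<psi> by (simp add: \<psi>_def xy f algebra_simps)
        qed
        from supertangent_slope[OF sup this] show "deriv \<phi> t \<le> c x"
          using \<eta>(3) x xy by auto
      qed
    qed
  qed
  moreover have "w (x, T0) \<le> g x" if "x \<in> \<Gamma>" for x
  proof -
    have "(x, T0) \<notin> N" using \<rho>(5) by (auto simp: N_def)
    then show ?thesis using perron_initial[OF g that] by (simp add: w_def u_def)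
  qed
  ultimately have "w \<in> candidates g" by (simp add: candidates_def)
  then have "w (y0, t0) \<le> u (y0, t0)" unfolding u_def using perron_upper[OF g] y0 t0 by auto
  moreover have "w (y0, t0) \<ge> u (y0, t0) + \<epsilon> * \<kappa>" using \<rho>(1) by (simp add: w_def N_def \<psi>_def f)
  moreover have "\<epsilon> * \<kappa> > 0" using \<epsilon> \<kappa>(1) by simp
  ultimately show False by linarith
qed

section \<open>The supersolution property inside arcs and at vertices\<close>

lemma perron_supersolution_interior:
  assumes g: "continuous_on \<Gamma> g" and \<gamma>: "\<gamma> \<in> E" and s: "0 < s" "s < 1" and t: "T0 < t"
    and sub: "subtangent (along (perron g) \<gamma>) \<phi> (s, t)"
  shows "0 \<le> deriv_t \<phi> s t + H \<gamma> s (deriv_s \<phi> s t)"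
proof (rule ccontr)
  assume neg: "\<not> ?thesis"
  define a where "a = deriv_t \<phi> s t"
  define q where "q = deriv_s \<phi> s t"
  have s01: "s \<in> {0..1}" using s by auto
  have "subtangent_on ({0..1} \<times> UNIV) (along (perron g) \<gamma>) \<phi> (s, t)"
    using sub unfolding subtangent_on_def by (auto elim: eventually_mono)
  then have sd: "subdiff (along (perron g) \<gamma>) s t a q"
    unfolding a_def q_def by (rule subtangent_imp_subdiff) simp
  \<comment> \<open>The value 0 is a filler that keeps \<open>p\<close> antisymmetric: by
    \<open>arcs_meet\<close> only \<open>\<gamma>\<close> and its inverse pass through the
    point.\<close>
  define p where "p \<gamma>' = (if \<gamma>' = \<gamma> then q else if \<gamma>' = reversepath \<gamma> then - q else 0)" for \<gamma>'
  have rev: "reversepath \<gamma>' = \<gamma> \<longleftrightarrow> \<gamma>' = reversepath \<gamma>" for \<gamma>' by (metis reversepath_reversepath)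
  have rev': "reversepath \<gamma>' = reversepath \<gamma> \<longleftrightarrow> \<gamma>' = \<gamma>" for \<gamma>' by (metis reversepath_reversepath)
  have p\<gamma>: "p \<gamma> = q" "p (reversepath \<gamma>) = - q"
    using reversepath_neq[OF \<gamma>] by (simp_all add: p_def)
  have branch: "subdiff (along (perron g) \<gamma>') s0 t a (p \<gamma>') \<and> a + H \<gamma>' s0 (p \<gamma>') < 0"
    if \<gamma>': "\<gamma>' \<in> E" "s0 \<in> {0..1}" "\<gamma>' s0 = \<gamma> s" for \<gamma>' s0
  proof -
    have "a + H \<gamma> s q < 0" using neg by (simp add: a_def q_def)
    moreover have "H (reversepath \<gamma>) (1 - s) (- q) = H \<gamma> s q"
      using H_reversepath[OF \<gamma>, of "1 - s" "- q"] s by simp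
    moreover have "subdiff (along (perron g) (reversepath \<gamma>)) (1 - s) t a (- q)"
      by (rule subdiff_reversepath[OF sd])
    ultimately show ?thesis
      using arcs_meet[OF \<gamma> \<gamma>'(1) s \<gamma>'(2) \<gamma>'(3)[symmetric]] sd p\<gamma> by (elim disjE conjE) simp_all
  qed
  show False
  proof (rule no_strict_subdiff[OF g arc_point_in[OF \<gamma> s01] t, of p a])
    show "p (reversepath \<gamma>') = - p \<gamma>'" for \<gamma>'
      using reversepath_neq[OF \<gamma>] by (auto simp: p_def rev rev')
    show "\<gamma> s \<in> vertices E \<Longrightarrow> a < c (\<gamma> s)" using interior_point_not_vertex[OF \<gamma> s] by simp
  qed (use branch in blast)+
qed

text \<open>If the condition fails on every incoming arc, each one provides a subdifferential with
  its own time slope. What links the arcs is the common trace of \<open>u\<close> at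
  \<open>x\<close>: a lower bound for its slope obtained from one arc serves as the trace hypothesis
  of \<open>subdiff_slope_transfer\<close> on all others.\<close>

lemma perron_supersolution_vertex:
  assumes g: "continuous_on \<Gamma> g" and x: "x \<in> vertices E" and t0: "T0 < t0"
    and T: "\<forall>\<^sub>F t in nhds t0. t \<in> T"
    and sub: "subtangent (\<lambda>t. perron g (x, t)) \<phi> t0" and slope: "deriv \<phi> t0 < c x"
  shows "\<exists>\<gamma>\<in>arcs_into E x. \<forall>\<phi>. subtangent_on ({0..1} \<times> T) (along (perron g) \<gamma>) \<phi> (1, t0) \<longrightarrow>
     deriv_t \<phi> 1 t0 + H \<gamma> 1 (deriv_s \<phi> 1 t0) \<ge> 0"
proof (rule ccontr)
  assume neg: "\<not> ?thesis"
  define u where "u = perron g"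
  define A where "A = arcs_into E x"
  have A: "\<gamma> \<in> A \<longleftrightarrow> \<gamma> \<in> E \<and> \<gamma> 1 = x" for \<gamma> by (simp add: A_def arcs_into_def pathfinish_def)
  have "finite A" using finite_E by (simp add: A_def arcs_into_def)
  have "\<exists>b q. subdiff (along u \<gamma>) 1 t0 b q \<and> b + H \<gamma> 1 q < 0" if "\<gamma> \<in> A" for \<gamma>
  proof -
    have "\<exists>\<phi>. subtangent_on ({0..1} \<times> T) (along u \<gamma>) \<phi> (1, t0) \<and>
        \<not> deriv_t \<phi> 1 t0 + H \<gamma> 1 (deriv_s \<phi> 1 t0) \<ge> 0"
      using bspec[OF neg[unfolded bex_simps(8)], of \<gamma>] that by (simp add: A_def u_def)
    then obtain \<phi> where \<phi>: "subtangent_on ({0..1} \<times> T) (along u \<gamma>) \<phi> (1, t0)"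
      "deriv_t \<phi> 1 t0 + H \<gamma> 1 (deriv_s \<phi> 1 t0) < 0" by (elim exE conjE) (simp add: not_le)
    show ?thesis using subtangent_imp_subdiff[OF \<phi>(1) T] \<phi>(2) by (intro exI conjI)
  qed
  then obtain b q where bq: "\<And>\<gamma>. \<gamma> \<in> A \<Longrightarrow> subdiff (along u \<gamma>) 1 t0 (b \<gamma>) (q \<gamma>)"
    "\<And>\<gamma>. \<gamma> \<in> A \<Longrightarrow> b \<gamma> + H \<gamma> 1 (q \<gamma>) < 0" by metis
  \<comment> \<open>Including the slope of \<open>\<phi>\<close> keeps \<open>a\<close> below
    \<open>c x\<close>.\<close>
  define a where "a = Min (insert (deriv \<phi> t0) (b ` A))"
  have "a \<in> insert (deriv \<phi> t0) (b ` A)"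
    unfolding a_def by (rule Min_in) (use \<open>finite A\<close> in auto)
  moreover have "a \<le> deriv \<phi> t0" "\<And>\<gamma>. \<gamma> \<in> A \<Longrightarrow> a \<le> b \<gamma>"
    unfolding a_def using \<open>finite A\<close> by auto
  ultimately have a: "a \<le> deriv \<phi> t0" "\<And>\<gamma>. \<gamma> \<in> A \<Longrightarrow> a \<le> b \<gamma>" "a \<in> insert (deriv \<phi> t0) (b ` A)"
    by blast+
  \<comment> \<open>The minimum is attained by \<open>\<phi>\<close> or by some arc. In the latter
    case the subdifferential of that arc, restricted to \<open>s = 1\<close>, bounds the
    trace.\<close>
  have trace: "\<exists>r>0. \<forall>t. \<bar>t - t0\<bar> < r \<longrightarrow> u (x, t0) + a * (t - t0) - \<epsilon> * \<bar>t - t0\<bar> \<le> u (x, t)"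
    if \<epsilon>: "\<epsilon> > 0" for \<epsilon>
  proof (cases "a = deriv \<phi> t0")
    case True
    then show ?thesis using subtangent_imp_lower_slope[OF sub \<epsilon>] by (simp add: u_def)
  next
    case False
    then obtain \<gamma> where \<gamma>: "\<gamma> \<in> A" "a = b \<gamma>" using a(3) by auto
    obtain r where r: "r > 0" "\<And>s t. s \<in> {0..1} \<Longrightarrow> \<bar>s - 1\<bar> < r \<Longrightarrow> \<bar>t - t0\<bar> < r \<Longrightarrow>
        along u \<gamma> (1, t0) + a * (t - t0) + q \<gamma> * (s - 1) - \<epsilon> * (\<bar>s - 1\<bar> + \<bar>t - t0\<bar>) \<le> along u \<gamma> (s, t)"
      using subdiffD[OF bq(1)[OF \<gamma>(1)] \<epsilon>] unfolding \<gamma>(2) by metis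
    have "\<gamma> 1 = x" using \<gamma>(1) A by simp
    with r(2)[of 1] r(1) show ?thesis by (intro exI[of _ r]) (simp add: along_def)
  qed
  have "\<exists>\<pi>. subdiff (along u \<gamma>) 1 t0 a \<pi> \<and> a + H \<gamma> 1 \<pi> < 0" if \<gamma>: "\<gamma> \<in> A" for \<gamma>
  proof (cases "a = b \<gamma>")
    case True
    then show ?thesis using bq[OF \<gamma>] by auto
  next
    case False
    then have lt: "a < b \<gamma>" using a(2)[OF \<gamma>] by simp
    have \<gamma>E: "\<gamma> \<in> E" "\<gamma> 1 = x" using \<gamma> A by auto
    show ?thesis
    proof (rule subdiff_slope_transfer[OF H_continuous[OF \<gamma>E(1)] _ t0 _ _ bq[OF \<gamma>] lt])
      show "continuous_on ({0..1} \<times> {T0..}) (along u \<gamma>)"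
        unfolding u_def by (rule along_continuous[OF subsolD(1)[OF perron_subsol[OF g]] \<gamma>E(1)])
      show "0 \<le> deriv_t \<phi> s t + H \<gamma> s (deriv_s \<phi> s t)"
        if "0 < s" "s < 1" "T0 < t" "subtangent (along u \<gamma>) \<phi> (s, t)" for s t \<phi>
        using perron_supersolution_interior[OF g \<gamma>E(1)] that unfolding u_def by blast
      show "\<exists>r>0. \<forall>t. \<bar>t - t0\<bar> < r \<longrightarrow>
          along u \<gamma> (1, t0) + a * (t - t0) - \<epsilon> * \<bar>t - t0\<bar> \<le> along u \<gamma> (1, t)" if "\<epsilon> > 0" for \<epsilon>
        using trace[OF that] \<gamma>E(2) by (simp add: along_def)
    qed
  qed
  then obtain \<pi> where \<pi>: "\<And>\<gamma>. \<gamma> \<in> A \<Longrightarrow> subdiff (along u \<gamma>) 1 t0 a (\<pi> \<gamma>)"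
    "\<And>\<gamma>. \<gamma> \<in> A \<Longrightarrow> a + H \<gamma> 1 (\<pi> \<gamma>) < 0" by metis
  \<comment> \<open>Arcs leaving \<open>x\<close> take the negated slope of their inverse. Without
    loops the first two cases exclude each other on \<open>E\<close>, and arcs avoiding
    \<open>x\<close> get the filler 0.\<close>
  define p where "p \<gamma> = (if \<gamma> 1 = x then \<pi> \<gamma> else if \<gamma> 0 = x then - \<pi> (reversepath \<gamma>) else 0)" for \<gamma>
  have ends: "\<gamma> 0 \<noteq> \<gamma> 1" if "\<gamma> \<in> E" for \<gamma>
    using no_loop[OF that] by (simp add: pathstart_def pathfinish_def)
  have rev: "reversepath \<gamma> 1 = \<gamma> 0" "reversepath \<gamma> 0 = \<gamma> 1" for \<gamma> :: "real \<Rightarrow> 'a"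
    by (simp_all add: reversepath_def)
  have branch: "subdiff (along u \<gamma>) s0 t0 a (p \<gamma>) \<and> a + H \<gamma> s0 (p \<gamma>) < 0"
    if \<gamma>: "\<gamma> \<in> E" "s0 \<in> {0..1}" "\<gamma> s0 = x" for \<gamma> s0
  proof (cases "s0 = 1")
    case True
    then have "\<gamma> \<in> A" "p \<gamma> = \<pi> \<gamma>" using \<gamma> A by (auto simp: p_def)
    with True \<pi> show ?thesis by simp
  next
    case False
    have "s0 = 0"
    proof (rule ccontr)
      assume "s0 \<noteq> 0"
      with False \<gamma>(2) have "0 < s0" "s0 < 1" by auto
      from interior_point_not_vertex[OF \<gamma>(1) this] \<gamma>(3) x show False by simp
    qed
    then have \<gamma>0: "\<gamma> 0 = x" using \<gamma>(3) by simp
    have revA: "reversepath \<gamma> \<in> A" using A reversepath_E[OF \<gamma>(1)] rev \<gamma>0 by simp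
    have "\<gamma> 1 \<noteq> x" using ends[OF \<gamma>(1)] \<gamma>0 by auto
    then have "p \<gamma> = - \<pi> (reversepath \<gamma>)" using \<gamma>0 by (simp add: p_def)
    moreover have "subdiff (along u \<gamma>) 0 t0 a (- \<pi> (reversepath \<gamma>))"
      using subdiff_reversepath[OF \<pi>(1)[OF revA]] by simp
    moreover have "H \<gamma> 0 (- \<pi> (reversepath \<gamma>)) = H (reversepath \<gamma>) 1 (\<pi> (reversepath \<gamma>))"
      using H_reversepath[OF \<gamma>(1), of 1] by simp
    ultimately show ?thesis using \<open>s0 = 0\<close> \<pi>(2)[OF revA] by simp
  qed
  show False
  proof (rule no_strict_subdiff[OF g vertex_in[OF x] t0, of p a])
    show "p (reversepath \<gamma>) = - p \<gamma>" if "\<gamma> \<in> E" for \<gamma>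
      using ends[OF that] by (auto simp: p_def rev)
    show "a < c x" using a(1) slope by simp
  qed (use branch in \<open>unfold u_def, blast\<close>)+
qed

lemma perron_solution:
  assumes g: "continuous_on \<Gamma> g"
  shows "HJ_solution T0 T1 E H c (perron g)"
proof -
  note sub = perron_subsol[OF g]
  have cont: "continuous_on (\<Gamma> \<times> time_domain T0 T1) (perron g)"
    by (rule continuous_on_subset[OF subsolD(1)[OF sub]]) (auto simp: time_domain_def)
  have times: "T0 < t" if "t \<in> open_times T0 T1" for t using that by (simp add: open_times_def)
  \<comment> \<open>Openness makes the closure a neighbourhood of every time in question, so the
    constraint in time has no effect on the test functions.\<close>
  have "open_times T0 T1 = {T0<..} \<inter> ereal -` {..<T1}" by (auto simp: open_times_def)
  moreover have "open (ereal -` {..<T1})" by (intro open_ereal_vimage open_lessThan)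
  ultimately have "open (open_times T0 T1)" by (simp add: open_Int)
  then have near: "\<forall>\<^sub>F t in nhds t0. t \<in> closure (open_times T0 T1)" if "t0 \<in> open_times T0 T1" for t0
    using eventually_nhds_in_open[of "open_times T0 T1" t0] that closure_subset
    by (auto elim!: eventually_mono)
  have "HJ_subsolution T0 T1 E H c (perron g)"
    unfolding HJ_subsolution_def HJ_arc_subsolution_def
    using cont subsolD(2,3)[OF sub] times unfolding sub_arc_def sub_vertex_def by auto
  moreover have "HJ_supersolution T0 T1 E H c (perron g)"
    unfolding HJ_supersolution_def HJ_arc_supersolution_def
  proof (intro conjI ballI allI impI)
    show "0 \<le> deriv_t \<phi> s t + H \<gamma> s (deriv_s \<phi> s t)"
      if "\<gamma> \<in> E" "s \<in> {0<..<1}" "t \<in> open_times T0 T1" "subtangent (along (perron g) \<gamma>) \<phi> (s, t)"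
      for \<gamma> s t \<phi>
      by (rule perron_supersolution_interior[OF g that(1) _ _ times[OF that(3)] that(4)])
        (use that(2) in auto)
  next
    fix x t0 assume x: "x \<in> vertices E" and t0: "t0 \<in> open_times T0 T1"
      and "\<exists>\<phi>. subtangent (\<lambda>t. perron g (x, t)) \<phi> t0 \<and> deriv \<phi> t0 < c x"
    then obtain \<phi> where "subtangent (\<lambda>t. perron g (x, t)) \<phi> t0" "deriv \<phi> t0 < c x" by blast
    then show "\<exists>\<gamma>\<in>arcs_into E x. \<forall>\<phi>.
        subtangent_on ({0..1} \<times> closure (open_times T0 T1)) (along (perron g) \<gamma>) \<phi> (1, t0) \<longrightarrow>
        deriv_t \<phi> 1 t0 + H \<gamma> 1 (deriv_s \<phi> 1 t0) \<ge> 0"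
      by (rule perron_supersolution_vertex[OF g x times[OF t0] near[OF t0]])
  qed (rule cont)
  ultimately show ?thesis by (simp add: HJ_solution_def)
qed

end

theorem proposition7p6:
  fixes E :: "(real \<Rightarrow> real ^ 'n) set"
    and H :: "(real \<Rightarrow> real ^ 'n) \<Rightarrow> real \<Rightarrow> real \<Rightarrow> real"
    and T0 :: real and T1 :: ereal
    and g c :: "real ^ 'n \<Rightarrow> real"
  assumes "0 \<le> T0" and "ereal T0 < T1"
    and "network E" and "hamiltonians E H"
    and "continuous_on (network_set E) g"
    and "flux_limiter E H c"
  shows "\<exists>u :: (real ^ 'n) \<times> real \<Rightarrow> real.
           HJ_solution T0 T1 E H c u \<and>
           uniformly_continuous_on (network_set E \<times> time_domain T0 T1) u \<and>
           (\<forall>x\<in>network_set E. u (x, T0) = g x)"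
proof -
  interpret hj_network E H c T0
    by standard (rule assms)+
  have "uniformly_continuous_on (network_set E \<times> time_domain T0 T1) (perron g)"
    unfolding uniformly_continuous_on_def
  proof (intro allI impI)
    fix e :: real assume "e > 0"
    then obtain d where "d > 0" "\<forall>z\<in>network_set E \<times> {T0..}. \<forall>z'\<in>network_set E \<times> {T0..}.
        dist z' z < d \<longrightarrow> dist (perron g z') (perron g z) < e"
      using perron_uniformly_continuous[OF assms(5)] unfolding uniformly_continuous_on_def by blast
    then show "\<exists>d>0. \<forall>z\<in>network_set E \<times> time_domain T0 T1. \<forall>z'\<in>network_set E \<times> time_domain T0 T1.
        dist z' z < d \<longrightarrow> dist (perron g z') (perron g z) < e"
      by (intro exI[of _ d]) (auto simp: time_domain_def)
  qed
  with perron_solution[OF assms(5)] perron_initial[OF assms(5)] show ?thesis by blast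
qed

end
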